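(* Let $C_0,C_1,C_2,\ldots$ be independent and identically distributed complex-valued random variables with absolutely continuous distribution, and suppose $\mathbb{E}[|C_0|^t]<\infty$ for some $t>0$. Let $P_n(z)=\sum_{k=0}^n C_k z^k$, let $r\in(0,1)$ and $0\le\alpha<\beta<2\pi$. Then for all sufficiently large $n\in\mathbb{N}$, $$\mathbb{E}\left[\left|\tau_n\left(A_r(\alpha,\beta)\right)-\frac{\beta-\alpha}{2\pi}\right|\right]\le\left(\sqrt{\frac{2\pi}{\mathbf{k}}}+\frac{2}{1-r}\right)\sqrt{\frac{\frac{t+2}{2t}\log(n+1)+\frac1t\log\mathbb{E}[|C_0|^t]+\frac{1}{2e}-\mathbb{E}[\log|C_0|]}{n}}.$$
   Context: $\mathbf{k}=\sum_{k=0}^\infty(-1)^k/(2k+1)^2$ is Catalan's constant. "Absolutely continuous" means having a density with respect to area measure on $\mathbb{C}$; in particular $C_0C_n\ne0$ almost surely, so $P_n$ has degree $n$ almost surely. $\tau_n=\frac1n\sum_{k=1}^n\delta_{Z_k}$ is the normalized counting measure of the $n$ complex zeros $Z_1,\dots,Z_n$ of $P_n$ (with multiplicity). The annular sector is $A_r(\alpha,\beta)=\{z\in\mathbb{C}: r<|z|<1/r,\ \alpha\le\arg z<\beta\}$, with $\arg z\in[0,2\pi)$. The expectation $\mathbb{E}[\log|C_0|]$ takes values in $[-\infty,\infty)$; if it equals $-\infty$, the right-hand side is read as $+\infty$. *)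

theory Defs
  imports
    "HOL-Probability.Probability"
    "HOL-Computational_Algebra.Fundamental_Theorem_Algebra"
begin

definition catalan_constant :: real where
  "catalan_constant = (\<Sum>k. (-1) ^ k / (2 * real k + 1) ^ 2)"

definition random_poly :: "(nat \<Rightarrow> 'a \<Rightarrow> complex) \<Rightarrow> nat \<Rightarrow> 'a \<Rightarrow> complex poly" where
  "random_poly C n \<omega> = (\<Sum>k\<le>n. monom (C k \<omega>) k)"

text \<open>
  The set function \<open>\<tau>\<^sub>n = 1/n \<Sum>\<^sub>k \<delta>\<^bsub>Z\<^sub>k\<^esub>\<close>, where the \<open>Z\<^sub>k\<close> run through the multiset of complex
  zeros of \<open>p\<close>.  There are \<open>n\<close> of them if \<open>p\<close> has degree \<open>n\<close>; the factor is always \<open>1/n\<close>.  The zero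
  polynomial gets the empty multiset of zeros.
\<close>

definition zero_counting :: "nat \<Rightarrow> complex poly \<Rightarrow> complex set \<Rightarrow> real" where
  "zero_counting n p A = (1 / real n) * (\<Sum>z\<in>#proots p. indicator A z)"

text \<open>\<open>Arg2pi\<close> is the library's argument function with values in \<open>[0, 2\<pi>)\<close>.\<close>

definition annular_sector :: "real \<Rightarrow> real \<Rightarrow> real \<Rightarrow> complex set" where
  "annular_sector r \<alpha> \<beta> = {z. r < norm z \<and> norm z < 1 / r \<and> \<alpha> \<le> Arg2pi z \<and> Arg2pi z < \<beta>}"

text \<open>
  Expectation with values in the extended reals, \<open>E[X\<^sup>+] - E[X\<^sup>-]\<close>, since \<open>ennreal\<close> truncates negative
  reals to 0.  It is meaningful when at least one of the two parts is finite; unlike the Bochner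
  integral it does not return 0 when \<open>X\<close> is not integrable.
\<close>

definition ext_expectation :: "'a measure \<Rightarrow> ('a \<Rightarrow> real) \<Rightarrow> ereal" where
  "ext_expectation M X =
     enn2ereal (\<integral>\<^sup>+\<omega>. ennreal (X \<omega>) \<partial>M) - enn2ereal (\<integral>\<^sup>+\<omega>. ennreal (- X \<omega>) \<partial>M)"

text \<open>The value at \<open>-\<infinity>\<close>, 0, is arbitrary.\<close>

definition ereal_sqrt :: "ereal \<Rightarrow> ereal" where
  "ereal_sqrt x = (if x = \<infinity> then \<infinity> else ereal (sqrt (real_of_ereal x)))"

end

theory Submission
  imports Defs
begin

text \<open>
  The randomness enters only through the size of the coefficients.  For a polynomial \<open>p\<close> with
  coefficients \<open>c\<^sub>0, \<dots>, c\<^sub>n\<close>, \<open>c\<^sub>0 c\<^sub>n \<noteq> 0\<close>, put \<open>h = 1/2 ln (2 \<Sum>|c\<^sub>k|\<^sup>2 / |c\<^sub>0 c\<^sub>n|)\<close>.  An Erdos-Turan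
  inequality (\<open>annular_sector_discrepancy\<close>) says that the proportion of zeros in an annular sector
  differs from \<open>(\<beta> - \<alpha>) / (2 \<pi>)\<close> by at most \<open>(4 / sqrt \<pi> + 2 / (1 - r)) sqrt (h / n)\<close>.  Catalan's
  constant is at most 1 and \<open>16 \<le> 2 \<pi>\<^sup>2\<close>, so \<open>4 / sqrt \<pi>\<close> is at most the constant that is claimed.

  \<^bold>\<open>Arguments of the zeros.\<close>  For a real trigonometric polynomial \<open>F(\<theta>) = Re \<Sum> c\<^sub>k e\<^bsup>ik\<theta>\<^esup>\<close> let
  \<open>G(\<theta>) = Re \<Sum> k c\<^sub>k e\<^bsup>ik\<theta>\<^esup>\<close>, the derivative of the conjugate of \<open>F\<close>.  From the series of \<open>ln (1 - x)\<close>,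
  the average over the circle of \<open>(1 - G(\<phi>) / B) ln |e\<^bsup>i\<phi>\<^esup> - e\<^bsup>i\<theta>\<^esup>|\<close> is \<open>(F(\<theta>) - mean F) / (2 B)\<close>
  (\<open>circle_avg_log_potential\<close>).  If \<open>|G| \<le> B\<close>, the weight \<open>1 - G / B\<close> is a density between 0 and 2.
  Moving every zero radially to the circle decreases each \<open>|e\<^bsup>i\<phi>\<^esup> - z|\<^sup>2 / |z|\<close>, so concavity of the
  logarithm and Parseval's identity give \<open>\<Sum>\<^sub>j (F(arg z\<^sub>j) - mean F) \<le> 2 B h\<close>
  (\<open>weighted_jensen\<close>, \<open>trig_sum_at_roots_le\<close>).  Now let \<open>F\<close> approximately dominate the indicator of an
  arc of half-width \<open>l\<close>, with transition zones of width proportional to \<open>d\<close>.  Its mean is at most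
  \<open>(l + d) / \<pi>\<close>.  Since \<open>G\<close> is an average of the second differences of \<open>F\<close> against
  \<open>1 / (4 sin\<^sup>2 (t / 2))\<close>, the bounds \<open>0 \<le> F \<le> 1\<close> and \<open>2 t\<^sup>2 / d\<^sup>2\<close> for the second differences suffice for
  \<open>B = 2 / d\<close> (\<open>conjugate_derivative_bound\<close>).  So the arc contains at most
  \<open>n l / \<pi> + n d / \<pi> + 4 h / d\<close> arguments of zeros, and the best \<open>d\<close> yields \<open>n l / \<pi> + 4 sqrt (n h / \<pi>)\<close>
  (\<open>card_args_in_arc_le\<close>).  The lower bound is the upper bound for the complementary arc.

  \<^bold>\<open>Moduli of the zeros.\<close>  The same inequality with weight 1 is Jensen's formula in disguise.  A zero
  with \<open>|z| \<le> r\<close> or \<open>|z| \<ge> 1 / r\<close> can be moved to modulus \<open>r\<close> at a gain of a factor \<open>r\<close>; so there are at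
  most \<open>2 h / ln (1 / r) \<le> 2 h / (1 - r)\<close> of them (\<open>card_roots_off_annulus\<close>).

  \<^bold>\<open>Expectation.\<close>  The height \<open>h\<close> is at most a sum of functions of one coefficient each
  (\<open>half_ln_sum_squares_le\<close>), so its expectation follows from the common law of the coefficients by
  linearity, and \<open>E sqrt (h / n) \<le> sqrt (E h / n)\<close>.  The term \<open>1/2 ln 2\<close> from the weight being at most 2
  replaces \<open>1 / (2 e)\<close>, which is smaller.  But only \<open>max (1/t) (1/2)\<close> of the coefficient
  \<open>1/t + 1/2\<close> of \<open>ln (n + 1)\<close> is consumed; the rest absorbs \<open>1/2 ln 2\<close> for large \<open>n\<close>.

  \<^bold>\<open>Measurability.\<close>  An annular sector is a countable union of compact sets.  The coefficient vectors of
  polynomials with at least \<open>m\<close> zeros in such a set are the image of a \<open>\<sigma>\<close>-compact set under the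
  continuous map that multiplies \<open>m\<close> linear factors and a cofactor; so they form a Borel set
  (\<open>many_roots_measurable\<close>).
\<close>

section \<open>Averages over the unit circle\<close>

definition circle_avg :: "(real \<Rightarrow> 'a::euclidean_space) \<Rightarrow> 'a" where
  "circle_avg f = integral {0..2 * pi} f /\<^sub>R (2 * pi)"

lemma circle_avg_add:
  assumes "continuous_on UNIV f" "continuous_on UNIV g"
  shows "circle_avg (\<lambda>x. f x + g x) = circle_avg f + circle_avg g"
  unfolding circle_avg_def
  by (subst integral_add)
     (auto intro!: integrable_continuous_interval continuous_on_subset[OF assms(1)]
       continuous_on_subset[OF assms(2)] simp: scaleR_add_right)

lemma circle_avg_diff:
  assumes "continuous_on UNIV f" "continuous_on UNIV g"
  shows "circle_avg (\<lambda>x. f x - g x) = circle_avg f - circle_avg g"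
  unfolding circle_avg_def
  by (subst integral_diff)
     (auto intro!: integrable_continuous_interval continuous_on_subset[OF assms(1)]
       continuous_on_subset[OF assms(2)] simp: scaleR_diff_right)

lemma circle_avg_sum:
  assumes "finite A" "\<And>i. i \<in> A \<Longrightarrow> continuous_on UNIV (f i)"
  shows "circle_avg (\<lambda>x. \<Sum>i\<in>A. f i x) = (\<Sum>i\<in>A. circle_avg (f i))"
  unfolding circle_avg_def
  by (subst integral_sum)
     (auto intro!: integrable_continuous_interval continuous_on_subset[OF assms(2)] assms(1)
       simp: scaleR_sum_right)

lemma circle_avg_const [simp]: "circle_avg (\<lambda>_. c) = c"
  by (simp add: circle_avg_def)

lemma circle_avg_mult_left:
  fixes c :: "'a :: {euclidean_space, real_normed_field}"
  shows "circle_avg (\<lambda>x. c * f x) = c * circle_avg f"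
  by (simp add: circle_avg_def)

lemma circle_avg_linear:
  assumes "bounded_linear h" "continuous_on UNIV f"
  shows "circle_avg (\<lambda>x. h (f x)) = h (circle_avg f)"
proof -
  have "f integrable_on {0..2*pi}"
    by (intro integrable_continuous_interval continuous_on_subset[OF assms(2)]) auto
  from integral_linear[OF this assms(1)] show ?thesis
    using assms(1) by (simp add: circle_avg_def o_def linear_simps)
qed

lemmas circle_avg_Re = circle_avg_linear[OF bounded_linear_Re]

lemma circle_avg_mono:
  fixes f g :: "real \<Rightarrow> real"
  assumes "continuous_on UNIV f" "continuous_on UNIV g" "\<And>x. 0 \<le> x \<Longrightarrow> x \<le> 2 * pi \<Longrightarrow> f x \<le> g x"
  shows "circle_avg f \<le> circle_avg g"
  unfolding circle_avg_def
  by (auto intro!: mult_left_mono integral_le integrable_continuous_interval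
    continuous_on_subset[OF assms(1)] continuous_on_subset[OF assms(2)] assms(3))

text \<open>
  The integral over a window of length \<open>2 \<pi>\<close> has derivative \<open>f(x + 2 \<pi>) - f(x) = 0\<close> in the left
  endpoint \<open>x\<close>.
\<close>

lemma circle_avg_shift:
  fixes f :: "real \<Rightarrow> 'a :: euclidean_space"
  assumes "continuous_on UNIV f" "\<And>x. f (x + 2 * pi) = f x"
  shows "circle_avg (\<lambda>x. f (x + c)) = circle_avg f"
proof -
  have "((\<lambda>x. integral {x..x + 2*pi} f) has_vector_derivative 0) (at x)" for x :: real
  proof -
    define H where "H = (\<lambda>y. integral {x - 1..y} f)"
    have int: "f integrable_on {a..b}" for a b
      by (intro integrable_continuous_interval continuous_on_subset[OF assms(1)]) auto
    have H: "(H has_vector_derivative f y) (at y)" if "y > x - 1" for y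
    proof -
      have "(H has_vector_derivative f y) (at y within {x - 1..y+1})"
        unfolding H_def using that
        by (intro integral_has_vector_derivative continuous_on_subset[OF assms(1)]) auto
      moreover have "at y within {x - 1..y+1} = at y"
        using that by (intro at_within_Icc_at) auto
      ultimately show ?thesis by simp
    qed
    have H2: "((\<lambda>y. H (y + 2*pi)) has_vector_derivative f (x + 2*pi)) (at x)"
    proof -
      have "((\<lambda>y. y + 2*pi) has_real_derivative 1) (at x)"
        by (auto intro!: derivative_eq_intros)
      moreover have "(H has_vector_derivative f (x + 2*pi)) (at (x + 2*pi))"
        using pi_gt_zero by (intro H) linarith
      ultimately show ?thesis
        using vector_diff_chain_at[of "\<lambda>y. y + 2*pi" 1 x H "f (x+2*pi)"]
        by (simp add: o_def has_real_derivative_iff_has_vector_derivative)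
    qed
    have diff: "((\<lambda>y. H (y + 2*pi) - H y) has_vector_derivative f (x + 2*pi) - f x) (at x)"
      by (intro has_vector_derivative_diff H2 H) auto
    have "H (y + 2*pi) - H y = integral {y..y + 2*pi} f" if "y \<in> {x - 1<..}" for y
    proof -
      have "integral {x-1..y} f + integral {y..y + 2*pi} f = integral {x-1..y+2*pi} f"
        using that by (intro Henstock_Kurzweil_Integration.integral_combine int) auto
      then show ?thesis by (simp add: H_def algebra_simps)
    qed
    then have "((\<lambda>y. integral {y..y + 2*pi} f) has_vector_derivative f (x + 2*pi) - f x) (at x)"
      by (rule has_vector_derivative_transform_within_open[OF diff, of "{x - 1<..}", rotated 2]) auto
    then show ?thesis using assms(2) by simp
  qed
  then obtain k where k: "\<And>x. integral {x..x + 2*pi} f = k"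
    using has_vector_derivative_zero_constant[of UNIV "\<lambda>x. integral {x..x + 2*pi} f"] by auto
  have "integral {0..2*pi} (\<lambda>x. f (x + c)) = integral {c..c + 2*pi} f"
    using integral_shift_real_ivl[of c c "c + 2*pi" f] by simp
  with k[of 0] k[of c] show ?thesis by (simp add: circle_avg_def)
qed

lemma circle_avg_reflect:
  fixes f :: "real \<Rightarrow> 'a :: euclidean_space"
  assumes "continuous_on UNIV f" "\<And>x. f (x + 2 * pi) = f x"
  shows "circle_avg (\<lambda>x. f (- x)) = circle_avg f"
proof -
  have "circle_avg (\<lambda>x. f (- x)) = circle_avg (\<lambda>x. f (x - 2 * pi))"
    using Henstock_Kurzweil_Integration.integral_reflect_real[where a = "-2*pi" and b = 0 and f = f] integral_shift_real_ivl[of "-2*pi" "-2*pi" 0 f]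
    by (simp add: circle_avg_def)
  then show ?thesis using circle_avg_shift[OF assms, of "- 2 * pi"] by simp
qed

lemma circle_avg_cis:
  fixes k :: int
  shows "circle_avg (\<lambda>x. cis (of_int k * x)) = (if k = 0 then 1 else 0)"
proof (cases "k = 0")
  case False
  have "((\<lambda>x. cis (of_int k * x)) has_integral
      (cis (of_int k * (2*pi)) / (\<i> * of_int k) - cis (of_int k * 0) / (\<i> * of_int k))) {0..2*pi}"
  proof (rule fundamental_theorem_of_calculus)
    fix x :: real
    have "((\<lambda>z. exp (\<i> * of_int k * z) / (\<i> * of_int k)) has_field_derivative exp (\<i> * of_int k * of_real x)) (at (of_real x))"
      using False by (auto intro!: derivative_eq_intros)
    from has_vector_derivative_real_field[OF this]
    show "((\<lambda>x. cis (of_int k * x) / (\<i> * of_int k)) has_vector_derivative cis (of_int k * x)) (at x within {0..2*pi})"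
      by (simp add: cis_conv_exp mult_ac has_vector_derivative_at_within)
  qed auto
  moreover have "cis (of_int k * (2*pi)) = 1"
    by (metis cis_multiple_2pi Ints_of_int mult.commute)
  ultimately show ?thesis
    using False by (simp add: circle_avg_def integral_unique)
qed (simp)

section \<open>Trigonometric polynomials and logarithmic potentials\<close>

text \<open>
  The value at \<open>s e\<^bsup>i\<theta>\<^esup>\<close> of the harmonic polynomial \<open>Re \<Sum> c\<^sub>k z\<^sup>k\<close>.  On the circle, \<open>s = 1\<close>, these are the
  real trigonometric polynomials; their values for \<open>s < 1\<close> occur because potentials are evaluated at
  points off the circle.  Multiplying the \<open>c\<^sub>k\<close> by \<open>k\<close> gives the derivative of the conjugate function.
\<close>

definition trig_harmonic :: "(nat \<Rightarrow> complex) \<Rightarrow> nat \<Rightarrow> real \<Rightarrow> real \<Rightarrow> real" where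
  "trig_harmonic c N s \<theta> = Re (\<Sum>k<N. c k * of_real s ^ k * cis (real k * \<theta>))"

lemma continuous_on_cis_comp [continuous_intros]:
  "continuous_on A f \<Longrightarrow> continuous_on A (\<lambda>x. cis (f x))"
  by (simp add: cis_conv_exp continuous_intros)

lemma circle_avg_cis_mult_cnj:
  "circle_avg (\<lambda>x. cis (real j * x) * cnj (cis (real k * x))) = (if j = k then 1 else 0)"
proof -
  have "cis (real j * x) * cnj (cis (real k * x)) = cis (of_int (int j - int k) * x)" for x
    by (simp add: cis_cnj cis_mult algebra_simps)
  then show ?thesis using circle_avg_cis[of "int j - int k"] by simp
qed

lemma circle_avg_cis_mult:
  "circle_avg (\<lambda>x. cis (real j * x) * cis (real k * x)) = (if j = 0 \<and> k = 0 then 1 else 0)"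
proof -
  have "cis (real j * x) * cis (real k * x) = cis (of_int (int j + int k) * x)" for x
    by (simp add: cis_mult algebra_simps)
  then show ?thesis using circle_avg_cis[of "int j + int k"] by simp
qed

lemma parseval_trig_poly:
  "circle_avg (\<lambda>x. (norm (\<Sum>j<n. a j * cis (real j * x)))\<^sup>2) = (\<Sum>j<n. (norm (a j))\<^sup>2)"
proof -
  let ?f = "\<lambda>x. \<Sum>j<n. a j * cis (real j * x)"
  have "circle_avg (\<lambda>x. ?f x * cnj (?f x)) =
      circle_avg (\<lambda>x. \<Sum>j<n. \<Sum>k<n. (a j * cnj (a k)) * (cis (real j * x) * cnj (cis (real k * x))))"
    by (simp add: sum_product mult_ac)
  also have "\<dots> = (\<Sum>j<n. \<Sum>k<n. (a j * cnj (a k)) * (if j = k then 1 else 0))"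
    by (subst circle_avg_sum, simp, intro continuous_intros, rule sum.cong, rule refl,
        subst circle_avg_sum, simp, intro continuous_intros)
       (simp only: circle_avg_mult_left circle_avg_cis_mult_cnj)
  also have "\<dots> = of_real (\<Sum>j<n. (norm (a j))\<^sup>2)"
    by (simp add: if_distrib cong: if_cong flip: complex_norm_square)
  finally have "circle_avg (\<lambda>x. ?f x * cnj (?f x)) = of_real (\<Sum>j<n. (norm (a j))\<^sup>2)" .
  moreover have "circle_avg (\<lambda>x. (norm (?f x))\<^sup>2) = Re (circle_avg (\<lambda>x. ?f x * cnj (?f x)))"
  proof -
    have "(norm z)\<^sup>2 = Re (z * cnj z)" for z
      by (simp only: complex_norm_square[symmetric] Re_complex_of_real)
    then show ?thesis
      by (simp only:) (intro circle_avg_Re continuous_intros)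
  qed
  ultimately show ?thesis by simp
qed

definition dirichlet_sum :: "nat \<Rightarrow> real \<Rightarrow> complex" where
  "dirichlet_sum k t = (\<Sum>j<k. cis (real j * t))"

lemma circle_avg_dirichlet_sum: "circle_avg (\<lambda>t. (norm (dirichlet_sum k t))\<^sup>2) = real k"
  using parseval_trig_poly[of "\<lambda>_. 1" k] by (simp add: dirichlet_sum_def)

lemma norm_cis_minus_1: "(norm (cis t - 1))\<^sup>2 = 4 * (sin (t / 2))\<^sup>2"
proof -
  have "(norm (cis t - 1))\<^sup>2 = 2 - 2 * cos t"
    using sin_cos_squared_add[of t] unfolding cmod_power2 by (simp add: power2_eq_square algebra_simps)
  also have "\<dots> = 4 * (sin (t / 2))\<^sup>2"
    using cos_double_sin[of "t / 2"] by simp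
  finally show ?thesis .
qed

lemma norm_dirichlet_sum:
  "4 * (sin (t / 2))\<^sup>2 * (norm (dirichlet_sum k t))\<^sup>2 = 2 - 2 * cos (real k * t)"
proof -
  have "(cis t - 1) * dirichlet_sum k t = cis (real k * t) - 1"
    using power_diff_1_eq[of "cis t" k] by (simp only: dirichlet_sum_def Complex.DeMoivre)
  then have "(norm (cis t - 1))\<^sup>2 * (norm (dirichlet_sum k t))\<^sup>2 = (norm (cis (real k * t) - 1))\<^sup>2"
    by (simp flip: norm_mult power_mult_distrib)
  then show ?thesis
    using cos_double_sin[of "real k * t / 2"] by (simp add: norm_cis_minus_1)
qed

text \<open>
  On the circle, this is the second difference of \<open>F = Re \<Sum> c\<^sub>k e\<^bsup>ik\<theta>\<^esup>\<close> divided by \<open>4 sin\<^sup>2 (t / 2)\<close>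
  (\<open>difference_kernel_eq\<close>), written without the division so that it is visibly a continuous
  function of \<open>t\<close>.
\<close>

definition difference_kernel :: "(nat \<Rightarrow> complex) \<Rightarrow> nat \<Rightarrow> real \<Rightarrow> real \<Rightarrow> real" where
  "difference_kernel c N \<theta> t = Re (\<Sum>k<N. c k * cis (real k * \<theta>) * of_real ((norm (dirichlet_sum k t))\<^sup>2))"

lemma continuous_on_difference_kernel: "continuous_on A (difference_kernel c N \<theta>)"
  unfolding difference_kernel_def [abs_def] dirichlet_sum_def by (intro continuous_intros)

text \<open>
  The operator \<open>e\<^bsup>ik\<theta>\<^esup> \<mapsto> k e\<^bsup>ik\<theta>\<^esup>\<close> is the square root of the Laplacian on the circle; averaging second
  differences against \<open>1 / (4 sin\<^sup>2 (t / 2))\<close> is its representation as a singular integral.  On a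
  single frequency \<open>k\<close> the average is that of \<open>|1 + e\<^bsup>it\<^esup> + \<dots> + e\<^bsup>i(k-1)t\<^esup>|\<^sup>2\<close>, which is \<open>k\<close> by
  Parseval's identity.
\<close>

lemma circle_avg_difference_kernel:
  "circle_avg (difference_kernel c N \<theta>) = trig_harmonic (\<lambda>k. of_nat k * c k) N 1 \<theta>"
proof -
  have of_real: "circle_avg (\<lambda>t. complex_of_real ((norm (dirichlet_sum k t))\<^sup>2)) = of_nat k" for k
    using circle_avg_linear[OF bounded_linear_of_real, of "\<lambda>t. (norm (dirichlet_sum k t))\<^sup>2"]
    by (simp add: circle_avg_dirichlet_sum)
       (simp add: dirichlet_sum_def continuous_intros)
  have "circle_avg (difference_kernel c N \<theta>) =
     Re (circle_avg (\<lambda>t. \<Sum>k<N. c k * cis (real k * \<theta>) * of_real ((norm (dirichlet_sum k t))\<^sup>2)))"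
    unfolding difference_kernel_def[abs_def] dirichlet_sum_def
    by (intro circle_avg_Re continuous_intros)
  also have "\<dots> = Re (\<Sum>k<N. c k * cis (real k * \<theta>) * of_nat k)"
    by (subst circle_avg_sum)
       (auto intro!: continuous_intros simp: dirichlet_sum_def of_real[unfolded dirichlet_sum_def]
         circle_avg_mult_left simp del: of_real_power)
  finally show ?thesis by (simp add: trig_harmonic_def mult_ac)
qed

lemma difference_kernel_eq:
  "4 * (sin (t / 2))\<^sup>2 * difference_kernel c N \<theta> t =
     2 * trig_harmonic c N 1 \<theta> - trig_harmonic c N 1 (\<theta> + t) - trig_harmonic c N 1 (\<theta> - t)"
proof -
  have *: "c k * cis (real k * \<theta>) * of_real (2 - 2 * cos (real k * t)) =
     2 * (c k * cis (real k * \<theta>)) - c k * cis (real k * (\<theta> + t)) - c k * cis (real k * (\<theta> - t))" for k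
    by (simp add: complex_eq_iff cos_add cos_diff sin_add sin_diff algebra_simps)
  have "4 * (sin (t / 2))\<^sup>2 * difference_kernel c N \<theta> t =
      Re (\<Sum>k<N. c k * cis (real k * \<theta>) * of_real (4 * (sin (t / 2))\<^sup>2 * (norm (dirichlet_sum k t))\<^sup>2))"
    unfolding difference_kernel_def
    by (simp add: sum_distrib_left algebra_simps)
  also have "\<dots> = Re (\<Sum>k<N. 2 * (c k * cis (real k * \<theta>)) - c k * cis (real k * (\<theta> + t)) - c k * cis (real k * (\<theta> - t)))"
    unfolding norm_dirichlet_sum * ..
  also have "\<dots> = 2 * trig_harmonic c N 1 \<theta> - trig_harmonic c N 1 (\<theta> + t) - trig_harmonic c N 1 (\<theta> - t)"
    unfolding trig_harmonic_def by (simp add: sum_subtractf sum_distrib_left)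
  finally show ?thesis .
qed

text \<open>
  Up to the sign, \<open>ln |e\<^bsup>i\<phi>\<^esup> - s e\<^bsup>i\<alpha>\<^esup>|\<close> is the real part of \<open>\<Sum> x\<^sup>l / l\<close> with \<open>x = s e\<^bsup>i(\<alpha>-\<phi>)\<^esup>\<close>.  In the
  product with \<open>Re \<Sum> b\<^sub>k e\<^bsup>ik\<phi>\<^esup>\<close> each frequency meets only its opposite, which leaves a factor 1/2.  The
  frequency 0 drops out on both sides because \<open>b\<^sub>0 / 0 = 0\<close>.
\<close>

lemma circle_avg_log_potential:
  assumes s: "0 \<le> s" "s < 1"
  shows "circle_avg (\<lambda>\<phi>. trig_harmonic b N 1 \<phi> * ln (norm (cis \<phi> - of_real s * cis \<alpha>))) =
    - (1 / 2) * trig_harmonic (\<lambda>k. b k / of_nat k) N s \<alpha>"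
proof -
  define x where "x = (\<lambda>\<phi>. of_real s * cis (\<alpha> - \<phi>))"
  define A where "A = (\<lambda>\<phi>. \<Sum>k<N. b k * cis (real k * \<phi>))"
  define P where "P = (\<lambda>m \<phi>. \<Sum>l<m. x \<phi> ^ l / of_nat l)"
  have norm_x: "norm (x \<phi>) = s" for \<phi> using s by (simp add: x_def norm_mult)
  have cont_A: "continuous_on B A" and cont_P: "continuous_on B (P m)" for B m
    unfolding A_def P_def x_def divide_inverse by (intro continuous_intros)+
  have A: "trig_harmonic b N 1 \<phi> = Re (A \<phi>)" for \<phi> by (simp add: trig_harmonic_def A_def)
  have ln_eq: "ln (norm (cis \<phi> - of_real s * cis \<alpha>)) = Re (Ln (1 - x \<phi>))" for \<phi>
  proof -
    have ne: "1 - x \<phi> \<noteq> 0" using norm_x[of \<phi>] s by auto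
    have "cis \<phi> - of_real s * cis \<alpha> = cis \<phi> * (1 - x \<phi>)"
      by (simp add: x_def algebra_simps cis_mult)
    then show ?thesis using ne by (simp add: norm_mult)
  qed
  have xpow: "x \<phi> ^ l = of_real s ^ l * (cis (real l * \<alpha>) * cnj (cis (real l * \<phi>)))" for l \<phi>
    by (simp add: x_def power_mult_distrib Complex.DeMoivre cis_cnj cis_mult right_diff_distrib)
  have summand: "b k * cis (real k * \<phi>) * (x \<phi> ^ l / of_nat l) =
      (b k * (of_real s ^ l * cis (real l * \<alpha>) / of_nat l)) * (cis (real k * \<phi>) * cnj (cis (real l * \<phi>)))" for k l \<phi>
    by (simp add: xpow mult_ac)
  have summand': "b k * cis (real k * \<phi>) * cnj (x \<phi> ^ l / of_nat l) =
      (b k * (of_real s ^ l * cnj (cis (real l * \<alpha>)) / of_nat l)) * (cis (real k * \<phi>) * cis (real l * \<phi>))" for k l \<phi>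
    by (simp add: xpow mult_ac)
  have avg1: "circle_avg (\<lambda>\<phi>. A \<phi> * P m \<phi>) = (\<Sum>k<N. b k / of_nat k * of_real s ^ k * cis (real k * \<alpha>))"
    if "m \<ge> N" for m
  proof -
    have "circle_avg (\<lambda>\<phi>. A \<phi> * P m \<phi>) = circle_avg (\<lambda>\<phi>. \<Sum>k<N. \<Sum>l<m.
      (b k * (of_real s ^ l * cis (real l * \<alpha>) / of_nat l)) * (cis (real k * \<phi>) * cnj (cis (real l * \<phi>))))"
      unfolding A_def P_def sum_product summand ..
    also have "\<dots> = (\<Sum>k<N. \<Sum>l<m. (b k * (of_real s ^ l * cis (real l * \<alpha>) / of_nat l)) * (if k = l then 1 else 0))"
      by (subst circle_avg_sum, simp, intro continuous_intros, rule sum.cong, rule refl,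
        subst circle_avg_sum, simp, intro continuous_intros)
       (simp only: circle_avg_mult_left circle_avg_cis_mult_cnj)
    also have "\<dots> = (\<Sum>k<N. b k / of_nat k * of_real s ^ k * cis (real k * \<alpha>))"
      using that by (intro sum.cong refl) (simp add: if_distrib cong: if_cong)
    finally show ?thesis .
  qed
  have avg2: "circle_avg (\<lambda>\<phi>. A \<phi> * cnj (P m \<phi>)) = 0" for m
  proof -
    have "circle_avg (\<lambda>\<phi>. A \<phi> * cnj (P m \<phi>)) = circle_avg (\<lambda>\<phi>. \<Sum>k<N. \<Sum>l<m.
      (b k * (of_real s ^ l * cnj (cis (real l * \<alpha>)) / of_nat l)) * (cis (real k * \<phi>) * cis (real l * \<phi>)))"
      unfolding A_def P_def cnj_sum sum_product summand' ..
    also have "\<dots> = (\<Sum>k<N. \<Sum>l<m. (b k * (of_real s ^ l * cnj (cis (real l * \<alpha>)) / of_nat l)) * (if k = 0 \<and> l = 0 then 1 else 0))"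
      by (subst circle_avg_sum, simp, intro continuous_intros, rule sum.cong, rule refl,
        subst circle_avg_sum, simp, intro continuous_intros)
       (simp only: circle_avg_mult_left circle_avg_cis_mult)
    also have "\<dots> = 0"
      by (intro sum.neutral ballI) auto
    finally show ?thesis .
  qed
  have avg: "circle_avg (\<lambda>\<phi>. Re (A \<phi>) * Re (P m \<phi>)) = 1 / 2 * trig_harmonic (\<lambda>k. b k / of_nat k) N s \<alpha>"
    if "m \<ge> N" for m
  proof -
    have eq: "Re (A \<phi>) * Re (P m \<phi>) = Re (1 / 2 * (A \<phi> * P m \<phi> + A \<phi> * cnj (P m \<phi>)))" for \<phi>
      by (simp add: field_simps)
    have cont1: "continuous_on UNIV (\<lambda>\<phi>. A \<phi> * P m \<phi>)" and cont2: "continuous_on UNIV (\<lambda>\<phi>. A \<phi> * cnj (P m \<phi>))"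
      using cont_A[of UNIV] cont_P[of UNIV m] by (auto intro!: continuous_on_mult continuous_on_cnj)
    have "circle_avg (\<lambda>\<phi>. Re (A \<phi>) * Re (P m \<phi>)) =
        Re (1 / 2 * (circle_avg (\<lambda>\<phi>. A \<phi> * P m \<phi>) + circle_avg (\<lambda>\<phi>. A \<phi> * cnj (P m \<phi>))))"
      unfolding eq
      by (subst circle_avg_Re, rule continuous_on_mult_left, rule continuous_on_add[OF cont1 cont2],
          subst circle_avg_mult_left, subst circle_avg_add[OF cont1 cont2]) (rule refl)
    then show ?thesis using avg1[OF that] avg2[of m] by (simp add: trig_harmonic_def)
  qed
  have unif: "uniform_limit {0..2*pi} P (\<lambda>\<phi>. - Ln (1 - x \<phi>)) sequentially"
  proof -
    have "uniform_limit {0..2*pi} (\<lambda>m \<phi>. \<Sum>l<m. x \<phi> ^ l / of_nat l)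
        (\<lambda>\<phi>. \<Sum>l. x \<phi> ^ l / of_nat l) sequentially"
    proof (rule Weierstrass_m_test)
      show "norm (x \<phi> ^ l / of_nat l) \<le> s ^ l" for l \<phi>
      proof (cases "l = 0")
        case False
        then have "s ^ l / real l \<le> s ^ l / 1" using s by (intro divide_left_mono) auto
        then show ?thesis using norm_x[of \<phi>] by (simp add: norm_divide norm_power)
      qed auto
      show "summable (\<lambda>l. s ^ l)" using s by (simp add: summable_geometric)
    qed
    moreover have "(\<Sum>l. x \<phi> ^ l / of_nat l) = - Ln (1 - x \<phi>)" for \<phi>
    proof -
      have "(\<lambda>n. - ((x \<phi>)^n) / of_nat n) sums ln (1 - x \<phi>)"
        using Ln_series'[of "- x \<phi>"] norm_x[of \<phi>] s by simp
      from sums_minus[OF this] show ?thesis by (simp add: sums_iff)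
    qed
    ultimately show ?thesis by (simp add: P_def)
  qed
  have "uniform_limit {0..2*pi} (\<lambda>m \<phi>. Re (A \<phi>) * Re (P m \<phi>)) (\<lambda>\<phi>. Re (A \<phi>) * Re (- Ln (1 - x \<phi>))) sequentially"
  proof (rule uniform_lim_mult)
    show "uniform_limit {0..2*pi} (\<lambda>m \<phi>. Re (P m \<phi>)) (\<lambda>\<phi>. Re (- Ln (1 - x \<phi>))) sequentially"
      by (rule bounded_linear.uniform_limit[OF bounded_linear_Re unif])
    show "uniform_limit {0..2*pi} (\<lambda>m \<phi>. Re (A \<phi>)) (\<lambda>\<phi>. Re (A \<phi>)) sequentially"
      by (rule uniform_limit_const)
    show "bounded ((\<lambda>\<phi>. Re (A \<phi>)) ` {0..2*pi})"
      using cont_A by (intro compact_imp_bounded compact_continuous_image continuous_on_Re) auto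
    show "bounded ((\<lambda>\<phi>. Re (- Ln (1 - x \<phi>))) ` {0..2*pi})"
    proof (intro compact_imp_bounded compact_continuous_image)
      have "continuous_on {0..2*pi} (\<lambda>\<phi>. - Ln (1 - x \<phi>))"
        by (rule uniform_limit_theorem[OF _ unif]) (auto intro: always_eventually cont_P)
      then show "continuous_on {0..2*pi} (\<lambda>\<phi>. Re (- Ln (1 - x \<phi>)))" by (rule continuous_on_Re)
    qed auto
  qed
  then obtain I J where IJ:
    "\<And>m. ((\<lambda>\<phi>. Re (A \<phi>) * Re (P m \<phi>)) has_integral I m) {0..2*pi}"
    "((\<lambda>\<phi>. Re (A \<phi>) * Re (- Ln (1 - x \<phi>))) has_integral J) {0..2*pi}" "I \<longlonglongrightarrow> J"
    by (rule uniform_limit_integral)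
       (use cont_A cont_P in \<open>auto intro!: continuous_on_mult continuous_on_Re\<close>)
  have "I m = pi * trig_harmonic (\<lambda>k. b k / of_nat k) N s \<alpha>" if "m \<ge> N" for m
    using avg[OF that] integral_unique[OF IJ(1)[of m]] by (simp add: circle_avg_def field_simps)
  then have "\<forall>\<^sub>F m in sequentially. I m = pi * trig_harmonic (\<lambda>k. b k / of_nat k) N s \<alpha>"
    by (rule eventually_sequentiallyI)
  then have "I \<longlonglongrightarrow> pi * trig_harmonic (\<lambda>k. b k / of_nat k) N s \<alpha>"
    by (rule tendsto_eventually)
  then have "J = pi * trig_harmonic (\<lambda>k. b k / of_nat k) N s \<alpha>"
    by (rule LIMSEQ_unique[OF IJ(3)])
  moreover have "((\<lambda>\<phi>. Re (A \<phi>) * Re (Ln (1 - x \<phi>))) has_integral - J) {0..2*pi}"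
    using has_integral_neg[OF IJ(2)] by simp
  ultimately have "integral {0..2*pi} (\<lambda>\<phi>. Re (A \<phi>) * Re (Ln (1 - x \<phi>))) =
      - (pi * trig_harmonic (\<lambda>k. b k / of_nat k) N s \<alpha>)"
    by (simp add: integral_unique)
  then show ?thesis
    unfolding circle_avg_def A ln_eq by simp
qed

section \<open>The conjugate derivative of a trigonometric polynomial\<close>

lemma sin_ge_minus_cubic:
  assumes "0 \<le> (x::real)"
  shows "x - x ^ 3 / 6 \<le> sin x"
proof -
  have "sin 0 - (0 - 0 ^ 3 / 6) \<le> sin x - (x - x ^ 3 / 6)"
  proof (rule DERIV_nonneg_imp_nondecreasing[OF assms])
    fix y :: real assume "0 \<le> y" "y \<le> x"
    have "((\<lambda>x. sin x - (x - x ^ 3 / 6)) has_real_derivative cos y - 1 + y\<^sup>2 / 2) (at y)"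
      by (auto intro!: derivative_eq_intros)
    moreover have "cos y - 1 + y\<^sup>2 / 2 \<ge> 0"
    proof -
      have "(sin (y / 2))\<^sup>2 \<le> (y / 2)\<^sup>2"
        by (metis abs_sin_x_le_abs_x abs_le_square_iff)
      then show ?thesis using cos_double_sin[of "y / 2"] by (simp add: power2_eq_square)
    qed
    ultimately show "\<exists>z. ((\<lambda>x. sin x - (x - x ^ 3 / 6)) has_real_derivative z) (at y) \<and> 0 \<le> z"
      by blast
  qed
  then show ?thesis by simp
qed

text \<open>
  In the form \<open>cot x \<le> 1 / x\<close>, this controls the singularity of the kernel at 0.
\<close>

lemma mult_cos_le_sin:
  assumes "0 \<le> (x::real)" "x \<le> pi"
  shows "x * cos x \<le> sin x"
proof -
  have "sin 0 - 0 * cos 0 \<le> sin x - x * cos x"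
  proof (rule DERIV_nonneg_imp_nondecreasing[OF assms(1)])
    fix y :: real assume y: "0 \<le> y" "y \<le> x"
    have "((\<lambda>x. sin x - x * cos x) has_real_derivative y * sin y) (at y)"
      by (auto intro!: derivative_eq_intros)
    moreover have "y * sin y \<ge> 0"
      using y assms by (intro mult_nonneg_nonneg sin_ge_zero) auto
    ultimately show "\<exists>z. ((\<lambda>x. sin x - x * cos x) has_real_derivative z) (at y) \<and> 0 \<le> z"
      by blast
  qed
  then show ?thesis by simp
qed

lemma continuous_on_trig_harmonic: "continuous_on A (trig_harmonic c N s)"
  unfolding trig_harmonic_def[abs_def] by (intro continuous_intros)

lemma difference_kernel_minus: "difference_kernel c N \<theta> (- t) = difference_kernel c N \<theta> t"
proof -
  have "dirichlet_sum k (- t) = cnj (dirichlet_sum k t)" for k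
    by (simp add: dirichlet_sum_def cis_cnj)
  then show ?thesis by (simp add: difference_kernel_def)
qed

lemma difference_kernel_periodic: "difference_kernel c N \<theta> (t + 2 * pi) = difference_kernel c N \<theta> t"
proof -
  have "dirichlet_sum k (t + 2 * pi) = dirichlet_sum k t" for k
    unfolding dirichlet_sum_def using cis_multiple_2pi[of "real j" for j]
    by (intro sum.cong refl) (simp add: distrib_left cis_mult[symmetric] mult.commute mult.left_commute)
  then show ?thesis by (simp add: difference_kernel_def)
qed

lemma has_integral_half_csc_squared:
  assumes "0 < T" "T \<le> pi"
  shows "((\<lambda>t. 1 / (2 * (sin (t / 2))\<^sup>2)) has_integral 2 * cot (T / 2)) {T..2 * pi - T}"
proof -
  have "((\<lambda>t. 1 / (2 * (sin (t / 2))\<^sup>2)) has_integral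
      (- cot ((2 * pi - T) / 2) - (- cot (T / 2)))) {T..2 * pi - T}"
  proof (rule fundamental_theorem_of_calculus)
    fix t assume t: "t \<in> {T..2 * pi - T}"
    have "sin (t / 2) > 0" using t assms by (intro sin_gt_zero) auto
    then have "((\<lambda>t. - cot (t / 2)) has_real_derivative 1 / (2 * (sin (t / 2))\<^sup>2)) (at t)"
      by (auto intro!: derivative_eq_intros DERIV_chain2[OF DERIV_cot] simp: field_simps power2_eq_square)
    then show "((\<lambda>t. - cot (t / 2)) has_vector_derivative 1 / (2 * (sin (t / 2))\<^sup>2)) (at t within {T..2 * pi - T})"
      by (simp add: has_real_derivative_iff_has_vector_derivative has_vector_derivative_at_within)
  qed (use assms in auto)
  moreover have "cot ((2 * pi - T) / 2) = - cot (T / 2)"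
    by (simp add: cot_def diff_divide_distrib)
  ultimately show ?thesis by simp
qed

text \<open>
  The difference kernel is at most \<open>\<pi>\<^sup>2 / (2 \<delta>\<^sup>2)\<close> near 0, from the bound on the second differences, and
  at most \<open>1 / (2 sin\<^sup>2 (t / 2))\<close> elsewhere, because second differences of a function with values in
  \<open>[0, 1]\<close> are at most 2.  The second bound has the primitive \<open>- cot (t / 2)\<close>.
\<close>

lemma conjugate_derivative_bound:
  fixes c :: "nat \<Rightarrow> complex" and N :: nat
  defines "F \<equiv> trig_harmonic c N 1"
  assumes \<delta>: "0 < \<delta>" "\<delta> \<le> pi"
    and range: "\<And>x. 0 \<le> F x" "\<And>x. F x \<le> 1"
    and diff2: "\<And>x t. \<bar>2 * F x - F (x + t) - F (x - t)\<bar> \<le> 2 * t\<^sup>2 / \<delta>\<^sup>2"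
  shows "\<bar>trig_harmonic (\<lambda>k. of_nat k * c k) N 1 \<theta>\<bar> \<le> 2 / \<delta>"
proof -
  define E where "E = difference_kernel c N \<theta>"
  \<comment> \<open>this split balances the near part \<open>T \<pi>\<^sup>2 / \<delta>\<^sup>2\<close> and the far part \<open>4 / T\<close>\<close>
  define T where "T = 2 * \<delta> / pi"
  have cont: "continuous_on A E" for A
    unfolding E_def by (rule continuous_on_difference_kernel)
  have T: "0 < T" "T \<le> 2"
    using \<delta> by (auto simp: T_def field_simps)
  then have T': "T \<le> pi" "2 * pi - T \<ge> T"
    using pi_ge_two by linarith+
  note T = T T'
  have E_eq: "4 * (sin (t / 2))\<^sup>2 * \<bar>E t\<bar> = \<bar>2 * F \<theta> - F (\<theta> + t) - F (\<theta> - t)\<bar>" for t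
    by (simp add: E_def F_def abs_mult flip: difference_kernel_eq)
  have near_pos: "\<bar>E t\<bar> \<le> pi\<^sup>2 / (2 * \<delta>\<^sup>2)" if t: "0 < t" "t \<le> T" for t
  proof -
    have "t / pi \<le> sin (t / 2)"
    proof -
      have "t / pi \<le> 5 / 6 * (t / 2)"
        using t pi_approx by (simp add: field_simps)
      also have "\<dots> \<le> t / 2 - (t / 2) ^ 3 / 6"
      proof -
        have "(t / 2) ^ 3 \<le> 1 ^ 2 * (t / 2)"
          unfolding power3_eq_cube power2_eq_square using t T
          by (intro mult_right_mono mult_mono) auto
        then show ?thesis by simp
      qed
      also have "\<dots> \<le> sin (t / 2)" using t by (intro sin_ge_minus_cubic) auto
      finally show ?thesis .
    qed
    then have "(t / pi)\<^sup>2 \<le> (sin (t / 2))\<^sup>2" using t by (intro power_mono) auto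
    then have "4 * (t / pi)\<^sup>2 * \<bar>E t\<bar> \<le> 4 * (sin (t / 2))\<^sup>2 * \<bar>E t\<bar>"
      by (intro mult_right_mono mult_left_mono) auto
    also have "\<dots> \<le> 2 * t\<^sup>2 / \<delta>\<^sup>2" unfolding E_eq by (rule diff2)
    finally show ?thesis using t \<delta> by (simp add: field_simps)
  qed
  \<comment> \<open>at \<open>t = 0\<close> the quotient is of the form 0/0, and the bound holds by continuity\<close>
  have near: "\<bar>E t\<bar> \<le> pi\<^sup>2 / (2 * \<delta>\<^sup>2)" if t: "0 \<le> t" "t \<le> T" for t
  proof (cases "t = 0")
    case True
    have "(E \<longlongrightarrow> E 0) (at 0 within UNIV)"
      using cont[of UNIV] unfolding continuous_on_def by blast
    then have "((\<lambda>t. \<bar>E t\<bar>) \<longlongrightarrow> \<bar>E 0\<bar>) (at_right 0)"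
      by (intro tendsto_rabs) (rule tendsto_within_subset, auto)
    moreover have "\<forall>\<^sub>F t in at_right 0. \<bar>E t\<bar> \<le> pi\<^sup>2 / (2 * \<delta>\<^sup>2)"
      using eventually_at_right_less[of 0] eventually_at_right_field[of "\<lambda>t. t < T" 0] T
      by (smt (verit, best) eventually_at_right_field near_pos)
    ultimately show ?thesis unfolding True by (intro tendsto_upperbound) auto
  qed (use near_pos t in auto)
  have far: "\<bar>E t\<bar> \<le> 1 / (2 * (sin (t / 2))\<^sup>2)" if t: "T \<le> t" "t \<le> 2 * pi - T" for t
  proof -
    have "sin (t / 2) > 0" using t T by (intro sin_gt_zero) auto
    moreover have "4 * (sin (t / 2))\<^sup>2 * \<bar>E t\<bar> \<le> 2"
      unfolding E_eq using range[of \<theta>] range[of "\<theta> + t"] range[of "\<theta> - t"] by linarith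
    ultimately show ?thesis by (simp add: field_simps)
  qed
  have int: "(\<lambda>t. \<bar>E t\<bar>) integrable_on {a..b}" for a b
    by (intro integrable_continuous_interval continuous_intros cont)
  have "integral {0..2*pi} (\<lambda>t. \<bar>E t\<bar>) = integral {0..T} (\<lambda>t. \<bar>E t\<bar>) + integral {T..2*pi - T} (\<lambda>t. \<bar>E t\<bar>)
      + integral {2*pi - T..2*pi} (\<lambda>t. \<bar>E t\<bar>)"
    using T by (simp add: Henstock_Kurzweil_Integration.integral_combine int)
  also have "\<dots> \<le> T * (pi\<^sup>2 / (2 * \<delta>\<^sup>2)) + 2 * cot (T / 2) + T * (pi\<^sup>2 / (2 * \<delta>\<^sup>2))"
  proof (intro add_mono)
    have "integral {0..T} (\<lambda>t. \<bar>E t\<bar>) \<le> integral {0..T} (\<lambda>t. pi\<^sup>2 / (2 * \<delta>\<^sup>2))"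
      by (intro integral_le int near) auto
    then show "integral {0..T} (\<lambda>t. \<bar>E t\<bar>) \<le> T * (pi\<^sup>2 / (2 * \<delta>\<^sup>2))" using T by simp
    have "\<bar>E t\<bar> \<le> pi\<^sup>2 / (2 * \<delta>\<^sup>2)" if t: "2*pi - T \<le> t" "t \<le> 2*pi" for t
      using near[of "2 * pi - t"] t difference_kernel_periodic[of c N \<theta> "- t"] difference_kernel_minus[of c N \<theta> t]
      by (simp add: E_def add.commute)
    then have "integral {2*pi - T..2*pi} (\<lambda>t. \<bar>E t\<bar>) \<le> integral {2*pi - T..2*pi} (\<lambda>t. pi\<^sup>2 / (2 * \<delta>\<^sup>2))"
      by (intro integral_le int) auto
    then show "integral {2*pi - T..2*pi} (\<lambda>t. \<bar>E t\<bar>) \<le> T * (pi\<^sup>2 / (2 * \<delta>\<^sup>2))" using T by simp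
    have "integral {T..2*pi - T} (\<lambda>t. \<bar>E t\<bar>) \<le> integral {T..2*pi - T} (\<lambda>t. 1 / (2 * (sin (t / 2))\<^sup>2))"
      using has_integral_half_csc_squared[OF T(1,3)] far by (intro integral_le int) (auto simp: integrable_on_def)
    then show "integral {T..2*pi - T} (\<lambda>t. \<bar>E t\<bar>) \<le> 2 * cot (T / 2)"
      using has_integral_half_csc_squared[OF T(1,3)] by (simp add: integral_unique)
  qed
  also have "2 * cot (T / 2) \<le> 2 * (2 / T)"
  proof -
    have "sin (T / 2) > 0" using T by (intro sin_gt_zero) auto
    moreover have "T / 2 * cos (T / 2) \<le> sin (T / 2)" using T by (intro mult_cos_le_sin) auto
    ultimately show ?thesis using T by (simp add: cot_def field_simps)
  qed
  also have "T * (pi\<^sup>2 / (2 * \<delta>\<^sup>2)) + 2 * (2 / T) + T * (pi\<^sup>2 / (2 * \<delta>\<^sup>2)) = 2 * pi * (2 / \<delta>)"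
    using \<delta> by (simp add: T_def power2_eq_square field_simps)
  finally have "integral {0..2*pi} (\<lambda>t. \<bar>E t\<bar>) \<le> 2 * pi * (2 / \<delta>)" by simp
  moreover have "\<bar>integral {0..2*pi} E\<bar> \<le> integral {0..2*pi} (\<lambda>t. \<bar>E t\<bar>)"
    using integral_norm_bound_integral[of E "{0..2*pi}" "\<lambda>t. \<bar>E t\<bar>"] int cont
    by (simp add: integrable_continuous_interval)
  ultimately have "\<bar>circle_avg E\<bar> \<le> 2 / \<delta>"
    by (simp add: circle_avg_def abs_mult field_simps)
  then show ?thesis by (simp add: E_def circle_avg_difference_kernel)
qed

section \<open>Fejer smoothing\<close>

text \<open>
  The cosine form of the Fejer kernel, which exhibits its Fourier coefficients; positivity is
  visible on the left-hand side.
\<close>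

lemma norm_dirichlet_sum_eq_cos:
  "(norm (dirichlet_sum N s))\<^sup>2 = (\<Sum>k<N. (if k = 0 then real N else 2 * (real N - real k)) * cos (real k * s))"
proof (induction N)
  case (Suc N)
  have "(norm (dirichlet_sum (Suc N) s))\<^sup>2 = (norm (dirichlet_sum N s))\<^sup>2 + 1 + 2 * Re (dirichlet_sum N s * cnj (cis (real N * s)))"
  proof -
    have "(norm (a + cis b))\<^sup>2 = (norm a)\<^sup>2 + 1 + 2 * Re (a * cnj (cis b))" for a b
      using sin_cos_squared_add[of b] unfolding cmod_power2 by (simp add: power2_eq_square algebra_simps)
    then show ?thesis by (simp add: dirichlet_sum_def)
  qed
  also have "Re (dirichlet_sum N s * cnj (cis (real N * s))) = (\<Sum>j<N. cos (real (N - j) * s))"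
    unfolding dirichlet_sum_def sum_distrib_right Re_sum
    by (intro sum.cong refl) (simp add: cis_cnj cis_mult of_nat_diff left_diff_distrib flip: cos_diff, simp add: cos_diff mult_ac)
  also have "\<dots> = (\<Sum>j<N. cos (real (Suc j) * s))"
    by (intro sum.reindex_bij_witness[of _ "\<lambda>j. N - Suc j" "\<lambda>j. N - Suc j"]) auto
  also have "(norm (dirichlet_sum N s))\<^sup>2 + 1 + 2 * (\<Sum>j<N. cos (real (Suc j) * s)) =
     (\<Sum>k<Suc N. (if k = 0 then real (Suc N) else 2 * (real (Suc N) - real k)) * cos (real k * s))"
  proof -
    let ?w = "\<lambda>N k. if k = 0 then real N else 2 * (real N - real k)"
    have "(\<Sum>k<Suc N. ?w (Suc N) k * cos (real k * s)) =
        (\<Sum>k<Suc N. ?w N k * cos (real k * s)) + (\<Sum>k<Suc N. (if k = 0 then 1 else 2) * cos (real k * s))"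
      unfolding sum.distrib[symmetric] by (intro sum.cong refl) (auto simp: algebra_simps)
    also have "(\<Sum>k<Suc N. ?w N k * cos (real k * s)) = (norm (dirichlet_sum N s))\<^sup>2"
      by (simp add: Suc.IH)
    also have "(\<Sum>k<Suc N. (if k = 0 then 1 else 2) * cos (real k * s)) = 1 + 2 * (\<Sum>j<N. cos (real (Suc j) * s))"
      unfolding sum.lessThan_Suc_shift by (simp add: sum_distrib_left)
    finally show ?thesis by simp
  qed
  finally show ?case .
qed (simp add: dirichlet_sum_def)

definition fejer_kernel :: "nat \<Rightarrow> real \<Rightarrow> real" where
  "fejer_kernel N s = (norm (dirichlet_sum N s))\<^sup>2 / real N"

lemma continuous_on_fejer_kernel: "continuous_on A f \<Longrightarrow> continuous_on A (\<lambda>x. fejer_kernel N (f x))"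
  unfolding fejer_kernel_def[abs_def] dirichlet_sum_def divide_inverse by (intro continuous_intros)

lemma fejer_kernel_nonneg: "fejer_kernel N s \<ge> 0"
  by (simp add: fejer_kernel_def)

lemma circle_avg_fejer_kernel: "N > 0 \<Longrightarrow> circle_avg (fejer_kernel N) = 1"
  using circle_avg_mult_left[of "1 / real N" "\<lambda>t. (norm (dirichlet_sum N t))\<^sup>2"]
  by (simp add: fejer_kernel_def[abs_def] circle_avg_dirichlet_sum)

lemma circle_avg_cos_mult_cos:
  "circle_avg (\<lambda>s. cos (real k * s) * cos (real j * s)) = (if k = j then if k = 0 then 1 else 1 / 2 else 0)"
proof -
  have "circle_avg (\<lambda>s. cos (real k * s) * cos (real j * s)) =
     circle_avg (\<lambda>s. Re (1 / 2 * (cis (real k * s) * cis (real j * s) + cis (real k * s) * cnj (cis (real j * s)))))"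
    by (intro arg_cong[of _ _ circle_avg] ext) (simp add: field_simps)
  also have "\<dots> = Re (1 / 2 * (circle_avg (\<lambda>s. cis (real k * s) * cis (real j * s)) + circle_avg (\<lambda>s. cis (real k * s) * cnj (cis (real j * s)))))"
    by (subst circle_avg_Re, intro continuous_intros, subst circle_avg_mult_left, subst circle_avg_add)
       (intro continuous_intros refl)+
  also have "\<dots> = (if k = j then if k = 0 then 1 else 1 / 2 else 0)"
    unfolding circle_avg_cis_mult circle_avg_cis_mult_cnj by auto
  finally show ?thesis .
qed

lemma circle_avg_cos_mult_fejer_kernel:
  assumes "N > 0"
  shows "circle_avg (\<lambda>s. cos s * fejer_kernel N s) = 1 - 1 / real N"
proof -
  define w where "w = (\<lambda>k. (if k = 0 then real N else 2 * (real N - real k)) / real N)"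
  have "circle_avg (\<lambda>s. cos s * fejer_kernel N s) = circle_avg (\<lambda>s. \<Sum>k<N. w k * (cos (real k * s) * cos (real 1 * s)))"
    by (intro arg_cong[of _ _ circle_avg] ext)
       (simp add: fejer_kernel_def norm_dirichlet_sum_eq_cos w_def sum_distrib_left sum_divide_distrib mult_ac)
  also have "\<dots> = (\<Sum>k<N. w k * (if k = 1 then 1 / 2 else 0))"
    by (subst circle_avg_sum, simp, intro continuous_intros, simp only: circle_avg_mult_left circle_avg_cos_mult_cos)
       (intro sum.cong refl, auto)
  also have "\<dots> = (if 1 < N then w 1 / 2 else 0)"
    by (simp add: if_distrib cong: if_cong)
  also have "\<dots> = 1 - 1 / real N"
    using assms by (cases "N = 1") (auto simp: w_def field_simps)
  finally show ?thesis .
qed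

text \<open>
  The kernel is even, so the error is an average of second differences.  These are at most
  \<open>8 M (1 - cos s)\<close>, and the average of \<open>1 - cos s\<close> against the Fejer kernel depends only on its first
  Fourier coefficient: it is \<open>1 / N\<close>.
\<close>

lemma fejer_smoothing_error:
  fixes f :: "real \<Rightarrow> real"
  assumes cont: "continuous_on UNIV f" and per: "\<And>x. f (x + 2 * pi) = f x"
    and diff2: "\<And>x t. \<bar>2 * f x - f (x + t) - f (x - t)\<bar> \<le> M * t\<^sup>2"
    and N: "N > 0"
  shows "\<bar>circle_avg (\<lambda>s. f (x + s) * fejer_kernel N s) - f x\<bar> \<le> 4 * M / real N"
proof -
  have M: "M \<ge> 0" using diff2[of 0 1] by simp
  have cont_f: "continuous_on A (\<lambda>s. f (g s))" if "continuous_on A g" for A g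
    using continuous_on_compose2[OF cont that] by simp
  have cont_K: "continuous_on A (\<lambda>s. fejer_kernel N (g s))" if "continuous_on A g" for A g
    by (rule continuous_on_fejer_kernel[OF that])
  have fejer_per: "fejer_kernel N (s + 2 * pi) = fejer_kernel N s" for s
    unfolding fejer_kernel_def norm_dirichlet_sum_eq_cos
    using cos.plus_of_nat[of "real k * s" k for k] by (simp add: distrib_left mult_ac)
  have fejer_even: "fejer_kernel N (- s) = fejer_kernel N s" for s
    unfolding fejer_kernel_def norm_dirichlet_sum_eq_cos by simp
  have refl: "circle_avg (\<lambda>s. f (x + s) * fejer_kernel N s) = circle_avg (\<lambda>s. f (x - s) * fejer_kernel N s)"
    using circle_avg_reflect[of "\<lambda>s. f (x + s) * fejer_kernel N s"] per[of "x + s" for s]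
    by (simp add: fejer_per fejer_even add.assoc cont_f cont_K continuous_intros)
  have quad: "\<bar>2 * f x - f (x + s) - f (x - s)\<bar> \<le> 8 * M * (1 - cos s)" if s: "0 \<le> s" "s \<le> 2 * pi" for s
  proof -
    have small: "\<bar>2 * f x - f (x + s) - f (x - s)\<bar> \<le> 8 * M * (1 - cos s)" if s: "0 \<le> s" "s \<le> pi" for s
    proof -
      have "s / 4 \<le> s / 2 - (s / 2) ^ 3 / 6"
      proof -
        have "s\<^sup>2 \<le> 4\<^sup>2 * (3 / 4)"
        proof -
          have "s\<^sup>2 \<le> 3.2\<^sup>2" using s pi_approx by (intro power_mono) auto
          then show ?thesis by (simp add: power2_eq_square)
        qed
        then have "s * s\<^sup>2 \<le> s * 12" using s by (intro mult_left_mono) auto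
        then show ?thesis by (simp add: power3_eq_cube power2_eq_square field_simps)
      qed
      also have "\<dots> \<le> sin (s / 2)" using s by (intro sin_ge_minus_cubic) auto
      finally have "(s / 4)\<^sup>2 \<le> (sin (s / 2))\<^sup>2" using s by (intro power_mono) auto
      then have "s\<^sup>2 \<le> 8 * (1 - cos s)"
        using cos_double_sin[of "s / 2"] by (simp add: power2_eq_square)
      then have "M * s\<^sup>2 \<le> M * (8 * (1 - cos s))" using M by (intro mult_left_mono)
      with diff2[of x s] show ?thesis by (simp add: algebra_simps)
    qed
    show ?thesis
    proof (cases "s \<le> pi")
      case False
      then have "\<bar>2 * f x - f (x + (2 * pi - s)) - f (x - (2 * pi - s))\<bar> \<le> 8 * M * (1 - cos (2 * pi - s))"
        using s by (intro small) auto
      moreover have "cos (2 * pi - s) = cos s" by (simp add: cos_diff)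
      ultimately show ?thesis using per[of "x - s"] per[of "x + s - 2 * pi"] by (simp add: algebra_simps)
    qed (use small s in auto)
  qed
  have "2 * (circle_avg (\<lambda>s. f (x + s) * fejer_kernel N s) - f x) =
     circle_avg (\<lambda>s. f (x + s) * fejer_kernel N s) + circle_avg (\<lambda>s. f (x - s) * fejer_kernel N s)
      - 2 * f x * circle_avg (fejer_kernel N)"
    using refl circle_avg_fejer_kernel[OF N] by simp
  also have "\<dots> = circle_avg (\<lambda>s. f (x + s) * fejer_kernel N s + f (x - s) * fejer_kernel N s - 2 * f x * fejer_kernel N s)"
  proof -
    have cts: "continuous_on UNIV (\<lambda>s. f (x + s) * fejer_kernel N s)"
      "continuous_on UNIV (\<lambda>s. f (x - s) * fejer_kernel N s)"
      "continuous_on UNIV (\<lambda>s. 2 * f x * fejer_kernel N s)"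
      by (intro continuous_intros cont_f cont_K)+
    show ?thesis
      unfolding circle_avg_diff[OF continuous_on_add[OF cts(1,2)] cts(3)] circle_avg_add[OF cts(1,2)]
        circle_avg_mult_left ..
  qed
  finally have eq: "2 * (circle_avg (\<lambda>s. f (x + s) * fejer_kernel N s) - f x) =
    circle_avg (\<lambda>s. f (x + s) * fejer_kernel N s + f (x - s) * fejer_kernel N s - 2 * f x * fejer_kernel N s)" .
  have up: "circle_avg (\<lambda>s. 8 * M * (fejer_kernel N s - cos s * fejer_kernel N s)) = 8 * M / real N"
    by (subst circle_avg_mult_left, subst circle_avg_diff)
       (auto intro!: continuous_intros cont_K simp: circle_avg_cos_mult_fejer_kernel[OF N] circle_avg_fejer_kernel[OF N])
  have pt: "\<bar>f (x + s) * fejer_kernel N s + f (x - s) * fejer_kernel N s - 2 * f x * fejer_kernel N s\<bar>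
     \<le> 8 * M * (fejer_kernel N s - cos s * fejer_kernel N s)" if "0 \<le> s" "s \<le> 2 * pi" for s
  proof -
    have "\<bar>2 * f x - f (x + s) - f (x - s)\<bar> * fejer_kernel N s \<le> 8 * M * (1 - cos s) * fejer_kernel N s"
      by (intro mult_right_mono quad that fejer_kernel_nonneg)
    moreover have eq: "f (x + s) * fejer_kernel N s + f (x - s) * fejer_kernel N s - 2 * f x * fejer_kernel N s =
       - ((2 * f x - f (x + s) - f (x - s)) * fejer_kernel N s)" by (simp add: algebra_simps)
    ultimately show ?thesis
      unfolding eq abs_minus_cancel abs_mult abs_of_nonneg[OF fejer_kernel_nonneg]
      by (simp add: left_diff_distrib right_diff_distrib mult.assoc)
  qed
  have upper: "circle_avg (\<lambda>s. f (x + s) * fejer_kernel N s + f (x - s) * fejer_kernel N s - 2 * f x * fejer_kernel N s) \<le> 8 * M / real N"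
    unfolding up[symmetric] using pt by (intro circle_avg_mono continuous_intros cont_f cont_K) (auto simp: abs_le_iff)
  have lower: "circle_avg (\<lambda>s. - (8 * M * (fejer_kernel N s - cos s * fejer_kernel N s))) \<le>
     circle_avg (\<lambda>s. f (x + s) * fejer_kernel N s + f (x - s) * fejer_kernel N s - 2 * f x * fejer_kernel N s)"
  proof (intro circle_avg_mono continuous_intros cont_f cont_K)
    fix s :: real assume "0 \<le> s" "s \<le> 2 * pi"
    from pt[OF this] show "- (8 * M * (fejer_kernel N s - cos s * fejer_kernel N s))
      \<le> f (x + s) * fejer_kernel N s + f (x - s) * fejer_kernel N s - 2 * f x * fejer_kernel N s"
      by linarith
  qed
  have up': "circle_avg (\<lambda>s. - (8 * M * (fejer_kernel N s - cos s * fejer_kernel N s))) = - (8 * M / real N)"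
    unfolding up[symmetric] using circle_avg_mult_left[of "-1::real"] by simp
  have "\<bar>z\<bar> \<le> 4 * b" if "2 * z \<le> 8 * b" "- (8 * b) \<le> 2 * z" for z b :: real
    using that by linarith
  from this[of _ "M / real N"] show ?thesis
    using upper lower unfolding up' eq[symmetric] by simp
qed

text \<open>
  Convolution with a positive kernel preserves the mean, the range and bounds on the second
  differences.  So a function with the properties needed for \<open>conjugate_derivative_bound\<close> may be
  replaced by a trigonometric polynomial at the expense of a uniform error that tends to 0.
\<close>

lemma fejer_smoothing:
  fixes f :: "real \<Rightarrow> real"
  assumes cont: "continuous_on UNIV f" and per: "\<And>x. f (x + 2 * pi) = f x"
    and range: "\<And>x. 0 \<le> f x" "\<And>x. f x \<le> 1"
    and diff2: "\<And>x t. \<bar>2 * f x - f (x + t) - f (x - t)\<bar> \<le> M * t\<^sup>2"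
    and N: "N > 0"
  obtains c where "c 0 = of_real (circle_avg f)"
    "\<And>x. 0 \<le> trig_harmonic c N 1 x" "\<And>x. trig_harmonic c N 1 x \<le> 1"
    "\<And>x t. \<bar>2 * trig_harmonic c N 1 x - trig_harmonic c N 1 (x + t) - trig_harmonic c N 1 (x - t)\<bar> \<le> M * t\<^sup>2"
    "\<And>x. \<bar>trig_harmonic c N 1 x - f x\<bar> \<le> 4 * M / real N"
proof -
  define w where "w = (\<lambda>k. (if k = 0 then real N else 2 * (real N - real k)) / real N)"
  define c where "c = (\<lambda>k. of_real (w k) * circle_avg (\<lambda>u. of_real (f u) * cnj (cis (real k * u))))"
  have M: "M \<ge> 0" using diff2[of 0 1] by simp
  have cont_f: "continuous_on A (\<lambda>s. f (g s))" if "continuous_on A g" for A g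
    using continuous_on_compose2[OF cont that] by simp
  have cont_K: "continuous_on A (\<lambda>s. fejer_kernel N (g s))" if "continuous_on A g" for A g
    by (rule continuous_on_fejer_kernel[OF that])
  have conv: "trig_harmonic c N 1 x = circle_avg (\<lambda>s. f (x + s) * fejer_kernel N s)" for x
  proof -
    have "circle_avg (\<lambda>s. f (x + s) * fejer_kernel N s) = circle_avg (\<lambda>s. \<Sum>k<N. w k * (f (x + s) * cos (real k * s)))"
      by (intro arg_cong[of _ _ circle_avg] ext)
         (simp add: fejer_kernel_def norm_dirichlet_sum_eq_cos w_def sum_distrib_left sum_divide_distrib mult_ac)
    also have "\<dots> = (\<Sum>k<N. w k * circle_avg (\<lambda>s. f (x + s) * cos (real k * s)))"
      by (subst circle_avg_sum, simp, intro continuous_intros cont_f, simp only: circle_avg_mult_left)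
    also have "\<dots> = (\<Sum>k<N. Re (c k * cis (real k * x)))"
    proof (intro sum.cong refl)
      fix k
      have "f (x + s) * cos (real k * s) = f (s + x) * cos (real k * ((s + x) - x))" for s
        by (simp add: add.commute)
      then have "circle_avg (\<lambda>s. f (x + s) * cos (real k * s)) = circle_avg (\<lambda>s. f (s + x) * cos (real k * ((s + x) - x)))"
        by presburger
      also have "\<dots> = circle_avg (\<lambda>u. f u * cos (real k * (u - x)))"
      proof (rule circle_avg_shift[of "\<lambda>u. f u * cos (real k * (u - x))"])
        show "continuous_on UNIV (\<lambda>u. f u * cos (real k * (u - x)))"
          by (intro continuous_intros cont_f)
        show "f (u + 2 * pi) * cos (real k * (u + 2 * pi - x)) = f u * cos (real k * (u - x))" for u
          using cos.plus_of_nat[of "real k * (u - x)" k] per[of u] by (simp add: algebra_simps)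
      qed
      also have "\<dots> = circle_avg (\<lambda>u. Re (cis (real k * x) * (of_real (f u) * cnj (cis (real k * u)))))"
        by (intro arg_cong[of _ _ circle_avg] ext) (simp add: cis_cnj right_diff_distrib cos_diff algebra_simps)
      also have "\<dots> = Re (cis (real k * x) * circle_avg (\<lambda>u. of_real (f u) * cnj (cis (real k * u))))"
        by (subst circle_avg_Re, intro continuous_intros cont_f, subst circle_avg_mult_left, rule refl)
      finally have avg: "circle_avg (\<lambda>s. f (x + s) * cos (real k * s)) =
          Re (cis (real k * x) * circle_avg (\<lambda>u. of_real (f u) * cnj (cis (real k * u))))" .
      have "c k * cis (real k * x) =
          w k *\<^sub>R (cis (real k * x) * circle_avg (\<lambda>u. of_real (f u) * cnj (cis (real k * u))))"
        by (simp add: c_def scaleR_conv_of_real mult_ac)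
      then show "w k * circle_avg (\<lambda>s. f (x + s) * cos (real k * s)) = Re (c k * cis (real k * x))"
        by (simp only: avg scaleR_complex.sel)
    qed
    finally show ?thesis by (simp add: trig_harmonic_def)
  qed
  have one: "circle_avg (\<lambda>s. a * fejer_kernel N s) = a" for a
    by (simp add: circle_avg_mult_left circle_avg_fejer_kernel[OF N])
  show thesis
  proof (rule that[of c])
    have "circle_avg (\<lambda>u. complex_of_real (f u)) = of_real (circle_avg f)"
      using circle_avg_linear[OF bounded_linear_of_real cont] by simp
    then show "c 0 = of_real (circle_avg f)" using N by (simp add: c_def w_def)
  next
    fix x
    have "circle_avg (\<lambda>s. 0 * fejer_kernel N s) \<le> circle_avg (\<lambda>s. f (x + s) * fejer_kernel N s)"
      by (intro circle_avg_mono continuous_intros cont_f cont_K mult_right_mono range fejer_kernel_nonneg)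
    then show "0 \<le> trig_harmonic c N 1 x" unfolding conv one .
    have "circle_avg (\<lambda>s. f (x + s) * fejer_kernel N s) \<le> circle_avg (\<lambda>s. 1 * fejer_kernel N s)"
      by (intro circle_avg_mono continuous_intros cont_f cont_K mult_right_mono range fejer_kernel_nonneg)
    then show "trig_harmonic c N 1 x \<le> 1" unfolding conv one .
    show "\<bar>trig_harmonic c N 1 x - f x\<bar> \<le> 4 * M / real N"
      unfolding conv by (rule fejer_smoothing_error[OF cont per diff2 N])
  next
    fix x t
    let ?d = "\<lambda>s. 2 * (f (x + s) * fejer_kernel N s) - f (x + t + s) * fejer_kernel N s - f (x - t + s) * fejer_kernel N s"
    have eq: "2 * trig_harmonic c N 1 x - trig_harmonic c N 1 (x + t) - trig_harmonic c N 1 (x - t) = circle_avg ?d"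
    proof -
      have cts: "continuous_on UNIV (\<lambda>s. 2 * (f (x + s) * fejer_kernel N s))"
        "continuous_on UNIV (\<lambda>s. f (x + t + s) * fejer_kernel N s)"
        "continuous_on UNIV (\<lambda>s. f (x - t + s) * fejer_kernel N s)"
        by (intro continuous_intros cont_f cont_K)+
      show ?thesis
        unfolding conv circle_avg_diff[OF continuous_on_diff[OF cts(1,2)] cts(3)] circle_avg_diff[OF cts(1,2)]
          circle_avg_mult_left ..
    qed
    have pt: "\<bar>?d s\<bar> \<le> M * t\<^sup>2 * fejer_kernel N s" for s
    proof -
      have "\<bar>2 * f (x + s) - f (x + s + t) - f (x + s - t)\<bar> * fejer_kernel N s \<le> M * t\<^sup>2 * fejer_kernel N s"
        by (intro mult_right_mono diff2 fejer_kernel_nonneg)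
      moreover have "?d s = (2 * f (x + s) - f (x + s + t) - f (x + s - t)) * fejer_kernel N s"
        by (simp add: algebra_simps)
      ultimately show ?thesis using fejer_kernel_nonneg[of N s] by (simp add: abs_mult)
    qed
    have "circle_avg ?d \<le> circle_avg (\<lambda>s. M * t\<^sup>2 * fejer_kernel N s)"
      using pt by (intro circle_avg_mono continuous_intros cont_f cont_K) (auto simp: abs_le_iff)
    moreover have "circle_avg (\<lambda>s. - (M * t\<^sup>2) * fejer_kernel N s) \<le> circle_avg ?d"
    proof (intro circle_avg_mono continuous_intros cont_f cont_K)
      fix s
      show "- (M * t\<^sup>2) * fejer_kernel N s \<le> ?d s"
        using pt[of s] unfolding mult_minus_left by linarith
    qed
    ultimately show "\<bar>2 * trig_harmonic c N 1 x - trig_harmonic c N 1 (x + t) - trig_harmonic c N 1 (x - t)\<bar> \<le> M * t\<^sup>2"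
      unfolding eq one by linarith
  qed
qed

section \<open>A smooth majorant of an arc\<close>

text \<open>
  The distance from \<open>x\<close> to the nearest multiple of \<open>2 \<pi>\<close>.
\<close>

definition circle_dist :: "real \<Rightarrow> real" where
  "circle_dist x = arccos (cos x)"

lemma circle_dist_le_abs: "circle_dist x \<le> \<bar>x\<bar>"
proof (cases "\<bar>x\<bar> \<le> pi")
  case True
  then show ?thesis using arccos_cos_eq_abs[of x] by (simp add: circle_dist_def)
next
  case False
  then show ?thesis using arccos_ubound[of "cos x"] by (simp add: circle_dist_def)
qed

text \<open>
  Up to sign, \<open>x\<close> is congruent to \<open>circle_dist x\<close> modulo \<open>2 \<pi>\<close>.
\<close>

lemma circle_dist_add_le: "circle_dist (x + t) \<le> circle_dist x + \<bar>t\<bar>"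
proof -
  define a where "a = circle_dist x"
  have a: "0 \<le> a" "cos a = cos x" "sin a = \<bar>sin x\<bar>"
    by (simp_all add: a_def circle_dist_def arccos_lbound sin_arccos_abs flip: sin_squared_eq)
  have "cos (x + t) = cos (a + t) \<or> cos (x + t) = cos (a - t)"
    by (simp add: cos_add cos_diff a abs_if)
  then have "circle_dist (x + t) \<le> \<bar>a + t\<bar> \<or> circle_dist (x + t) \<le> \<bar>a - t\<bar>"
    using circle_dist_le_abs[of "a + t"] circle_dist_le_abs[of "a - t"] by (auto simp: circle_dist_def)
  then show ?thesis using a(1) unfolding a_def[symmetric] by linarith
qed

lemma circle_dist_lipschitz: "\<bar>circle_dist x - circle_dist y\<bar> \<le> \<bar>x - y\<bar>"
  using circle_dist_add_le[of x "y - x"] circle_dist_add_le[of y "x - y"] by simp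

definition trapezoid :: "real \<Rightarrow> real \<Rightarrow> real" where
  "trapezoid d u = max 0 (min 1 (u / d))"

lemma trapezoid_lipschitz: "d > 0 \<Longrightarrow> \<bar>trapezoid d u - trapezoid d v\<bar> \<le> \<bar>u - v\<bar> / d"
proof -
  assume "d > 0"
  have "\<bar>max 0 (min 1 a) - max 0 (min 1 b)\<bar> \<le> \<bar>a - b\<bar>" for a b :: real by linarith
  from this[of "u / d" "v / d"] show ?thesis using \<open>d > 0\<close>
    by (simp add: trapezoid_def diff_divide_distrib[symmetric])
qed

text \<open>
  The trapezoid is a difference of two functions \<open>max 0 u\<close>; with this primitive it can be integrated
  without distinguishing the positions of its corners.
\<close>

lemma has_real_derivative_half_pos_part_squared:
  "((\<lambda>u. (max 0 u)\<^sup>2 / 2) has_real_derivative max 0 u) (at u)"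
  unfolding DERIV_def
proof -
  have bound: "\<bar>((max 0 (u + h))\<^sup>2 / 2 - (max 0 u)\<^sup>2 / 2) / h - max 0 u\<bar> \<le> \<bar>h\<bar>" if "h \<noteq> 0" for h
  proof -
    have "\<bar>(max 0 (u + h))\<^sup>2 / 2 - (max 0 u)\<^sup>2 / 2 - h * max 0 u\<bar> \<le> h\<^sup>2"
    proof -
      consider "u \<ge> 0" "u + h \<ge> 0" | "u \<ge> 0" "u + h < 0" | "u < 0" "u + h \<ge> 0" | "u < 0" "u + h < 0" by linarith
      then show ?thesis
      proof cases
        case 1
        then show ?thesis by (simp add: power2_eq_square algebra_simps)
      next
        case 2
        have "\<bar>- (u\<^sup>2 / 2) - h * u\<bar> \<le> h\<^sup>2"
        proof -
          have "0 \<le> u * (- h)" "u * u \<le> u * (- h)" "u * (- h) \<le> (- h) * (- h)"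
            using 2 mult_nonneg_nonneg[of u "- h"] mult_left_mono[of u "- h" u] mult_right_mono[of u "- h" "- h"]
            by simp_all
          moreover have "0 \<le> u * u" by simp
          ultimately show ?thesis by (simp only: power2_eq_square) argo
        qed
        then show ?thesis using 2 by simp
      next
        case 3
        have "(u + h)\<^sup>2 \<le> h\<^sup>2" using 3 by (intro power_mono) auto
        moreover have "0 \<le> h\<^sup>2" by simp
        ultimately have "(u + h)\<^sup>2 / 2 \<le> h\<^sup>2" by linarith
        then show ?thesis using 3 by simp
      next
        case 4
        then show ?thesis by simp
      qed
    qed
    then have "\<bar>(max 0 (u + h))\<^sup>2 / 2 - (max 0 u)\<^sup>2 / 2 - h * max 0 u\<bar> / \<bar>h\<bar> \<le> h\<^sup>2 / \<bar>h\<bar>"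
      by (intro divide_right_mono) auto
    moreover have "h\<^sup>2 / \<bar>h\<bar> = \<bar>h\<bar>" using that by (simp add: power2_eq_square field_simps abs_mult_self_eq)
    moreover have "((max 0 (u + h))\<^sup>2 / 2 - (max 0 u)\<^sup>2 / 2 - h * max 0 u) / h =
        ((max 0 (u + h))\<^sup>2 / 2 - (max 0 u)\<^sup>2 / 2) / h - max 0 u"
      using that by (simp add: diff_divide_distrib)
    ultimately show ?thesis by (metis abs_divide)
  qed
  show "(\<lambda>h. ((max 0 (u + h))\<^sup>2 / 2 - (max 0 u)\<^sup>2 / 2) / h) \<midarrow>0\<rightarrow> max 0 u"
    by (rule LIM_I, rule_tac x = r in exI, use bound in \<open>fastforce intro: le_less_trans\<close>)
qed

lemma integral_trapezoid_le:
  assumes d: "d > 0" and b: "b \<ge> 3 * d / 2" and B: "B \<ge> 0"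
  shows "integral {0..B} (\<lambda>x. trapezoid d (b - x)) \<le> b - d / 2"
proof -
  define R where "R = (\<lambda>u::real. (max 0 u)\<^sup>2 / 2)"
  have R: "(R has_real_derivative max 0 u) (at u)" for u
    unfolding R_def by (rule has_real_derivative_half_pos_part_squared)
  have mono: "R u \<le> R v" if "u \<le> v" for u v
    unfolding R_def using that by (intro divide_right_mono power_mono) auto
  \<comment> \<open>a primitive of \<open>trapezoid d (b - x) = max 0 u - max 0 (u - 1)\<close> with \<open>u = (b - x) / d\<close>\<close>
  define G where "G = (\<lambda>x. d * (R ((b - x) / d - 1) - R ((b - x) / d)))"
  have "((\<lambda>x. trapezoid d (b - x)) has_integral G B - G 0) {0..B}"
  proof (rule fundamental_theorem_of_calculus[OF B])
    fix x
    have "(G has_real_derivative d * (max 0 ((b - x) / d - 1) * (- 1 / d) - max 0 ((b - x) / d) * (- 1 / d))) (at x)"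
      unfolding G_def using d
      by (auto intro!: derivative_eq_intros DERIV_chain2[OF R] simp: field_simps)
    also have "d * (max 0 ((b - x) / d - 1) * (- 1 / d) - max 0 ((b - x) / d) * (- 1 / d)) = trapezoid d (b - x)"
    proof -
      have "d * (p * (- 1 / d) - q * (- 1 / d)) = q - p" for p q using d by (simp add: field_simps)
      then show ?thesis by (simp add: trapezoid_def max_def min_def)
    qed
    finally show "(G has_vector_derivative trapezoid d (b - x)) (at x within {0..B})"
      by (simp add: has_real_derivative_iff_has_vector_derivative has_vector_derivative_at_within)
  qed
  then have "integral {0..B} (\<lambda>x. trapezoid d (b - x)) = G B - G 0" by (rule integral_unique)
  also have "\<dots> \<le> - G 0"
    using mono[of "(b - B) / d - 1" "(b - B) / d"] d by (simp add: G_def mult_le_0_iff)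
  also have "\<dots> = b - d / 2"
  proof -
    have "b / d \<ge> 1" using b d by (simp add: field_simps)
    then have "- G 0 = d * ((b / d)\<^sup>2 / 2 - (b / d - 1)\<^sup>2 / 2)" by (simp add: G_def R_def max_def right_diff_distrib)
    also have "y\<^sup>2 / 2 - (y - 1)\<^sup>2 / 2 = y - 1 / 2" for y :: real
      by (simp add: power2_eq_square field_simps)
    note this[of "b / d"]
    finally show ?thesis using d by (simp add: algebra_simps)
  qed
  finally show ?thesis .
qed

text \<open>
  The second difference of \<open>f\<close> vanishes at \<open>t = 0\<close>, and its derivative in \<open>t\<close> is \<open>1 / d\<close> times the sum of
  two increments of \<open>\<plusminus>g\<close> over distances \<open>2 t\<close>, hence at most \<open>4 t / d\<^sup>2\<close>.
\<close>

lemma box_average_second_difference: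
  fixes g :: "real \<Rightarrow> real"
  assumes d: "d > 0" and lip: "\<And>x y. \<bar>g x - g y\<bar> \<le> \<bar>x - y\<bar> / d"
  defines "f \<equiv> (\<lambda>x. integral {-d/2..d/2} (\<lambda>s. g (x + s)) / d)"
  shows "\<bar>2 * f x - f (x + t) - f (x - t)\<bar> \<le> 2 * t\<^sup>2 / d\<^sup>2"
proof -
  have cont: "continuous_on A g" for A
  proof (rule continuous_on_subset[of UNIV])
    show "continuous_on UNIV g"
      unfolding continuous_on_iff dist_real_def
    proof (intro ballI allI impI)
      fix x e :: real assume "e > 0"
      have "\<bar>g y - g x\<bar> < e" if "\<bar>y - x\<bar> < d * e" for y
      proof -
        have "\<bar>y - x\<bar> / d < e" using that d by (simp add: field_simps)
        with lip[of y x] show ?thesis by linarith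
      qed
      then show "\<exists>\<delta>>0. \<forall>y\<in>UNIV. \<bar>y - x\<bar> < \<delta> \<longrightarrow> \<bar>g y - g x\<bar> < e"
        using d \<open>e > 0\<close> by (intro exI[of _ "d * e"]) auto
    qed
  qed auto
  have main: "\<bar>2 * f x - f (x + t) - f (x - t)\<bar> \<le> 2 * t\<^sup>2 / d\<^sup>2" if t: "t \<ge> 0" for t
  proof -
    \<comment> \<open>any base point of the primitive to the left of all arguments that occur\<close>
    define a where "a = x - t - d"
    define H where "H = (\<lambda>y. integral {a..y} g)"
    have H: "(H has_real_derivative g y) (at y)" if "y > a" for y
    proof -
      have "(H has_real_derivative g y) (at y within {a..y+1})"
        unfolding H_def using that by (intro integral_has_real_derivative cont) auto
      moreover have "at y within {a..y+1} = at y" using that by (intro at_within_Icc_at) auto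
      ultimately show ?thesis by simp
    qed
    have f_eq: "f y = (H (y + d / 2) - H (y - d / 2)) / d" if "y \<ge> x - t" for y
    proof -
      have "integral {-d/2..d/2} (\<lambda>s. g (y + s)) = integral {y - d/2..y + d/2} g"
        using integral_shift_real_ivl[of "y - d/2" y "y + d/2" g] by (simp add: add.commute)
      moreover have "H (y - d/2) + integral {y - d/2..y + d/2} g = H (y + d/2)"
        unfolding H_def using d that
        by (intro Henstock_Kurzweil_Integration.integral_combine integrable_continuous_interval cont) (auto simp: a_def)
      ultimately show ?thesis by (simp add: f_def)
    qed
    define k where "k = (\<lambda>\<tau>. (H (x + \<tau> + d/2) - H (x + \<tau> - d/2) + H (x - \<tau> + d/2) - H (x - \<tau> - d/2)) / d)"
    have k_eq: "k \<tau> = f (x + \<tau>) + f (x - \<tau>)" if "0 \<le> \<tau>" "\<tau> \<le> t" for \<tau>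
      using that t f_eq[of "x + \<tau>"] f_eq[of "x - \<tau>"] by (simp add: k_def add_divide_distrib[symmetric])
    define k' where "k' = (\<lambda>\<tau>. (g (x + \<tau> + d/2) - g (x + \<tau> - d/2) - g (x - \<tau> + d/2) + g (x - \<tau> - d/2)) / d)"
    have k': "(k has_real_derivative k' \<tau>) (at \<tau>)" if "0 \<le> \<tau>" "\<tau> \<le> t" for \<tau>
      unfolding k_def k'_def using that d
      by (auto intro!: derivative_eq_intros DERIV_chain2[OF H] simp: a_def)
    have k'_bound: "\<bar>k' \<tau>\<bar> \<le> 4 * \<tau> / d\<^sup>2" if "0 \<le> \<tau>" for \<tau>
    proof -
      have "\<bar>g (x + \<tau> + d/2) - g (x - \<tau> + d/2)\<bar> \<le> 2 * \<tau> / d"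
        using lip[of "x + \<tau> + d/2" "x - \<tau> + d/2"] that by simp
      moreover have "\<bar>g (x + \<tau> - d/2) - g (x - \<tau> - d/2)\<bar> \<le> 2 * \<tau> / d"
        using lip[of "x + \<tau> - d/2" "x - \<tau> - d/2"] that by simp
      ultimately have "\<bar>g (x + \<tau> + d/2) - g (x + \<tau> - d/2) - g (x - \<tau> + d/2) + g (x - \<tau> - d/2)\<bar> \<le> 4 * \<tau> / d"
        by linarith
      then have "\<bar>g (x + \<tau> + d/2) - g (x + \<tau> - d/2) - g (x - \<tau> + d/2) + g (x - \<tau> - d/2)\<bar> / d \<le> 4 * \<tau> / d / d"
        using d by (intro divide_right_mono) auto
      then show ?thesis using d by (simp add: k'_def abs_divide power2_eq_square)
    qed
    define q where "q = 2 / d\<^sup>2"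
    have k'_bound: "\<bar>k' \<tau>\<bar> \<le> q * (2 * \<tau>)" if "0 \<le> \<tau>" for \<tau>
      using k'_bound[OF that] by (simp add: q_def)
    have "k 0 + q * 0\<^sup>2 \<le> k t + q * t\<^sup>2"
    proof (rule DERIV_nonneg_imp_nondecreasing[OF t])
      fix \<tau> assume \<tau>: "0 \<le> \<tau>" "\<tau> \<le> t"
      have "((\<lambda>\<tau>. k \<tau> + q * \<tau>\<^sup>2) has_real_derivative k' \<tau> + q * (2 * \<tau>)) (at \<tau>)"
        by (auto intro!: derivative_eq_intros k' \<tau>)
      then show "\<exists>y. ((\<lambda>\<tau>. k \<tau> + q * \<tau>\<^sup>2) has_real_derivative y) (at \<tau>) \<and> 0 \<le> y"
        using k'_bound[OF \<tau>(1)] by (intro exI conjI) (assumption, linarith)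
    qed
    moreover have "k t - q * t\<^sup>2 \<le> k 0 - q * 0\<^sup>2"
    proof (rule DERIV_nonpos_imp_nonincreasing[OF t])
      fix \<tau> assume \<tau>: "0 \<le> \<tau>" "\<tau> \<le> t"
      have "((\<lambda>\<tau>. k \<tau> - q * \<tau>\<^sup>2) has_real_derivative k' \<tau> - q * (2 * \<tau>)) (at \<tau>)"
        by (auto intro!: derivative_eq_intros k' \<tau>)
      then show "\<exists>y. ((\<lambda>\<tau>. k \<tau> - q * \<tau>\<^sup>2) has_real_derivative y) (at \<tau>) \<and> y \<le> 0"
        using k'_bound[OF \<tau>(1)] by (intro exI conjI) (assumption, linarith)
    qed
    ultimately have "\<bar>2 * f x - f (x + t) - f (x - t)\<bar> \<le> q * t\<^sup>2"
      using k_eq[of 0] k_eq[of t] t by simp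
    then show ?thesis by (simp add: q_def)
  qed
  show ?thesis
  proof (cases "t \<ge> 0")
    case False
    with main[of "- t"] show ?thesis by (simp add: algebra_simps)
  qed (rule main)
qed

text \<open>
  The box average over a window of width \<open>d\<close> of a trapezoid that is 1 up to the distance \<open>l + d / 2\<close> from
  0 and descends to 0 over a length \<open>d\<close>.  Averaging makes the second differences quadratically small and
  does not change the mean.
\<close>

lemma smooth_arc_majorant:
  assumes d: "d > 0" and l: "l \<ge> 0"
  obtains f :: "real \<Rightarrow> real" where "continuous_on UNIV f" "\<And>x. f (x + 2 * pi) = f x"
    "\<And>x. 0 \<le> f x" "\<And>x. f x \<le> 1"
    "\<And>x t. \<bar>2 * f x - f (x + t) - f (x - t)\<bar> \<le> 2 / d\<^sup>2 * t\<^sup>2"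
    "\<And>x. circle_dist x \<le> l \<Longrightarrow> f x = 1"
    "circle_avg f \<le> (l + d) / pi"
proof -
  \<comment> \<open>\<open>b\<close> is the distance at which the trapezoid reaches 0; it is 1 up to the distance \<open>l + d / 2\<close>\<close>
  define b where "b = l + 3 * d / 2"
  define g where "g = (\<lambda>x. trapezoid d (b - circle_dist x))"
  define f where "f = (\<lambda>x. integral {-d/2..d/2} (\<lambda>s. g (x + s)) / d)"
  have lip: "\<bar>g x - g y\<bar> \<le> \<bar>x - y\<bar> / d" for x y
  proof -
    have "\<bar>g x - g y\<bar> \<le> \<bar>(b - circle_dist x) - (b - circle_dist y)\<bar> / d"
      unfolding g_def by (rule trapezoid_lipschitz[OF d])
    also have "\<dots> \<le> \<bar>x - y\<bar> / d"
      using circle_dist_lipschitz[of y x] d by (intro divide_right_mono) (auto simp: abs_minus_commute)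
    finally show ?thesis .
  qed
  have cont_UNIV: "continuous_on UNIV g"
    unfolding g_def trapezoid_def circle_dist_def using d by (intro continuous_intros) auto
  have cont: "continuous_on A (\<lambda>x. g (h x))" if "continuous_on A h" for A :: "'b::topological_space set" and h
    using continuous_on_compose2[OF cont_UNIV that] by simp
  have range: "0 \<le> g x" "g x \<le> 1" for x by (auto simp: g_def trapezoid_def)
  have per: "g (x + 2 * pi) = g x" for x by (simp add: g_def circle_dist_def)
  have int: "(\<lambda>s. g (x + s)) integrable_on {a..b}" for x a b
    by (intro integrable_continuous_interval cont continuous_intros)
  have d2: "- d / 2 \<le> d / 2" using d by simp
  have cont_f: "continuous_on UNIV f"
  proof -
    have "continuous_on UNIV (\<lambda>x. integral (cbox (-d/2) (d/2)) (\<lambda>s. g (x + s)))"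
      by (rule integral_continuous_on_param) (auto intro!: cont continuous_intros simp: case_prod_beta)
    then show ?thesis using d unfolding f_def by (auto intro!: continuous_intros)
  qed
  show thesis
  proof (rule that[of f])
    show "f (x + 2 * pi) = f x" for x
      using per[of "x + s" for s] by (simp add: f_def algebra_simps)
    show "0 \<le> f x" for x
      unfolding f_def using d int by (intro divide_nonneg_pos integral_nonneg range) auto
    show "f x \<le> 1" for x
    proof -
      have "integral {-d/2..d/2} (\<lambda>s. g (x + s)) \<le> integral {-d/2..d/2} (\<lambda>s. 1)"
        by (intro integral_le int range integrable_const_ivl)
      then show ?thesis using d by (simp add: f_def)
    qed
    show "\<bar>2 * f x - f (x + t) - f (x - t)\<bar> \<le> 2 / d\<^sup>2 * t\<^sup>2" for x t
      using box_average_second_difference[OF d lip, of x t] unfolding f_def by simp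
    show "f x = 1" if "circle_dist x \<le> l" for x
    proof -
      have "g (x + s) = 1" if s: "s \<in> {-d/2..d/2}" for s
      proof -
        have "circle_dist (x + s) \<le> l + d / 2"
          using circle_dist_add_le[of x s] \<open>circle_dist x \<le> l\<close> s by auto
        then have "1 \<le> (b - circle_dist (x + s)) / d" using d by (simp add: b_def field_simps)
        then show ?thesis by (simp add: g_def trapezoid_def)
      qed
      then have "integral {-d/2..d/2} (\<lambda>s. g (x + s)) = integral {-d/2..d/2} (\<lambda>s. 1)"
        by (intro Henstock_Kurzweil_Integration.integral_cong) auto
      then show ?thesis using d by (simp add: f_def)
    qed
    have avg_eq: "circle_avg f = circle_avg g"
    proof -
      have "integral (cbox 0 (2*pi)) (\<lambda>x. integral (cbox (-d/2) (d/2)) (\<lambda>s. g (x + s))) =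
          integral (cbox (-d/2) (d/2)) (\<lambda>s. integral (cbox 0 (2*pi)) (\<lambda>x. g (x + s)))"
        by (rule integral_swap_continuous) (auto intro!: cont continuous_intros simp: case_prod_beta)
      also have "\<dots> = integral {-d/2..d/2} (\<lambda>s. 2 * pi * circle_avg g)"
      proof -
        have "integral {0..2*pi} (\<lambda>x. g (x + s)) = 2 * pi * circle_avg g" for s
          using circle_avg_shift[OF cont_UNIV per, of s] by (simp add: circle_avg_def field_simps)
        then show ?thesis by simp
      qed
      also have "\<dots> = d * (2 * pi * circle_avg g)" using d by simp
      finally have "integral {0..2*pi} (\<lambda>x. integral {-d/2..d/2} (\<lambda>s. g (x + s))) = d * (2 * pi * circle_avg g)"
        by simp
      moreover have "integral {0..2*pi} f = integral {0..2*pi} (\<lambda>x. integral {-d/2..d/2} (\<lambda>s. g (x + s))) / d"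
        unfolding f_def by simp
      ultimately show ?thesis using d by (simp add: circle_avg_def)
    qed
    have "integral {0..2*pi} g \<le> 2 * (l + d)"
    proof -
      have int_g: "g integrable_on {a..b}" for a b
        by (intro integrable_continuous_interval continuous_on_subset[OF cont_UNIV]) auto
      have "integral {0..pi} g = integral {0..pi} (\<lambda>x. trapezoid d (b - x))"
        unfolding g_def by (intro Henstock_Kurzweil_Integration.integral_cong) (auto simp: circle_dist_def arccos_cos)
      also have "\<dots> \<le> l + d"
        using integral_trapezoid_le[of d b pi] d l by (simp add: b_def)
      finally have left: "integral {0..pi} g \<le> l + d" .
      have "integral {pi..2*pi} g = integral {-(2*pi)..-pi} (\<lambda>x. g (- x))"
        using Henstock_Kurzweil_Integration.integral_reflect_real[where a = pi and b = "2 * pi" and f = g] by simp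
      also have "\<dots> = integral {-(2*pi)..-pi} (\<lambda>x. g (x + 2 * pi))"
        using per by (simp add: g_def circle_dist_def)
      also have "\<dots> = integral {0..pi} g"
        using integral_shift_real_ivl[of 0 "2*pi" pi g] by simp
      finally have "integral {pi..2*pi} g = integral {0..pi} g" .
      moreover have "integral {0..pi} g + integral {pi..2*pi} g = integral {0..2*pi} g"
        by (intro Henstock_Kurzweil_Integration.integral_combine int_g) auto
      ultimately have "integral {0..2*pi} g = integral {0..pi} g + integral {0..pi} g" by simp
      with left show ?thesis by simp
    qed
    then have "circle_avg g \<le> (l + d) / pi"
      by (simp add: circle_avg_def field_simps)
    then show "circle_avg f \<le> (l + d) / pi" by (simp add: avg_eq)
  qed (rule cont_f)
qed

section \<open>A weighted Jensen inequality\<close>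

lemma circle_avg_trig_harmonic: "N > 0 \<Longrightarrow> circle_avg (trig_harmonic b N 1) = Re (b 0)"
proof -
  assume "N > 0"
  have "circle_avg (trig_harmonic b N 1) = Re (circle_avg (\<lambda>x. \<Sum>k<N. b k * cis (real_of_int (int k) * x)))"
    unfolding trig_harmonic_def[abs_def] by (subst circle_avg_Re) (auto intro!: continuous_intros)
  also have "\<dots> = Re (\<Sum>k<N. b k * (if k = 0 then 1 else 0))"
    by (subst circle_avg_sum) (auto intro!: continuous_intros simp: circle_avg_mult_left circle_avg_cis simp del: of_int_of_nat_eq)
  also have "\<dots> = Re (b 0)" using \<open>N > 0\<close> by (simp add: if_distrib cong: if_cong)
  finally show ?thesis .
qed

lemma trig_harmonic_weight_quotient:
  assumes "N > 0"
  shows "trig_harmonic (\<lambda>k. (if k = 0 then 1 else - (of_nat k * c k / of_real B)) / of_nat k) N s \<alpha> =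
    - (trig_harmonic c N s \<alpha> - Re (c 0)) / B"
proof -
  obtain m where N: "N = Suc m" using assms gr0_conv_Suc by blast
  define S where "S = (\<Sum>j<m. c (Suc j) * of_real s ^ Suc j * cis (real (Suc j) * \<alpha>))"
  have quot: "- (of_nat (Suc j) * c (Suc j) / of_real B) / of_nat (Suc j) = - (1 / of_real B) * c (Suc j)" for j
    by (simp del: of_nat_Suc)
  have "trig_harmonic (\<lambda>k. (if k = 0 then 1 else - (of_nat k * c k / of_real B)) / of_nat k) N s \<alpha> =
      Re (- (1 / of_real B) * S)"
    unfolding trig_harmonic_def N sum.lessThan_Suc_shift S_def
    by (simp add: quot sum_distrib_left mult.assoc del: of_nat_Suc power_Suc)
  also have "\<dots> = - Re S / B" by (simp add: Re_divide_of_real)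
  also have "Re S = trig_harmonic c N s \<alpha> - Re (c 0)"
    unfolding trig_harmonic_def N sum.lessThan_Suc_shift S_def by simp
  finally show ?thesis .
qed

text \<open>
  Concavity of the logarithm, in the form \<open>ln x \<le> ln A + x / A - 1\<close>, is averaged against the density
  \<open>W = 1 - G / B\<close>; the left-hand side is twice the sum of the logarithmic potentials of \<open>W\<close> at the points
  \<open>\<sigma>\<^sub>j e\<^bsup>i\<theta>\<^sub>j\<^esup>\<close>.
\<close>

lemma weighted_jensen_interior:
  fixes \<sigma> \<theta> :: "nat \<Rightarrow> real" and c :: "nat \<Rightarrow> complex" and B :: real and N :: nat
  defines "W \<equiv> (\<lambda>\<phi>. 1 - trig_harmonic (\<lambda>k. of_nat k * c k) N 1 \<phi> / B)"
  assumes N: "N > 0" and B: "B > 0" and bound: "\<And>\<phi>. trig_harmonic (\<lambda>k. of_nat k * c k) N 1 \<phi> \<le> B"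
    and \<sigma>: "\<And>j. j < n \<Longrightarrow> 0 \<le> \<sigma> j \<and> \<sigma> j < 1" and A: "A > 0"
  shows "(\<Sum>j<n. (trig_harmonic c N (\<sigma> j) (\<theta> j) - Re (c 0)) / B) \<le>
    ln A + circle_avg (\<lambda>\<phi>. W \<phi> * (\<Prod>j<n. (norm (cis \<phi> - of_real (\<sigma> j) * cis (\<theta> j)))\<^sup>2)) / A - 1"
proof -
  define b where "b = (\<lambda>k. if k = 0 then 1 else - (of_nat k * c k / of_real B))"
  define R where "R = (\<lambda>\<phi>. \<Prod>j<n. (norm (cis \<phi> - of_real (\<sigma> j) * cis (\<theta> j)))\<^sup>2)"
  define f where "f = (\<lambda>j \<phi>. trig_harmonic b N 1 \<phi> * ln (norm (cis \<phi> - of_real (\<sigma> j) * cis (\<theta> j))))"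
  have W_eq: "W \<phi> = trig_harmonic b N 1 \<phi>" for \<phi>
  proof -
    obtain m where m: "N = Suc m" using N gr0_conv_Suc by blast
    show ?thesis
      unfolding W_def trig_harmonic_def m sum.lessThan_Suc_shift b_def
      by (simp add: sum_divide_distrib sum_negf)
  qed
  have W_nonneg: "trig_harmonic b N 1 \<phi> \<ge> 0" for \<phi>
    using bound[of \<phi>] B by (simp add: W_eq[symmetric] W_def)
  have ne: "cis \<phi> - of_real (\<sigma> j) * cis (\<theta> j) \<noteq> 0" if "j < n" for j \<phi>
  proof
    assume "cis \<phi> - of_real (\<sigma> j) * cis (\<theta> j) = 0"
    then have "norm (cis \<phi>) = norm (of_real (\<sigma> j) * cis (\<theta> j))" by simp
    then show False using \<sigma>[OF that] by (simp add: norm_mult)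
  qed
  have cont_f: "continuous_on UNIV (f j)" if "j < n" for j
    unfolding f_def using ne[OF that] by (intro continuous_intros continuous_on_trig_harmonic) auto
  have cont_R: "continuous_on UNIV R" unfolding R_def by (intro continuous_intros)
  have R_pos: "R \<phi> > 0" for \<phi> unfolding R_def using ne by (intro prod_pos) auto
  have ln_R: "trig_harmonic b N 1 \<phi> * ln (R \<phi>) = (\<Sum>j<n. 2 * f j \<phi>)" for \<phi>
  proof -
    have "ln (R \<phi>) = (\<Sum>j<n. ln ((norm (cis \<phi> - of_real (\<sigma> j) * cis (\<theta> j)))\<^sup>2))"
      unfolding R_def using ne by (intro ln_prod) auto
    also have "\<dots> = (\<Sum>j<n. 2 * ln (norm (cis \<phi> - of_real (\<sigma> j) * cis (\<theta> j))))"
      using ne by (intro sum.cong refl) (simp add: ln_realpow)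
    finally show ?thesis by (simp add: f_def sum_distrib_left mult_ac)
  qed
  have "(\<Sum>j<n. (trig_harmonic c N (\<sigma> j) (\<theta> j) - Re (c 0)) / B) = (\<Sum>j<n. 2 * circle_avg (f j))"
  proof (intro sum.cong refl)
    fix j assume "j \<in> {..<n}"
    then have "circle_avg (f j) = - (1 / 2) * trig_harmonic (\<lambda>k. b k / of_nat k) N (\<sigma> j) (\<theta> j)"
      unfolding f_def using \<sigma>[of j] by (intro circle_avg_log_potential) auto
    also have "trig_harmonic (\<lambda>k. b k / of_nat k) N (\<sigma> j) (\<theta> j) = - (trig_harmonic c N (\<sigma> j) (\<theta> j) - Re (c 0)) / B"
      unfolding b_def by (rule trig_harmonic_weight_quotient[OF N])
    finally show "(trig_harmonic c N (\<sigma> j) (\<theta> j) - Re (c 0)) / B = 2 * circle_avg (f j)"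
      using B by (simp add: field_simps)
  qed
  also have "\<dots> = circle_avg (\<lambda>\<phi>. \<Sum>j<n. 2 * f j \<phi>)"
    by (subst circle_avg_sum) (auto intro!: continuous_intros cont_f simp: circle_avg_mult_left)
  also have "\<dots> \<le> circle_avg (\<lambda>\<phi>. (ln A - 1) * trig_harmonic b N 1 \<phi> + 1 / A * (trig_harmonic b N 1 \<phi> * R \<phi>))"
  proof (rule circle_avg_mono)
    fix \<phi>
    have "ln (R \<phi> / A) \<le> R \<phi> / A - 1" using R_pos[of \<phi>] A by (intro ln_le_minus_one) auto
    then have "ln (R \<phi>) \<le> ln A - 1 + R \<phi> / A" using R_pos[of \<phi>] A by (simp add: ln_div)
    then have "trig_harmonic b N 1 \<phi> * ln (R \<phi>) \<le> trig_harmonic b N 1 \<phi> * (ln A - 1 + R \<phi> / A)"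
      by (intro mult_left_mono W_nonneg)
    then show "(\<Sum>j<n. 2 * f j \<phi>) \<le> (ln A - 1) * trig_harmonic b N 1 \<phi> + 1 / A * (trig_harmonic b N 1 \<phi> * R \<phi>)"
      unfolding ln_R[symmetric] by (simp add: algebra_simps)
  next
    show "continuous_on UNIV (\<lambda>\<phi>. \<Sum>j<n. 2 * f j \<phi>)" by (intro continuous_intros cont_f) auto
  qed (intro continuous_intros continuous_on_trig_harmonic cont_R)
  also have "\<dots> = (ln A - 1) * circle_avg (trig_harmonic b N 1) + 1 / A * circle_avg (\<lambda>\<phi>. trig_harmonic b N 1 \<phi> * R \<phi>)"
  proof -
    have cts: "continuous_on UNIV (\<lambda>\<phi>. (ln A - 1) * trig_harmonic b N 1 \<phi>)"
      "continuous_on UNIV (\<lambda>\<phi>. 1 / A * (trig_harmonic b N 1 \<phi> * R \<phi>))"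
      by (intro continuous_intros continuous_on_trig_harmonic cont_R)+
    show ?thesis unfolding circle_avg_add[OF cts] circle_avg_mult_left ..
  qed
  also have "circle_avg (trig_harmonic b N 1) = 1"
    using circle_avg_trig_harmonic[OF N, of b] by (simp add: b_def)
  finally show ?thesis unfolding W_eq R_def by simp
qed

text \<open>
  Both sides are continuous under the contraction of all points by a factor \<open>s\<close>.  So the inequality
  extends to points on the circle, where the logarithm of the product is unbounded.
\<close>

lemma weighted_jensen:
  fixes \<sigma> \<theta> :: "nat \<Rightarrow> real" and c :: "nat \<Rightarrow> complex" and B :: real and N :: nat
  defines "W \<equiv> (\<lambda>\<phi>. 1 - trig_harmonic (\<lambda>k. of_nat k * c k) N 1 \<phi> / B)"
  assumes N: "N > 0" and B: "B > 0" and bound: "\<And>\<phi>. trig_harmonic (\<lambda>k. of_nat k * c k) N 1 \<phi> \<le> B"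
    and \<sigma>: "\<And>j. j < n \<Longrightarrow> 0 \<le> \<sigma> j \<and> \<sigma> j \<le> 1" and A: "A > 0"
  shows "(\<Sum>j<n. (trig_harmonic c N (\<sigma> j) (\<theta> j) - Re (c 0)) / B) \<le>
    ln A + circle_avg (\<lambda>\<phi>. W \<phi> * (\<Prod>j<n. (norm (cis \<phi> - of_real (\<sigma> j) * cis (\<theta> j)))\<^sup>2)) / A - 1"
proof -
  define D where "D = (\<lambda>s. (\<Sum>j<n. (trig_harmonic c N (s * \<sigma> j) (\<theta> j) - Re (c 0)) / B) -
    (ln A + circle_avg (\<lambda>\<phi>. W \<phi> * (\<Prod>j<n. (norm (cis \<phi> - of_real (s * \<sigma> j) * cis (\<theta> j)))\<^sup>2)) / A - 1))"
  have "continuous_on {0..1} D"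
  proof -
    have "continuous_on {0..1} (\<lambda>s. trig_harmonic c N (s * \<sigma> j) (\<theta> j))" for j
      unfolding trig_harmonic_def by (intro continuous_intros)
    moreover have "continuous_on {0..1} (\<lambda>s. circle_avg (\<lambda>\<phi>. W \<phi> * (\<Prod>j<n. (norm (cis \<phi> - of_real (s * \<sigma> j) * cis (\<theta> j)))\<^sup>2)))"
    proof -
      have cW: "continuous_on S (\<lambda>x. W (h x))" if "continuous_on S h" for S :: "(real \<times> real) set" and h
        using continuous_on_compose2[OF continuous_on_trig_harmonic[of UNIV] that] B
        unfolding W_def by (auto intro!: continuous_intros)
      have "continuous_on {0..1} (\<lambda>s. integral (cbox 0 (2*pi)) (\<lambda>\<phi>. W \<phi> * (\<Prod>j<n. (norm (cis \<phi> - of_real (s * \<sigma> j) * cis (\<theta> j)))\<^sup>2)))"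
        by (rule integral_continuous_on_param) (unfold case_prod_beta, intro continuous_intros cW)
      then show ?thesis unfolding circle_avg_def by (auto intro!: continuous_intros)
    qed
    ultimately show ?thesis using A B unfolding D_def by (intro continuous_intros) auto
  qed
  moreover have "D s \<le> 0" if s: "0 \<le> s" "s < 1" for s
  proof -
    have "0 \<le> s * \<sigma> j \<and> s * \<sigma> j < 1" if "j < n" for j
    proof -
      have "s * \<sigma> j \<le> s * 1" using s \<sigma>[OF that] by (intro mult_left_mono) auto
      then show ?thesis using s \<sigma>[OF that] by auto
    qed
    from weighted_jensen_interior[OF N B bound this A, where n = n and \<theta> = \<theta>] show ?thesis
      unfolding D_def W_def by simp
  qed
  moreover have "closure {0..<1::real} = {0..1}" by simp
  ultimately have "D 1 \<le> 0"
    using continuous_le_on_closure[of "{0..<1::real}" D 1 0] by auto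
  then show ?thesis unfolding D_def by simp
qed

section \<open>The discrepancy of the zeros of a polynomial\<close>

text \<open>
  The zeros are listed as a sequence so that sums, products and counts run over an index set.
\<close>

locale factored_polynomial =
  fixes p :: "complex poly" and a :: complex and z :: "nat \<Rightarrow> complex" and n :: nat
  assumes p_eq: "p = smult a (\<Prod>j<n. [:- z j, 1:])" and a_nz: "a \<noteq> 0"
    and z_nz: "\<And>j. j < n \<Longrightarrow> z j \<noteq> 0"
begin

definition energy :: real where "energy = (\<Sum>k\<le>n. (norm (coeff p k))\<^sup>2)"

text \<open>
  With the factor 2 inside the logarithm the height is positive and bounds averages over the
  circle of \<open>ln (|p| / sqrt |c\<^sub>0 c\<^sub>n|)\<close> against any density that is at most 2.
\<close>

definition height :: real where
  "height = ln (2 * energy / (norm (coeff p 0) * norm (coeff p n))) / 2"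

lemma degree_p: "degree p = n"
  unfolding p_eq using a_nz by (simp add: degree_prod_eq_sum_degree)

lemma coeff_p_n: "coeff p n = a"
proof -
  have "lead_coeff p = a" unfolding p_eq by (simp add: lead_coeff_prod)
  then show ?thesis by (simp add: degree_p)
qed

lemma norm_poly_p: "norm (poly p x) = norm a * (\<Prod>j<n. norm (x - z j))"
  unfolding p_eq by (simp add: poly_prod norm_mult prod_norm)

lemma norm_coeff_p_0: "norm (coeff p 0) = norm a * (\<Prod>j<n. norm (z j))"
  using norm_poly_p[of 0] by (simp add: poly_0_coeff_0)

lemma ends_pos: "norm (coeff p 0) * norm (coeff p n) > 0"
  using a_nz z_nz by (auto simp: norm_coeff_p_0 coeff_p_n intro!: mult_pos_pos prod_pos)

lemma circle_avg_norm_poly: "circle_avg (\<lambda>\<phi>. (norm (poly p (cis \<phi>)))\<^sup>2) = energy"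
proof -
  have "poly p (cis \<phi>) = (\<Sum>k<Suc n. coeff p k * cis (real k * \<phi>))" for \<phi>
    unfolding poly_altdef degree_p lessThan_Suc_atMost by (simp add: Complex.DeMoivre)
  then show ?thesis
    using parseval_trig_poly[of "coeff p" "Suc n"] by (simp add: energy_def lessThan_Suc_atMost)
qed

lemma two_le_energy_quotient:
  assumes "n > 0"
  shows "2 \<le> energy / (norm (coeff p 0) * norm (coeff p n))"
proof -
  have "(norm (coeff p 0))\<^sup>2 + (norm (coeff p n))\<^sup>2 = (\<Sum>k\<in>{0,n}. (norm (coeff p k))\<^sup>2)"
    using assms by simp
  also have "\<dots> \<le> energy" unfolding energy_def by (intro sum_mono2) auto
  finally have "2 * (norm (coeff p 0) * norm (coeff p n)) \<le> energy"
    using sum_squares_bound[of "norm (coeff p 0)" "norm (coeff p n)"] by simp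
  then show ?thesis using ends_pos by (simp add: pos_le_divide_eq)
qed

lemma height_pos: "n > 0 \<Longrightarrow> height > 0"
  using two_le_energy_quotient unfolding height_def by (auto intro!: ln_gt_zero)

text \<open>
  With \<open>u\<close> of modulus 1, \<open>|e\<^bsup>i\<phi>\<^esup> - \<rho> u|\<^sup>2 / \<rho> = \<rho> + 1 / \<rho> - 2 cos (\<dots>)\<close> depends on \<open>\<rho>\<close> through \<open>\<rho> + 1 / \<rho>\<close>,
  which is smallest at \<open>\<rho> = 1\<close>, and is at least \<open>r + 1 / r\<close> unless \<open>r < \<rho> < 1 / r\<close>.  Moving a zero outside
  this range to modulus \<open>r\<close> rather than 1 leaves the factor \<open>r\<close>.
\<close>

lemma contract_roots:
  assumes r: "0 < r" and Q: "Q \<subseteq> {j. j < n \<and> (norm (z j) \<le> r \<and> r \<le> 1 \<or> 1 / r \<le> norm (z j) \<and> r \<le> 1)}"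
  shows "(\<Prod>j<n. (norm (cis \<phi> - of_real (if j \<in> Q then r else 1) * cis (Arg2pi (z j))))\<^sup>2) \<le>
    r ^ card Q * ((norm (poly p (cis \<phi>)))\<^sup>2 / (norm (coeff p 0) * norm (coeff p n)))"
proof -
  have norm_sq: "(norm (cis \<phi> - of_real x * cis t))\<^sup>2 = 1 + x\<^sup>2 - 2 * x * cos (\<phi> - t)" for x t
  proof -
    have "(cos \<phi> - x * cos t)\<^sup>2 + (sin \<phi> - x * sin t)\<^sup>2 = 1 + x\<^sup>2 - 2 * x * (cos \<phi> * cos t + sin \<phi> * sin t)"
      using sin_cos_squared_add[of \<phi>] sin_cos_squared_add[of t] by algebra
    then show ?thesis unfolding cmod_power2 by (simp add: cos_diff)
  qed
  have z_polar: "z j = of_real (norm (z j)) * cis (Arg2pi (z j))" for j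
    using Arg2pi_eq[of "z j"] by (simp add: cis_conv_exp mult.commute)
  have factor: "(norm (cis \<phi> - of_real (if j \<in> Q then r else 1) * cis (Arg2pi (z j))))\<^sup>2 * norm (z j) \<le>
      (if j \<in> Q then r else 1) * (norm (cis \<phi> - z j))\<^sup>2" if "j < n" for j
  proof -
    define \<rho> where "\<rho> = norm (z j)"
    define C where "C = cos (\<phi> - Arg2pi (z j))"
    have \<rho>: "\<rho> > 0" using z_nz[OF that] by (simp add: \<rho>_def)
    have "(norm (cis \<phi> - z j))\<^sup>2 = 1 + \<rho>\<^sup>2 - 2 * \<rho> * C"
      using norm_sq[of "norm (z j)" "Arg2pi (z j)"] by (simp add: \<rho>_def C_def flip: z_polar)
    moreover have "(1 + 1\<^sup>2 - 2 * 1 * C) * \<rho> \<le> 1 * (1 + \<rho>\<^sup>2 - 2 * \<rho> * C)"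
      using zero_le_power2[of "\<rho> - 1"] by (simp add: power2_eq_square algebra_simps)
    moreover have "(1 + r\<^sup>2 - 2 * r * C) * \<rho> \<le> r * (1 + \<rho>\<^sup>2 - 2 * \<rho> * C)" if "j \<in> Q"
    proof -
      have "0 \<le> (r - \<rho>) * (1 - r * \<rho>)"
      proof -
        have "\<rho> \<le> r \<and> r \<le> 1 \<or> 1 / r \<le> \<rho> \<and> r \<le> 1" using Q that by (auto simp: \<rho>_def)
        then show ?thesis
        proof
          assume h: "\<rho> \<le> r \<and> r \<le> 1"
          then have "r * \<rho> \<le> 1 * 1" using r \<rho> by (intro mult_mono) auto
          then show ?thesis using h by (intro mult_nonneg_nonneg) auto
        next
          assume h: "1 / r \<le> \<rho> \<and> r \<le> 1"
          then have "1 \<le> r * \<rho>" using r by (simp add: field_simps)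
          moreover have "r \<le> 1 / r"
          proof -
            have "r * r \<le> 1 * 1" using h r by (intro mult_mono) auto
            then show ?thesis using r by (simp add: field_simps)
          qed
          ultimately show ?thesis using h by (intro mult_nonpos_nonpos) auto
        qed
      qed
      then show ?thesis by (simp add: power2_eq_square algebra_simps)
    qed
    ultimately show ?thesis
      using norm_sq[of r "Arg2pi (z j)"] norm_sq[of 1 "Arg2pi (z j)"] by (simp add: \<rho>_def C_def)
  qed
  have "(\<Prod>j<n. (norm (cis \<phi> - of_real (if j \<in> Q then r else 1) * cis (Arg2pi (z j))))\<^sup>2) * (\<Prod>j<n. norm (z j)) \<le>
      (\<Prod>j<n. if j \<in> Q then r else 1) * (\<Prod>j<n. (norm (cis \<phi> - z j))\<^sup>2)"
    unfolding prod.distrib[symmetric] using factor by (intro prod_mono) auto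
  also have "(\<Prod>j<n. if j \<in> Q then r else 1) = r ^ card Q"
  proof -
    have "{..<n} \<inter> Q = Q" using Q by auto
    then show ?thesis by (simp add: prod.If_cases)
  qed
  finally have "(\<Prod>j<n. (norm (cis \<phi> - of_real (if j \<in> Q then r else 1) * cis (Arg2pi (z j))))\<^sup>2) * (\<Prod>j<n. norm (z j)) \<le>
      r ^ card Q * (\<Prod>j<n. (norm (cis \<phi> - z j))\<^sup>2)" .
  moreover have "(\<Prod>j<n. norm (z j)) > 0" using z_nz by (intro prod_pos) auto
  ultimately have "(\<Prod>j<n. (norm (cis \<phi> - of_real (if j \<in> Q then r else 1) * cis (Arg2pi (z j))))\<^sup>2) \<le>
      r ^ card Q * (\<Prod>j<n. (norm (cis \<phi> - z j))\<^sup>2) / (\<Prod>j<n. norm (z j))"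
    by (simp add: pos_le_divide_eq)
  also have "\<dots> = r ^ card Q * ((norm (poly p (cis \<phi>)))\<^sup>2 / (norm (coeff p 0) * norm (coeff p n)))"
    using a_nz by (simp add: norm_poly_p norm_coeff_p_0 coeff_p_n power_mult_distrib prod_power_distrib power2_eq_square prod.distrib)
  finally show ?thesis .
qed

text \<open>
  The inequality for the weight 1 and the zeros moved by \<open>contract_roots\<close>.  The number \<open>A\<close> below bounds
  the average of the product, so the inequality reduces to \<open>0 \<le> ln A\<close>.
\<close>

lemma card_roots_off_annulus:
  assumes r: "0 < r" "r < 1" and n: "n > 0"
  shows "real (card {j. j < n \<and> (norm (z j) \<le> r \<or> 1 / r \<le> norm (z j))}) * ln (1 / r) \<le> 2 * height"
proof -
  define Q where "Q = {j. j < n \<and> (norm (z j) \<le> r \<or> 1 / r \<le> norm (z j))}"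
  define E where "E = norm (coeff p 0) * norm (coeff p n)"
  define A where "A = r ^ card Q * (energy / E)"
  have E: "E > 0" unfolding E_def by (rule ends_pos)
  have q: "energy / E \<ge> 2" unfolding E_def by (rule two_le_energy_quotient[OF n])
  have A: "A > 0" unfolding A_def using q r by (intro mult_pos_pos) auto
  let ?R = "\<lambda>\<phi>. \<Prod>j<n. (norm (cis \<phi> - of_real (if j \<in> Q then r else 1) * cis (Arg2pi (z j))))\<^sup>2"
  have "0 \<le> ln A + circle_avg ?R / A - 1"
    using weighted_jensen[where N = 1 and B = 1 and c = "\<lambda>_. 0" and n = n and A = A
      and \<sigma> = "\<lambda>j. if j \<in> Q then r else 1" and \<theta> = "\<lambda>j. Arg2pi (z j)"] A r
    by (simp add: trig_harmonic_def)
  moreover have "circle_avg ?R \<le> A"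
  proof -
    have "circle_avg ?R \<le> circle_avg (\<lambda>\<phi>. (r ^ card Q / E) * (norm (poly p (cis \<phi>)))\<^sup>2)"
    proof (rule circle_avg_mono)
      show "continuous_on UNIV ?R" by (intro continuous_intros)
      show "?R \<phi> \<le> (r ^ card Q / E) * (norm (poly p (cis \<phi>)))\<^sup>2" for \<phi>
        using contract_roots[of r Q \<phi>] r by (auto simp: Q_def E_def)
    qed (intro continuous_intros)
    then show ?thesis unfolding circle_avg_mult_left circle_avg_norm_poly A_def by simp
  qed
  then have "circle_avg ?R / A \<le> 1" using A by simp
  ultimately have "0 \<le> ln A" by linarith
  also have "ln A = - (real (card Q) * ln (1 / r)) + ln (energy / E)"
    unfolding A_def using r q by (subst ln_mult) (auto simp: ln_realpow ln_div)
  also have "ln (energy / E) \<le> ln (2 * energy / E)"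
  proof -
    have "2 * energy / E = 2 * (energy / E)" by simp
    then show ?thesis using q by (subst ln_le_cancel_iff) auto
  qed
  finally show ?thesis by (simp add: Q_def height_def E_def)
qed

text \<open>
  The weight \<open>1 - G / B\<close> is at most 2, so the weighted average of \<open>|p|\<^sup>2\<close> is at most twice the energy.
  This is the reason for the factor 2 in the height.
\<close>

lemma trig_sum_at_roots_le:
  assumes n: "n > 0" and N: "N > 0" and B: "B > 0"
    and bound: "\<And>\<phi>. \<bar>trig_harmonic (\<lambda>k. of_nat k * c k) N 1 \<phi>\<bar> \<le> B"
  shows "(\<Sum>j<n. trig_harmonic c N 1 (Arg2pi (z j)) - Re (c 0)) \<le> 2 * B * height"
proof -
  define E where "E = norm (coeff p 0) * norm (coeff p n)"
  define A where "A = 2 * (energy / E)"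
  have E: "E > 0" unfolding E_def by (rule ends_pos)
  have A: "A > 0" unfolding A_def E_def using two_le_energy_quotient[OF n] by simp
  let ?W = "\<lambda>\<phi>. 1 - trig_harmonic (\<lambda>k. of_nat k * c k) N 1 \<phi> / B"
  let ?R = "\<lambda>\<phi>. \<Prod>j<n. (norm (cis \<phi> - of_real 1 * cis (Arg2pi (z j))))\<^sup>2"
  have "(\<Sum>j<n. (trig_harmonic c N 1 (Arg2pi (z j)) - Re (c 0)) / B) \<le> ln A + circle_avg (\<lambda>\<phi>. ?W \<phi> * ?R \<phi>) / A - 1"
    by (rule weighted_jensen[where \<sigma> = "\<lambda>_. 1" and \<theta> = "\<lambda>j. Arg2pi (z j)"])
       (use N B A bound in \<open>auto simp: abs_le_iff\<close>)
  moreover have "circle_avg (\<lambda>\<phi>. ?W \<phi> * ?R \<phi>) \<le> A"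
  proof -
    have "circle_avg (\<lambda>\<phi>. ?W \<phi> * ?R \<phi>) \<le> circle_avg (\<lambda>\<phi>. (2 / E) * (norm (poly p (cis \<phi>)))\<^sup>2)"
    proof (rule circle_avg_mono)
      show "continuous_on UNIV (\<lambda>\<phi>. ?W \<phi> * ?R \<phi>)"
        using B by (intro continuous_intros continuous_on_trig_harmonic) auto
      show "?W \<phi> * ?R \<phi> \<le> (2 / E) * (norm (poly p (cis \<phi>)))\<^sup>2" for \<phi>
      proof -
        have "- 1 \<le> trig_harmonic (\<lambda>k. of_nat k * c k) N 1 \<phi> / B"
          using bound[of \<phi>] B by (simp add: field_simps abs_le_iff)
        moreover have "?R \<phi> \<le> (norm (poly p (cis \<phi>)))\<^sup>2 / E"
          using contract_roots[of 1 "{}" \<phi>] by (simp add: E_def)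
        ultimately have "?W \<phi> * ?R \<phi> \<le> 2 * ((norm (poly p (cis \<phi>)))\<^sup>2 / E)"
          by (intro mult_mono prod_nonneg) auto
        then show ?thesis by simp
      qed
    qed (intro continuous_intros)
    then show ?thesis unfolding circle_avg_mult_left circle_avg_norm_poly A_def by simp
  qed
  then have "circle_avg (\<lambda>\<phi>. ?W \<phi> * ?R \<phi>) / A \<le> 1" using A by simp
  ultimately have "(\<Sum>j<n. (trig_harmonic c N 1 (Arg2pi (z j)) - Re (c 0)) / B) \<le> ln A"
    by linarith
  also have "ln A = 2 * height" by (simp add: height_def A_def E_def)
  finally have "(\<Sum>j<n. trig_harmonic c N 1 (Arg2pi (z j)) - Re (c 0)) / B \<le> 2 * height"
    by (simp add: sum_divide_distrib)
  then show ?thesis using B by (simp add: pos_divide_le_eq mult_ac)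
qed

text \<open>
  The trigonometric polynomial that approximately dominates the indicator of the arc has mean at most
  \<open>(l + d) / \<pi>\<close> up to an error that vanishes in the limit of its degree.
\<close>

lemma card_args_in_arc_le:
  assumes n: "n > 0" and l: "l \<ge> 0"
  shows "real (card {j. j < n \<and> circle_dist (Arg2pi (z j) - \<gamma>) \<le> l}) \<le>
    real n * l / pi + 4 * sqrt (real n * height / pi)"
proof -
  define q where "q = sqrt (real n * height / pi)"
  \<comment> \<open>this makes the two error terms \<open>n d / \<pi>\<close> and \<open>4 h / d\<close> equal\<close>
  define d where "d = 2 * pi * q / real n"
  define J where "J = {j. j < n \<and> circle_dist (Arg2pi (z j) - \<gamma>) \<le> l}"
  have q: "q > 0" unfolding q_def using n height_pos by simp
  have q2: "q\<^sup>2 = real n * height / pi" unfolding q_def using n height_pos by simp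
  have d: "d > 0" unfolding d_def using q n by simp
  have nd: "real n * d / pi = 2 * q" unfolding d_def using n by simp
  have hd: "4 * height / d = 2 * q"
  proof -
    have "2 * q * d = 4 * height" using q2 n by (simp add: d_def power2_eq_square field_simps)
    then show ?thesis using d by (simp add: field_simps)
  qed
  have finJ: "finite J" by (simp add: J_def)
  have J_n: "card J \<le> n" using card_mono[of "{..<n}" J] by (auto simp: J_def)
  show ?thesis
  proof (cases "d \<le> pi")
    case False
    then have "real n * pi \<le> real n * d" by (intro mult_left_mono) auto
    then have "real n \<le> real n * d / pi" by (simp add: field_simps)
    moreover have "0 \<le> real n * l / pi" using l by simp
    ultimately show ?thesis using J_n nd q unfolding J_def[symmetric] q_def[symmetric] by linarith
  next
    case True
    obtain f :: "real \<Rightarrow> real" where f: "continuous_on UNIV f" "\<And>x. f (x + 2 * pi) = f x"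
      "\<And>x. 0 \<le> f x" "\<And>x. f x \<le> 1"
      "\<And>x t. \<bar>2 * f x - f (x + t) - f (x - t)\<bar> \<le> 2 / d\<^sup>2 * t\<^sup>2"
      "\<And>x. circle_dist x \<le> l \<Longrightarrow> f x = 1" "circle_avg f \<le> (l + d) / pi"
      using smooth_arc_majorant[OF d l] by blast
    have main: "real (card J) \<le> real n * (l + d) / pi + 4 * height / d + real n * (8 / d\<^sup>2) * (1 / real (Suc m))" for m
    proof -
      let ?N = "Suc m"
      define e where "e = 4 * (2 / d\<^sup>2) / real ?N"
      have avg: "circle_avg (\<lambda>x. f (x - \<gamma>)) = circle_avg f"
        using circle_avg_shift[OF f(1,2), of "- \<gamma>"] by simp
      obtain c where c: "c 0 = of_real (circle_avg f)"
        "\<And>x. 0 \<le> trig_harmonic c ?N 1 x" "\<And>x. trig_harmonic c ?N 1 x \<le> 1"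
        "\<And>x t. \<bar>2 * trig_harmonic c ?N 1 x - trig_harmonic c ?N 1 (x + t) - trig_harmonic c ?N 1 (x - t)\<bar> \<le> 2 / d\<^sup>2 * t\<^sup>2"
        "\<And>x. \<bar>trig_harmonic c ?N 1 x - f (x - \<gamma>)\<bar> \<le> e"
      proof (rule fejer_smoothing[of "\<lambda>x. f (x - \<gamma>)" "2 / d\<^sup>2" ?N])
        show "continuous_on UNIV (\<lambda>x. f (x - \<gamma>))"
          by (rule continuous_on_compose2[OF f(1)]) (auto intro!: continuous_intros)
        show "f (x + 2 * pi - \<gamma>) = f (x - \<gamma>)" for x using f(2)[of "x - \<gamma>"] by (simp add: algebra_simps)
        show "\<bar>2 * f (x - \<gamma>) - f (x + t - \<gamma>) - f (x - t - \<gamma>)\<bar> \<le> 2 / d\<^sup>2 * t\<^sup>2" for x t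
          using f(5)[of "x - \<gamma>" t] by (simp add: algebra_simps)
      qed (use f(3,4) avg e_def in auto)
      have "\<bar>trig_harmonic (\<lambda>k. of_nat k * c k) ?N 1 \<phi>\<bar> \<le> 2 / d" for \<phi>
        using c(2-4) d True by (intro conjugate_derivative_bound) auto
      from trig_sum_at_roots_le[OF n _ _ this] have
        "(\<Sum>j<n. trig_harmonic c ?N 1 (Arg2pi (z j)) - Re (c 0)) \<le> 2 * (2 / d) * height"
        using d by simp
      then have sum_le: "(\<Sum>j<n. trig_harmonic c ?N 1 (Arg2pi (z j))) \<le> real n * circle_avg f + 4 * height / d"
        by (simp add: sum_subtractf c(1))
      have e: "e \<ge> 0" unfolding e_def by simp
      have "real (card J) = (\<Sum>j<n. if j \<in> J then 1 else 0)"
      proof -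
        have "{..<n} \<inter> J = J" by (auto simp: J_def)
        then show ?thesis by (simp add: sum.If_cases)
      qed
      then have "real (card J) - real n * e = (\<Sum>j<n. if j \<in> J then 1 else 0) + (\<Sum>j<n. - e)"
        by simp
      also have "(\<Sum>j<n. if j \<in> J then 1 else 0) + (\<Sum>j<n. - e) = (\<Sum>j<n. (if j \<in> J then 1 else 0) - e)"
        unfolding sum.distrib[symmetric] by simp
      also have "\<dots> \<le> (\<Sum>j<n. trig_harmonic c ?N 1 (Arg2pi (z j)))"
      proof (rule sum_mono)
        fix j
        show "(if j \<in> J then 1 else 0) - e \<le> trig_harmonic c ?N 1 (Arg2pi (z j))"
          using c(2,5)[of "Arg2pi (z j)"] e f(6)[of "Arg2pi (z j) - \<gamma>"] by (auto simp: J_def abs_le_iff)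
      qed
      also have "real n * circle_avg f \<le> real n * ((l + d) / pi)"
        using f(7) by (intro mult_left_mono) auto
      with sum_le have "(\<Sum>j<n. trig_harmonic c ?N 1 (Arg2pi (z j))) \<le> real n * ((l + d) / pi) + 4 * height / d"
        by linarith
      finally show ?thesis by (simp add: e_def)
    qed
    have "(\<lambda>m. real n * (l + d) / pi + 4 * height / d + real n * (8 / d\<^sup>2) * (1 / real (Suc m)))
        \<longlonglongrightarrow> real n * (l + d) / pi + 4 * height / d + real n * (8 / d\<^sup>2) * 0"
      using LIMSEQ_inverse_real_of_nat by (intro tendsto_intros) (simp add: inverse_eq_divide)
    then have "real (card J) \<le> real n * (l + d) / pi + 4 * height / d"
      using main by (intro LIMSEQ_le_const) auto
    also have "real n * (l + d) / pi = real n * l / pi + real n * d / pi" by (simp add: field_simps)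
    finally show ?thesis unfolding nd hd J_def[symmetric] q_def[symmetric] by simp
  qed
qed

text \<open>
  The zeros with argument in \<open>[\<alpha>, \<beta>)\<close> are bounded above by the arc estimate, and below by the arc
  estimate for the complementary arc.  Intersecting with the annulus loses at most the zeros outside.
  The latter contribute \<open>2 / (1 - r)\<close> times \<open>h / n\<close>, which is at most \<open>sqrt (h / n)\<close> unless \<open>h > n\<close>, when
  the claimed bound exceeds 1.
\<close>

theorem annular_sector_discrepancy:
  assumes n: "n > 0" and r: "0 < r" "r < 1" and ab: "0 \<le> \<alpha>" "\<alpha> < \<beta>" "\<beta> < 2 * pi"
  shows "\<bar>real (card {j. j < n \<and> z j \<in> annular_sector r \<alpha> \<beta>}) / real n - (\<beta> - \<alpha>) / (2 * pi)\<bar> \<le>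
    (4 / sqrt pi + 2 / (1 - r)) * sqrt (height / real n)"
proof -
  define X where "X = {j. j < n \<and> z j \<in> annular_sector r \<alpha> \<beta>}"
  define Y where "Y = {j. j < n \<and> \<alpha> \<le> Arg2pi (z j) \<and> Arg2pi (z j) < \<beta>}"
  define Z where "Z = {j. j < n \<and> (norm (z j) \<le> r \<or> 1 / r \<le> norm (z j))}"
  define \<gamma> where "\<gamma> = (\<alpha> + \<beta>) / 2"
  define l where "l = (\<beta> - \<alpha>) / 2"
  define y where "y = height / real n"
  have y: "y > 0" unfolding y_def using height_pos[OF n] n by simp
  have fin: "finite X" "finite Y" "finite Z" by (auto simp: X_def Y_def Z_def)
  have l: "0 \<le> l" "l \<le> pi" using ab by (auto simp: l_def)
  have X_le: "card X \<le> card Y" using fin by (intro card_mono) (auto simp: X_def Y_def annular_sector_def)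
  have Y_le: "card Y \<le> card X + card Z"
  proof -
    have "Y \<subseteq> X \<union> Z" by (auto simp: X_def Y_def Z_def annular_sector_def)
    then have "card Y \<le> card (X \<union> Z)" using fin by (intro card_mono) auto
    also have "\<dots> \<le> card X + card Z" by (rule card_Un_le)
    finally show ?thesis .
  qed
  have X_n: "card X \<le> n" using card_mono[of "{..<n}" X] by (auto simp: X_def)
  have frac: "0 \<le> (\<beta> - \<alpha>) / (2 * pi)" "(\<beta> - \<alpha>) / (2 * pi) \<le> 1" using ab by (auto simp: field_simps)
  have r2: "2 / (1 - r) \<ge> 2" using r by (simp add: field_simps)
  have sq: "sqrt (real n * height / pi) / real n = sqrt y / sqrt pi"
  proof -
    have "real n * height / pi = (real n)\<^sup>2 * (y / pi)" using n by (simp add: y_def power2_eq_square)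
    then show ?thesis using n by (simp add: real_sqrt_mult real_sqrt_divide)
  qed
  show ?thesis
  proof (cases "y \<le> 1")
    case False
    have "\<bar>real (card X) / real n - (\<beta> - \<alpha>) / (2 * pi)\<bar> \<le> 1"
    proof -
      have "0 \<le> real (card X) / real n" "real (card X) / real n \<le> 1" using X_n n by auto
      then show ?thesis using frac by linarith
    qed
    also have "1 \<le> (4 / sqrt pi + 2 / (1 - r)) * 1" using r2 by (simp add: add_nonneg_nonneg) (smt (verit) divide_nonneg_nonneg real_sqrt_ge_0_iff pi_ge_zero)
    also have "\<dots> \<le> (4 / sqrt pi + 2 / (1 - r)) * sqrt y"
      using False r by (intro mult_left_mono) auto
    finally show ?thesis by (simp add: X_def y_def)
  next
    case True
    have "card Y \<le> card {j. j < n \<and> circle_dist (Arg2pi (z j) - \<gamma>) \<le> l}"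
    proof (intro card_mono subsetI)
      fix j assume "j \<in> Y"
      then have "\<bar>Arg2pi (z j) - \<gamma>\<bar> \<le> l" by (auto simp: Y_def \<gamma>_def l_def abs_le_iff field_simps)
      then show "j \<in> {j. j < n \<and> circle_dist (Arg2pi (z j) - \<gamma>) \<le> l}"
        using circle_dist_le_abs[of "Arg2pi (z j) - \<gamma>"] \<open>j \<in> Y\<close> by (auto simp: Y_def)
    qed auto
    with card_args_in_arc_le[OF n l(1), of \<gamma>]
    have up: "real (card Y) \<le> real n * l / pi + 4 * sqrt (real n * height / pi)" by linarith
    \<comment> \<open>the points outside the half-open arc lie in the closed complementary arc, centred at \<open>\<gamma> + \<pi>\<close>\<close>
    have "n - card Y \<le> card {j. j < n \<and> circle_dist (Arg2pi (z j) - (\<gamma> + pi)) \<le> pi - l}"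
    proof -
      have "n - card Y = card ({..<n} - Y)" using fin by (subst card_Diff_subset) (auto simp: Y_def)
      also have "\<dots> \<le> card {j. j < n \<and> circle_dist (Arg2pi (z j) - (\<gamma> + pi)) \<le> pi - l}"
      proof (intro card_mono subsetI)
        fix j assume j: "j \<in> {..<n} - Y"
        have "0 \<le> Arg2pi (z j)" "Arg2pi (z j) < 2 * pi" by (auto simp: Arg2pi Arg2pi_lt_2pi)
        moreover have "Arg2pi (z j) < \<alpha> \<or> \<beta> \<le> Arg2pi (z j)" using j by (auto simp: Y_def)
        ultimately have "\<bar>Arg2pi (z j) - (\<gamma> + pi)\<bar> \<le> pi - l \<or> \<bar>Arg2pi (z j) - (\<gamma> + pi) + 2 * pi\<bar> \<le> pi - l"
          using ab by (auto simp: \<gamma>_def l_def abs_le_iff field_simps)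
        then have "circle_dist (Arg2pi (z j) - (\<gamma> + pi)) \<le> pi - l"
        proof
          assume "\<bar>Arg2pi (z j) - (\<gamma> + pi) + 2 * pi\<bar> \<le> pi - l"
          moreover have "circle_dist (Arg2pi (z j) - (\<gamma> + pi) + 2 * pi) = circle_dist (Arg2pi (z j) - (\<gamma> + pi))"
            unfolding circle_dist_def cos_periodic ..
          ultimately show ?thesis using circle_dist_le_abs[of "Arg2pi (z j) - (\<gamma> + pi) + 2 * pi"]
            by linarith
        qed (use circle_dist_le_abs[of "Arg2pi (z j) - (\<gamma> + pi)"] in linarith)
        then show "j \<in> {j. j < n \<and> circle_dist (Arg2pi (z j) - (\<gamma> + pi)) \<le> pi - l}" using j by auto
      qed auto
      finally show ?thesis .
    qed
    with card_args_in_arc_le[OF n, of "pi - l" "\<gamma> + pi"] l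
    have "real n - real (card Y) \<le> real n * (pi - l) / pi + 4 * sqrt (real n * height / pi)" by linarith
    moreover have eq: "real n * (pi - l) / pi = real n - real n * l / pi" by (simp add: field_simps)
    ultimately have "real n - real (card Y) \<le> real n - real n * l / pi + 4 * sqrt (real n * height / pi)"
      unfolding eq by simp
    then have low: "real n * l / pi - 4 * sqrt (real n * height / pi) \<le> real (card Y)" by linarith
    have Z: "real (card Z) \<le> 2 * height / (1 - r)"
    proof -
      have "1 - r \<le> ln (1 / r)" using ln_le_minus_one[of r] r by (simp add: ln_div)
      then have "real (card Z) * (1 - r) \<le> real (card Z) * ln (1 / r)" by (intro mult_left_mono) auto
      also have "\<dots> \<le> 2 * height" unfolding Z_def by (rule card_roots_off_annulus[OF r n])
      finally show ?thesis using r by (simp add: pos_le_divide_eq)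
    qed
    have "\<bar>real (card X) - real n * l / pi\<bar> \<le> 4 * sqrt (real n * height / pi) + 2 * height / (1 - r)"
    proof -
      have "0 \<le> 2 * height / (1 - r)" using height_pos[OF n] r by simp
      then show ?thesis using up low Z X_le Y_le by linarith
    qed
    then have "\<bar>real (card X) - real n * l / pi\<bar> / real n \<le> (4 * sqrt (real n * height / pi) + 2 * height / (1 - r)) / real n"
      by (intro divide_right_mono) auto
    also have "\<dots> = 4 / sqrt pi * sqrt y + 2 / (1 - r) * y"
      using sq by (simp add: add_divide_distrib y_def)
    also have "y \<le> sqrt y"
    proof -
      have "sqrt y * sqrt y \<le> sqrt y * 1" using True y by (intro mult_left_mono) auto
      then show ?thesis using y by simp
    qed
    then have "4 / sqrt pi * sqrt y + 2 / (1 - r) * y \<le> 4 / sqrt pi * sqrt y + 2 / (1 - r) * sqrt y"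
      using r by (intro add_left_mono mult_left_mono) auto
    also have "\<bar>real (card X) - real n * l / pi\<bar> / real n = \<bar>real (card X) / real n - (\<beta> - \<alpha>) / (2 * pi)\<bar>"
    proof -
      have "\<bar>real (card X) - real n * l / pi\<bar> / real n = \<bar>(real (card X) - real n * l / pi) / real n\<bar>" by simp
      also have "(real (card X) - real n * l / pi) / real n = real (card X) / real n - (\<beta> - \<alpha>) / (2 * pi)"
        using n by (simp add: l_def diff_divide_distrib)
      finally show ?thesis .
    qed
    finally show ?thesis by (simp add: X_def y_def distrib_right)
  qed
qed

end

lemma factored_polynomial_exists:
  fixes p :: "complex poly"
  assumes "coeff p 0 \<noteq> 0"
  obtains z where "factored_polynomial p (lead_coeff p) z (degree p)"
    "proots p = image_mset z (mset_set {..<degree p})"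
proof -
  have p: "p \<noteq> 0" using assms by auto
  obtain xs where xs: "mset xs = proots p" using ex_mset by blast
  have len: "length xs = degree p" using size_proots_complex[of p] by (simp flip: xs)
  have roots: "proots p = image_mset (\<lambda>j. xs ! j) (mset_set {..<degree p})"
    by (metis atLeast0LessThan len map_nth mset_map mset_upt xs)
  show thesis
  proof (rule that[of "\<lambda>j. xs ! j"])
    show "factored_polynomial p (lead_coeff p) ((!) xs) (degree p)"
    proof
      show "p = smult (lead_coeff p) (\<Prod>j<degree p. [:- xs ! j, 1:])"
        using complex_poly_decompose_multiset[of p] by (simp add: roots prod_unfold_prod_mset image_mset.compositionality o_def)
      show "lead_coeff p \<noteq> 0" using p by simp
      show "xs ! j \<noteq> 0" if "j < degree p" for j
      proof -
        have "xs ! j \<in># proots p" using that by (simp flip: xs add: len)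
        then have "poly p (xs ! j) = 0" using p by simp
        then show ?thesis using assms by (auto simp: poly_0_coeff_0)
      qed
    qed
  qed (rule roots)
qed

section \<open>Measurability of the number of zeros\<close>

lemma compact_product_set:
  fixes K :: "nat \<Rightarrow> complex set"
  assumes "\<And>i. compact (K i)"
  shows "compact {x. \<forall>i. x i \<in> K i}"
proof -
  have "compactin (product_topology (\<lambda>i. euclidean) UNIV) (Pi\<^sub>E UNIV K)"
    unfolding compactin_PiE using assms by auto
  moreover have "Pi\<^sub>E UNIV K = {x. \<forall>i. x i \<in> K i}" by auto
  ultimately show ?thesis by (simp add: euclidean_product_topology)
qed

text \<open>
  The first \<open>m\<close> entries of \<open>x\<close> are prescribed zeros, the next \<open>n - m + 1\<close> the coefficients of a cofactor;
  so every polynomial of degree at most \<open>n\<close> with those zeros arises from one vector.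
\<close>

definition root_product :: "nat \<Rightarrow> nat \<Rightarrow> (nat \<Rightarrow> complex) \<Rightarrow> complex poly" where
  "root_product m n x = (\<Prod>j<m. [:- x j, 1:]) * (\<Sum>j\<le>n - m. monom (x (m + j)) j)"

lemma continuous_on_coeff_root_product: "continuous_on UNIV (\<lambda>x. coeff (root_product m n x) k)"
proof -
  have coord: "continuous_on UNIV (\<lambda>x. x j)" for j :: nat
    by (rule continuous_on_product_coordinates)
  have "continuous_on UNIV (\<lambda>x :: nat \<Rightarrow> complex. coeff ((\<Prod>j<l. [:- x j, 1:]) * (\<Sum>j\<le>n - m. monom (x (m + j)) j)) k)" for l k
  proof (induction l arbitrary: k)
    case 0
    show ?case by (cases "k \<le> n - m") (simp_all add: coeff_sum)
  next
    case (Suc l)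
    let ?P = "\<lambda>x :: nat \<Rightarrow> complex. (\<Prod>j<l. [:- x j, 1:]) * (\<Sum>j\<le>n - m. monom (x (m + j)) j)"
    have "coeff ((\<Prod>j<Suc l. [:- x j, 1:]) * (\<Sum>j\<le>n - m. monom (x (m + j)) j)) k =
        (case k of 0 \<Rightarrow> 0 | Suc k' \<Rightarrow> coeff (?P x) k') - x l * coeff (?P x) k" for x
    proof -
      have "(\<Prod>j<Suc l. [:- x j, 1:]) * (\<Sum>j\<le>n - m. monom (x (m + j)) j) = [:- x l, 1:] * ?P x"
        by (simp only: prod.lessThan_Suc mult_ac)
      also have "\<dots> = pCons 0 (?P x) - smult (x l) (?P x)" by simp
      finally show ?thesis by (simp only: coeff_diff coeff_pCons coeff_smult)
    qed
    then show ?case using Suc.IH coord by (cases k) (auto intro!: continuous_intros)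
  qed
  then show ?thesis by (simp add: root_product_def)
qed

lemma coeff_random_poly: "coeff (random_poly C n \<omega>) k = (if k \<le> n then C k \<omega> else 0)"
  by (simp add: random_poly_def coeff_sum)

lemma proots_prod_linear: "proots (\<Prod>j<m. [:- x j, 1:]) = image_mset x (mset_set {..<m})"
  for x :: "nat \<Rightarrow> complex"
proof (induction m)
  case (Suc m)
  have "proots (\<Prod>j<Suc m. [:- x j, 1:]) = proots (\<Prod>j<m. [:- x j, 1:]) + proots [:- x m, 1:]"
    unfolding prod.lessThan_Suc by (intro proots_mult) auto
  then show ?case by (simp add: Suc.IH lessThan_Suc)
qed simp

text \<open>
  The compact sets increase, so one index \<open>i\<close> serves for all prescribed zeros and bounds all coefficients
  of the cofactor.
\<close>

lemma many_roots_iff_factor: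
  assumes mono: "\<And>i. A i \<subseteq> A (Suc i)" and p: "p \<noteq> 0" "degree p \<le> n" and m: "m \<le> n"
  shows "m \<le> size (filter_mset (\<lambda>z. z \<in> (\<Union>i. A i)) (proots p)) \<longleftrightarrow>
    (\<exists>i x. (\<forall>j. x j \<in> (if j < m then A i else if j \<le> n then cball 0 (real i) else {0})) \<and> p = root_product m n x)"
proof
  assume "\<exists>i x. (\<forall>j. x j \<in> (if j < m then A i else if j \<le> n then cball 0 (real i) else {0})) \<and> p = root_product m n x"
  then obtain i x where x: "\<And>j. x j \<in> (if j < m then A i else if j \<le> n then cball 0 (real i) else {0})"
    and p_eq: "p = root_product m n x" by blast
  let ?q = "\<Sum>j\<le>n - m. monom (x (m + j)) j"
  have "proots p = image_mset x (mset_set {..<m}) + proots ?q"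
    using p unfolding p_eq root_product_def by (subst proots_mult) (auto simp: proots_prod_linear)
  moreover have "filter_mset (\<lambda>z. z \<in> (\<Union>i. A i)) (image_mset x (mset_set {..<m})) = image_mset x (mset_set {..<m})"
  proof -
    have "x j \<in> A i" if "j < m" for j using x[of j] that by simp
    then show ?thesis by (intro filter_mset_eq_conv[THEN iffD2]) auto
  qed
  ultimately show "m \<le> size (filter_mset (\<lambda>z. z \<in> (\<Union>i. A i)) (proots p))" by simp
next
  assume size_ge: "m \<le> size (filter_mset (\<lambda>z. z \<in> (\<Union>i. A i)) (proots p))"
  obtain ys where ys: "mset ys = filter_mset (\<lambda>z. z \<in> (\<Union>i. A i)) (proots p)" using ex_mset by blast
  have len: "m \<le> length ys" using size_ge by (metis size_mset ys)
  \<comment> \<open>the zeros that are left for the cofactor, together with the leading coefficient\<close>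
  define R where "R = proots p - mset (take m ys)"
  have "mset (take m ys) \<subseteq># mset ys" by (metis append_take_drop_id mset_append mset_subset_eq_add_left)
  also have "\<dots> \<subseteq># proots p" by (simp add: ys)
  finally have proots: "proots p = mset (take m ys) + R" by (simp add: R_def)
  define q where "q = smult (lead_coeff p) (\<Prod>x\<in>#R. [:- x, 1:])"
  have "take m ys = map (\<lambda>j. ys ! j) [0..<m]"
    using len by (intro nth_equalityI) auto
  then have "mset (take m ys) = image_mset (\<lambda>j. ys ! j) (mset_set {..<m})"
    by (simp add: atLeast0LessThan)
  then have "(\<Prod>x\<in>#mset (take m ys). [:- x, 1:]) = (\<Prod>j<m. [:- ys ! j, 1:])"
    by (simp add: prod_unfold_prod_mset image_mset.compositionality o_def)
  then have p_eq: "p = (\<Prod>j<m. [:- ys ! j, 1:]) * q"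
    using complex_poly_decompose_multiset[of p] by (simp add: proots q_def mult_ac)
  have "degree p = m + degree q"
    using p p_eq by (subst p_eq, subst degree_mult_eq) (auto simp: degree_prod_eq_sum_degree)
  then have deg_q: "degree q \<le> n - m" using p by simp
  define x where "x = (\<lambda>j. if j < m then ys ! j else if j \<le> n then coeff q (j - m) else 0)"
  have "p = root_product m n x"
  proof -
    have "(\<Sum>j\<le>n - m. monom (x (m + j)) j) = (\<Sum>j\<le>n - m. monom (coeff q j) j)"
      using m by (intro sum.cong) (auto simp: x_def)
    also have "\<dots> = q" using deg_q by (intro poly_eqI) (auto simp: coeff_sum coeff_eq_0)
    finally show ?thesis unfolding root_product_def by (subst p_eq) (simp add: x_def)
  qed
  moreover have "\<exists>i. \<forall>j. x j \<in> (if j < m then A i else if j \<le> n then cball 0 (real i) else {0})"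
  proof -
    have mono': "A i \<subseteq> A j" if "i \<le> j" for i j using lift_Suc_mono_le[of A, OF mono that] .
    have "\<exists>i. ys ! j \<in> A i" if "j < m" for j
    proof -
      have "ys ! j \<in># mset ys" using that len by simp
      then show ?thesis unfolding ys by simp
    qed
    then obtain I where I: "\<And>j. j < m \<Longrightarrow> ys ! j \<in> A (I j)" by metis
    define b where "b = (\<lambda>j. nat \<lceil>norm (x j)\<rceil>)"
    have b: "norm (x j) \<le> real (b j)" for j unfolding b_def by (rule real_nat_ceiling_ge)
    define i where "i = (\<Sum>j\<le>n. b j) + (\<Sum>j<m. I j)"
    have "x j \<in> (if j < m then A i else if j \<le> n then cball 0 (real i) else {0})" for j
    proof -
      have "x j \<in> A i" if "j < m"
      proof -
        have "I j \<le> (\<Sum>j<m. I j)" using that by (intro member_le_sum) auto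
        then have "I j \<le> i" by (simp add: i_def)
        with mono' I[OF that] that show ?thesis by (auto simp: x_def)
      qed
      moreover have "norm (x j) \<le> real i" if "j \<le> n"
      proof -
        have "b j \<le> (\<Sum>j\<le>n. b j)" using that by (intro member_le_sum) auto
        then have "b j \<le> i" by (simp add: i_def)
        with b[of j] show ?thesis by linarith
      qed
      moreover have "x j = 0" if "\<not> j < m" "\<not> j \<le> n" using that by (simp add: x_def)
      ultimately show ?thesis by simp
    qed
    then show ?thesis by blast
  qed
  ultimately show "\<exists>i x. (\<forall>j. x j \<in> (if j < m then A i else if j \<le> n then cball 0 (real i) else {0})) \<and> p = root_product m n x"
    by blast
qed

lemma many_roots_measurable:
  assumes C: "\<And>k. C k \<in> borel_measurable M"
    and A: "\<And>i. compact (A i)" "\<And>i. A i \<subseteq> A (Suc i)" and m: "m \<le> n"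
  shows "{\<omega> \<in> space M. random_poly C n \<omega> \<noteq> 0 \<and>
      m \<le> size (filter_mset (\<lambda>z. z \<in> (\<Union>i. A i)) (proots (random_poly C n \<omega>)))} \<in> sets M"
proof -
  define K where "K = (\<lambda>i. {x. \<forall>j. x j \<in> (if j < m then A i else if j \<le> n then cball 0 (real i) else {0::complex})})"
  define \<Phi> where "\<Phi> = (\<lambda>x k. coeff (root_product m n x) k)"
  define V where "V = (\<lambda>\<omega> k. coeff (random_poly C n \<omega>) k)"
  have "compact (K i)" for i
    unfolding K_def using A(1) by (intro compact_product_set) auto
  moreover have "continuous_on UNIV \<Phi>"
    unfolding \<Phi>_def by (intro continuous_on_coordinatewise_then_product continuous_on_coeff_root_product)
  ultimately have "compact (\<Phi> ` K i)" for i
    using compact_continuous_image continuous_on_subset by blast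
  then have img: "(\<Union>i. \<Phi> ` K i) \<in> sets borel"
    by (intro sets.countable_UN) (auto intro: borel_compact)
  have V: "V \<in> measurable M borel"
  proof (rule measurable_coordinatewise_then_product)
    show "(\<lambda>\<omega>. V \<omega> k) \<in> borel_measurable M" for k
      using C by (cases "k \<le> n") (simp_all add: V_def coeff_random_poly)
  qed
  have "{\<omega> \<in> space M. random_poly C n \<omega> \<noteq> 0 \<and>
      m \<le> size (filter_mset (\<lambda>z. z \<in> (\<Union>i. A i)) (proots (random_poly C n \<omega>)))} =
     {\<omega> \<in> space M. \<exists>k\<in>{..n}. C k \<omega> \<noteq> 0} \<inter> (V -` (\<Union>i. \<Phi> ` K i) \<inter> space M)"
  proof -
    have nz: "random_poly C n \<omega> \<noteq> 0 \<longleftrightarrow> (\<exists>k\<in>{..n}. C k \<omega> \<noteq> 0)" for \<omega>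
      by (auto simp: poly_eq_iff coeff_random_poly)
    have deg: "degree (random_poly C n \<omega>) \<le> n" for \<omega>
      by (intro degree_le) (simp add: coeff_random_poly)
    have V_iff: "V \<omega> \<in> (\<Union>i. \<Phi> ` K i) \<longleftrightarrow> (\<exists>i x. x \<in> K i \<and> random_poly C n \<omega> = root_product m n x)" for \<omega>
      unfolding V_def \<Phi>_def by (auto simp: image_iff poly_eq_iff fun_eq_iff)
    have size_iff: "m \<le> size (filter_mset (\<lambda>z. z \<in> (\<Union>i. A i)) (proots (random_poly C n \<omega>))) \<longleftrightarrow>
        (\<exists>i x. x \<in> K i \<and> random_poly C n \<omega> = root_product m n x)" if "random_poly C n \<omega> \<noteq> 0" for \<omega>
      unfolding K_def mem_Collect_eq by (rule many_roots_iff_factor[where A = A, OF A(2) that deg m])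
    show ?thesis
    proof (rule set_eqI)
      fix \<omega>
      show "\<omega> \<in> {\<omega> \<in> space M. random_poly C n \<omega> \<noteq> 0 \<and>
          m \<le> size (filter_mset (\<lambda>z. z \<in> (\<Union>i. A i)) (proots (random_poly C n \<omega>)))} \<longleftrightarrow>
        \<omega> \<in> {\<omega> \<in> space M. \<exists>k\<in>{..n}. C k \<omega> \<noteq> 0} \<inter> (V -` (\<Union>i. \<Phi> ` K i) \<inter> space M)"
        unfolding mem_Collect_eq Int_iff vimage_eq V_iff nz[symmetric] using size_iff[of \<omega>] by blast
    qed
  qed
  moreover have "{\<omega> \<in> space M. \<exists>k\<in>{..n}. C k \<omega> \<noteq> 0} \<in> sets M" using C by measurable
  ultimately show ?thesis using measurable_sets[OF V img] by (simp add: sets.Int)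
qed

lemma zero_counting_eq_size: "zero_counting n p A = real (size (filter_mset (\<lambda>z. z \<in> A) (proots p))) / real n"
proof -
  have "(\<Sum>z\<in>#F. indicator A z :: real) = real (size (filter_mset (\<lambda>z. z \<in> A) F))" for F
    by (induction F) auto
  then show ?thesis by (simp add: zero_counting_def)
qed

text \<open>
  A number of zeros is the sum over \<open>m\<close> of the indicators of having at least \<open>m\<close> zeros.
\<close>

lemma zero_counting_measurable:
  assumes C: "\<And>k. C k \<in> borel_measurable M"
    and A: "\<And>i. compact (A i)" "\<And>i. A i \<subseteq> A (Suc i)"
  shows "(\<lambda>\<omega>. zero_counting n (random_poly C n \<omega>) (\<Union>i. A i)) \<in> borel_measurable M"
proof -
  define s where "s = (\<lambda>\<omega>. size (filter_mset (\<lambda>z. z \<in> (\<Union>i. A i)) (proots (random_poly C n \<omega>))))"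
  define E where "E = (\<lambda>m. {\<omega> \<in> space M. random_poly C n \<omega> \<noteq> 0 \<and> m \<le> s \<omega>})"
  have E: "E m \<in> sets M" if "m \<le> n" for m
    unfolding E_def s_def using that by (intro many_roots_measurable C A)
  have "real (s \<omega>) = (\<Sum>m\<in>{1..n}. indicator (E m) \<omega>)" if "\<omega> \<in> space M" for \<omega>
  proof (cases "random_poly C n \<omega> = 0")
    case True
    then show ?thesis by (simp add: s_def E_def)
  next
    case False
    have "s \<omega> \<le> size (proots (random_poly C n \<omega>))" unfolding s_def by (rule size_filter_mset_lesseq)
    also have "\<dots> \<le> n"
      using size_proots_le[of "random_poly C n \<omega>"] degree_le[of n "random_poly C n \<omega>"] by (simp add: coeff_random_poly)
    finally have "s \<omega> \<le> n" .
    then have "{1..n} \<inter> {m. m \<le> s \<omega>} = {1..s \<omega>}" by auto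
    then show ?thesis using that False by (simp add: E_def indicator_def sum.If_cases)
  qed
  moreover have "(\<lambda>\<omega>. \<Sum>m\<in>{1..n}. indicator (E m) \<omega> :: real) \<in> borel_measurable M"
    using E by (intro borel_measurable_sum borel_measurable_indicator) auto
  ultimately have "(\<lambda>\<omega>. real (s \<omega>)) \<in> borel_measurable M"
    using measurable_cong[of M "\<lambda>\<omega>. real (s \<omega>)"] by simp
  then show ?thesis
    unfolding zero_counting_eq_size s_def by (rule borel_measurable_divide) simp
qed

text \<open>
  In polar coordinates the sector is a product of intervals, exhausted by compact rectangles; this
  avoids the discontinuity of the argument on the positive real axis.
\<close>

lemma annular_sector_sigma_compact:
  assumes r: "0 < r" and ab: "0 \<le> \<alpha>" "\<beta> < 2 * pi"
  obtains A :: "nat \<Rightarrow> complex set" where "\<And>i. compact (A i)" "\<And>i. A i \<subseteq> A (Suc i)"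
    "annular_sector r \<alpha> \<beta> = (\<Union>i. A i)"
proof -
  define B where "B = (\<lambda>i::nat. {r + 1 / real (Suc i)..1 / r - 1 / real (Suc i)} \<times> {\<alpha>..\<beta> - 1 / real (Suc i)})"
  define A where "A = (\<lambda>i. (\<lambda>(\<rho>, \<theta>). of_real \<rho> * cis \<theta>) ` B i)"
  have step: "1 / real (Suc (Suc i)) \<le> 1 / real (Suc i)" for i by (intro divide_left_mono) auto
  show thesis
  proof (rule that[of A])
    show "compact (A i)" for i
      unfolding A_def B_def case_prod_beta
      by (intro compact_continuous_image compact_Times continuous_intros) auto
    show "A i \<subseteq> A (Suc i)" for i
      unfolding A_def B_def using step[of i] by (intro image_mono) (auto intro: order.trans)
    show "annular_sector r \<alpha> \<beta> = (\<Union>i. A i)"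
    proof (intro equalityI subsetI)
      fix z assume z: "z \<in> annular_sector r \<alpha> \<beta>"
      define e where "e = Min {norm z - r, 1 / r - norm z, \<beta> - Arg2pi z}"
      have "e > 0" using z by (simp add: e_def annular_sector_def)
      then obtain i where i: "1 / real (Suc i) < e" by (meson nat_approx_posE)
      have "e \<le> norm z - r" "e \<le> 1 / r - norm z" "e \<le> \<beta> - Arg2pi z" by (auto simp: e_def)
      then have "(norm z, Arg2pi z) \<in> B i"
        using i z by (auto simp: B_def annular_sector_def)
      moreover have "z = (\<lambda>(\<rho>, \<theta>). of_real \<rho> * cis \<theta>) (norm z, Arg2pi z)"
        using Arg2pi_eq[of z] by (simp add: cis_conv_exp mult.commute)
      ultimately show "z \<in> (\<Union>i. A i)" unfolding A_def by blast
    next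
      fix z assume "z \<in> (\<Union>i. A i)"
      then obtain i \<rho> \<theta> where h: "r + 1 / real (Suc i) \<le> \<rho>" "\<rho> \<le> 1 / r - 1 / real (Suc i)"
        "\<alpha> \<le> \<theta>" "\<theta> \<le> \<beta> - 1 / real (Suc i)" and z: "z = of_real \<rho> * cis \<theta>"
        by (auto simp: A_def B_def)
      have pos: "0 < 1 / real (Suc i)" by simp
      have \<rho>: "\<rho> > 0" using h(1) pos r by linarith
      have "\<theta> < 2 * pi" using h(4) pos ab by linarith
      then have "Arg2pi z = \<theta>"
        using h(3) ab \<rho> by (intro Arg2pi_unique[of \<rho>]) (auto simp: z cis_conv_exp mult.commute)
      moreover have "norm z = \<rho>" using \<rho> by (simp add: z norm_mult)
      moreover have "r < \<rho>" "\<rho> < 1 / r" "\<theta> < \<beta>" using h pos by linarith+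
      ultimately show "z \<in> annular_sector r \<alpha> \<beta>" using h(3) by (simp add: annular_sector_def)
    qed
  qed
qed

section \<open>The expected height\<close>

lemma catalan_constant_bounds: "0 < catalan_constant" "catalan_constant \<le> 1"
proof -
  define a where "a = (\<lambda>k. 1 / (2 * real k + 1) ^ 2)"
  have a_lim: "a \<longlonglongrightarrow> 0"
    unfolding a_def by real_asymp
  have a_nonneg: "a k \<ge> 0" for k by (simp add: a_def)
  have a_mono: "a (Suc k) \<le> a k" for k
    unfolding a_def by (intro divide_left_mono power_mono mult_pos_pos zero_less_power) auto
  have eq: "catalan_constant = (\<Sum>k. (-1) ^ k * a k)" by (simp add: catalan_constant_def a_def)
  note leibniz = summable_Leibniz'[OF a_lim a_nonneg a_mono]
  have "(\<Sum>k<2 * 1. (-1) ^ k * a k) \<le> catalan_constant"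
    unfolding eq by (rule leibniz(2))
  then show "0 < catalan_constant" by (simp add: a_def numeral_2_eq_2)
  have "catalan_constant \<le> (\<Sum>k<2 * 0 + 1. (-1) ^ k * a k)"
    unfolding eq by (rule leibniz(4))
  then show "catalan_constant \<le> 1" by (simp add: a_def)
qed

lemma four_div_sqrt_pi_le: "4 / sqrt pi \<le> sqrt (2 * pi / catalan_constant)"
proof -
  have "16 / pi \<le> 2 * pi"
  proof -
    have "2.9 * 2.9 \<le> pi * pi" using pi_approx by (intro mult_mono) auto
    then show ?thesis by (simp add: pos_divide_le_eq)
  qed
  also have "\<dots> \<le> 2 * pi / catalan_constant"
    using catalan_constant_bounds by (simp add: pos_le_divide_eq)
  finally have "sqrt (16 / pi) \<le> sqrt (2 * pi / catalan_constant)" by (rule real_sqrt_le_mono)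
  moreover have "sqrt (16 / pi) = 4 / sqrt pi" using real_sqrt_abs[of 4] by (simp add: real_sqrt_divide)
  ultimately show ?thesis by simp
qed

text \<open>
  For \<open>t \<le> 2\<close>, \<open>(\<Sum> x\<^sub>k\<^sup>2)\<^bsup>1/2\<^esup> \<le> (\<Sum> x\<^sub>k\<^sup>t)\<^bsup>1/t\<^esup>\<close>.  For \<open>t > 2\<close>, the inequality of power means costs
  \<open>(1/2 - 1/t) ln (n + 1)\<close>.  Both bounds are linearised, so that the right-hand side is linear in the
  powers \<open>x\<^sub>k\<^sup>t\<close>.  The point of tangency is such that the last two terms cancel in expectation, if \<open>\<mu>\<close> is the expectation of each \<open>x\<^sub>k\<^sup>t\<close>.
\<close>

lemma half_ln_sum_squares_le:
  fixes x :: "nat \<Rightarrow> real"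
  assumes t: "t > 0" and \<mu>: "\<mu> > 0" and x: "\<And>k. x k \<ge> 0" and S: "(\<Sum>k\<le>n. (x k)\<^sup>2) > 0"
  shows "ln (\<Sum>k\<le>n. (x k)\<^sup>2) / 2 \<le> (if t \<le> 2 then 1 / t else 1 / 2) * ln (real n + 1) + ln \<mu> / t - 1 / t
    + (\<Sum>k\<le>n. x k powr t) / (t * \<mu> * (real n + 1))"
proof -
  define Y where "Y = (\<Sum>k\<le>n. x k powr t)"
  define S where "S = (\<Sum>k\<le>n. (x k)\<^sup>2)"
  have S_pos: "S > 0" using S by (simp add: S_def)
  have ln_le: "ln u \<le> ln b + u / b - 1" if "u > 0" "b > 0" for u b :: real
    using ln_le_minus_one[of "u / b"] that by (simp add: ln_div)
  show ?thesis
  proof (cases "t \<le> 2")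
    case True
    have Y_ge: "x k powr t \<le> Y" if "k \<le> n" for k
      unfolding Y_def using that by (intro member_le_sum) auto
    have Y_pos: "Y > 0"
    proof (rule ccontr)
      assume "\<not> Y > 0"
      then have "x k = 0" if "k \<le> n" for k using Y_ge[OF that] x[of k] by (smt (verit) powr_gt_zero)
      then show False using S_pos by (simp add: S_def)
    qed
    have sq_le: "(x k)\<^sup>2 \<le> x k powr t * Y powr (2 / t - 1)" if "k \<le> n" for k
    proof (cases "x k = 0")
      case False
      then have xk: "x k > 0" using x[of k] by simp
      have "(x k)\<^sup>2 = x k powr t * (x k powr t) powr (2 / t - 1)"
        using xk t by (simp add: powr_powr right_diff_distrib flip: powr_add powr_numeral)
      also have "\<dots> \<le> x k powr t * Y powr (2 / t - 1)"
        using t True Y_ge[OF that] by (intro mult_left_mono powr_mono2) auto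
      finally show ?thesis .
    qed simp
    have "S \<le> (\<Sum>k\<le>n. x k powr t * Y powr (2 / t - 1))"
      unfolding S_def using sq_le by (intro sum_mono) auto
    also have "\<dots> = Y powr 1 * Y powr (2 / t - 1)" using Y_pos by (simp add: Y_def sum_distrib_right)
    also have "\<dots> = Y powr (2 / t)" by (subst powr_add[symmetric]) simp
    finally have "ln S \<le> 2 / t * ln Y" using S_pos Y_pos by (metis ln_mono ln_powr order_less_le)
    then have "ln S / 2 \<le> 1 / t * ln Y" by (simp add: mult.commute)
    also have "\<dots> \<le> 1 / t * (ln ((real n + 1) * \<mu>) + Y / ((real n + 1) * \<mu>) - 1)"
      using t Y_pos \<mu> by (intro mult_left_mono ln_le) auto
    also have "ln ((real n + 1) * \<mu>) = ln (real n + 1) + ln \<mu>" using \<mu> by (simp add: ln_mult)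
    finally show ?thesis using True t \<mu> by (simp add: S_def Y_def algebra_simps add_divide_distrib diff_divide_distrib)
  next
    case False
    define b where "b = (real n + 1) * \<mu> powr (2 / t)"
    have b: "b > 0" using \<mu> by (simp add: b_def)
    have sq_le: "(x k)\<^sup>2 / \<mu> powr (2 / t) \<le> 2 / t * (x k powr t / \<mu>) + (1 - 2 / t)" for k
    proof (cases "x k = 0")
      case False
      then have xk: "x k > 0" using x[of k] by simp
      have "(x k powr t / \<mu>) powr (2 / t) * 1 powr (1 - 2 / t) \<le> 2 / t * (x k powr t / \<mu>) + (1 - 2 / t) * 1"
        using t \<open>\<not> t \<le> 2\<close> xk \<mu> by (intro Youngs_inequality_0) auto
      moreover have "(x k powr t / \<mu>) powr (2 / t) = (x k)\<^sup>2 / \<mu> powr (2 / t)"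
        using t xk \<mu> by (simp add: powr_divide powr_powr)
      ultimately show ?thesis by simp
    qed (use False t in simp)
    have "S / b = (\<Sum>k\<le>n. (x k)\<^sup>2 / \<mu> powr (2 / t)) / (real n + 1)"
      by (simp add: S_def b_def sum_divide_distrib mult.commute)
    also have "\<dots> \<le> (\<Sum>k\<le>n. 2 / t * (x k powr t / \<mu>) + (1 - 2 / t)) / (real n + 1)"
      using sq_le by (intro divide_right_mono sum_mono) auto
    also have "(\<Sum>k\<le>n. 2 / t * (x k powr t / \<mu>) + (1 - 2 / t)) = 2 / t * (Y / \<mu>) + (real n + 1) * (1 - 2 / t)"
      by (simp add: sum.distrib Y_def sum_distrib_left sum_divide_distrib)
    also have "\<dots> / (real n + 1) = 2 * (Y / (t * \<mu> * (real n + 1))) + (1 - 2 / t)"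
      by (simp add: add_divide_distrib)
    finally have Sb: "S / b \<le> 2 * (Y / (t * \<mu> * (real n + 1))) + (1 - 2 / t)" .
    have "ln b = ln (real n + 1) + 2 / t * ln \<mu>" using \<mu> by (simp add: b_def ln_mult ln_powr)
    with ln_le[OF S_pos b] Sb
    have "ln S \<le> ln (real n + 1) + 2 / t * ln \<mu> + 2 * (Y / (t * \<mu> * (real n + 1))) - 2 / t" by linarith
    moreover have "2 / t * ln \<mu> = 2 * (ln \<mu> / t)" "2 / t = 2 * (1 / t)" by simp_all
    ultimately have "ln S / 2 \<le> 1 / 2 * ln (real n + 1) + ln \<mu> / t - 1 / t + Y / (t * \<mu> * (real n + 1))"
      by linarith
    then show ?thesis using False by (simp add: S_def Y_def)
  qed
qed

lemma zero_counting_discrepancy: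
  fixes p :: "complex poly"
  assumes deg: "degree p = n" "n > 0" and p0: "coeff p 0 \<noteq> 0"
    and r: "0 < r" "r < 1" and ab: "0 \<le> \<alpha>" "\<alpha> < \<beta>" "\<beta> < 2 * pi"
  defines "h \<equiv> ln (2 * (\<Sum>k\<le>n. (norm (coeff p k))\<^sup>2) / (norm (coeff p 0) * norm (coeff p n))) / 2"
  shows "\<bar>zero_counting n p (annular_sector r \<alpha> \<beta>) - (\<beta> - \<alpha>) / (2 * pi)\<bar> \<le> (4 / sqrt pi + 2 / (1 - r)) * sqrt (h / real n)"
    and "h > 0"
proof -
  obtain z where "factored_polynomial p (lead_coeff p) z n" and
    roots: "proots p = image_mset z (mset_set {..<n})"
    using factored_polynomial_exists[OF p0] deg by blast
  then interpret factored_polynomial p "lead_coeff p" z n by simp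
  have "zero_counting n p (annular_sector r \<alpha> \<beta>) =
      real (card {j. j < n \<and> z j \<in> annular_sector r \<alpha> \<beta>}) / real n"
    by (simp add: zero_counting_eq_size roots filter_mset_image_mset Collect_conj_eq lessThan_def)
  moreover have "height = h" by (simp add: height_def energy_def h_def)
  ultimately show "\<bar>zero_counting n p (annular_sector r \<alpha> \<beta>) - (\<beta> - \<alpha>) / (2 * pi)\<bar> \<le> (4 / sqrt pi + 2 / (1 - r)) * sqrt (h / real n)"
    and "h > 0"
    using annular_sector_discrepancy[OF deg(2) r ab] height_pos[OF deg(2)] by simp_all
qed

lemma identically_distributed_integral:
  fixes g :: "complex \<Rightarrow> real"
  assumes C: "C \<in> borel_measurable M" "C' \<in> borel_measurable M" and eq: "distr M borel C = distr M borel C'"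
    and g: "g \<in> borel_measurable borel" and int: "integrable M (\<lambda>\<omega>. g (C' \<omega>))"
  shows "integrable M (\<lambda>\<omega>. g (C \<omega>))" and "(\<integral>\<omega>. g (C \<omega>) \<partial>M) = (\<integral>\<omega>. g (C' \<omega>) \<partial>M)"
proof -
  show "integrable M (\<lambda>\<omega>. g (C \<omega>))"
    using integrable_distr_eq[OF C(1) g] integrable_distr_eq[OF C(2) g] int eq by simp
  show "(\<integral>\<omega>. g (C \<omega>) \<partial>M) = (\<integral>\<omega>. g (C' \<omega>) \<partial>M)"
    using integral_distr[OF C(1) g] integral_distr[OF C(2) g] eq by simp
qed

lemma AE_nonzero_if_distributed_lborel:
  fixes C :: "'a \<Rightarrow> complex"
  assumes d: "distributed M lborel C f" and C': "C' \<in> borel_measurable M" and eq: "distr M borel C' = distr M borel C"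
  shows "AE \<omega> in M. C' \<omega> \<noteq> 0"
proof -
  have C: "C \<in> borel_measurable M" using distributed_measurable[OF d] by simp
  have ae: "AE x in density lborel f. x \<noteq> 0"
    using AE_lborel_singleton[of 0] distributed_borel_measurable[OF d] by (subst AE_density) auto
  have law: "distr M borel C' = density lborel f"
    unfolding eq distributed_distr_eq_density[OF d, symmetric] by (intro distr_cong) auto
  have "AE x in distr M borel C'. x \<noteq> 0" unfolding law by (rule ae)
  then show ?thesis using C' by (simp add: AE_distr_iff)
qed

lemma sqrt_le_tangent:
  assumes "0 \<le> x" "0 < (b::real)"
  shows "sqrt x \<le> (x + b) / (2 * sqrt b)"
proof -
  have "sqrt x * sqrt b \<le> (x + b) / 2"
    using arith_geo_mean_sqrt[of x b] assms by (simp add: real_sqrt_mult)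
  then have "2 * (sqrt x * sqrt b) \<le> x + b" by simp
  then show ?thesis using assms by (simp add: pos_le_divide_eq mult.left_commute)
qed

text \<open>
  The variable \<open>H\<close> bounds the height and is a linear combination of \<open>|C\<^sub>k|\<^sup>t\<close>, \<open>ln |C\<^sub>0|\<close> and \<open>ln |C\<^sub>n|\<close>;
  its expectation is the left-hand side of the last hypothesis.  The square root is replaced by its
  tangent at \<open>T / n\<close>, which gives Jensen's inequality and the comparison with \<open>T\<close> in one step.
\<close>

lemma expected_discrepancy_le:
  fixes M :: "'a measure" and C :: "nat \<Rightarrow> 'a \<Rightarrow> complex"
  assumes M: "prob_space M" and C: "\<And>k. C k \<in> borel_measurable M"
    and eq: "\<And>k. distr M borel (C k) = distr M borel (C 0)"
    and nz: "\<And>k. AE \<omega> in M. C k \<omega> \<noteq> 0"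
    and t: "t > 0" and int_t: "integrable M (\<lambda>\<omega>. norm (C 0 \<omega>) powr t)"
    and int_ln: "integrable M (\<lambda>\<omega>. ln (norm (C 0 \<omega>)))"
    and r: "0 < r" "r < 1" and ab: "0 \<le> \<alpha>" "\<alpha> < \<beta>" "\<beta> < 2 * pi"
    and n: "n > 0" and int_Z: "integrable M (\<lambda>\<omega>. \<bar>zero_counting n (random_poly C n \<omega>) (annular_sector r \<alpha> \<beta>) - (\<beta> - \<alpha>) / (2 * pi)\<bar>)"
    and T: "ln 2 / 2 + (if t \<le> 2 then 1 / t else 1 / 2) * ln (real n + 1)
      + ln (\<integral>\<omega>. norm (C 0 \<omega>) powr t \<partial>M) / t - (\<integral>\<omega>. ln (norm (C 0 \<omega>)) \<partial>M) \<le> T"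
  shows "T > 0"
    and "(\<integral>\<omega>. \<bar>zero_counting n (random_poly C n \<omega>) (annular_sector r \<alpha> \<beta>) - (\<beta> - \<alpha>) / (2 * pi)\<bar> \<partial>M)
    \<le> (4 / sqrt pi + 2 / (1 - r)) * sqrt (T / real n)"
proof -
  interpret prob_space M by (rule M)
  define \<mu> where "\<mu> = (\<integral>\<omega>. norm (C 0 \<omega>) powr t \<partial>M)"
  define K where "K = 4 / sqrt pi + 2 / (1 - r)"
  have K: "K \<ge> 0" using r by (simp add: K_def)
  have int_t': "integrable M (\<lambda>\<omega>. norm (C k \<omega>) powr t)" "(\<integral>\<omega>. norm (C k \<omega>) powr t \<partial>M) = \<mu>" for k
    using identically_distributed_integral[OF C C eq _ int_t, of k] by (auto simp: \<mu>_def)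
  define \<Lambda> where "\<Lambda> = (\<integral>\<omega>. ln (norm (C 0 \<omega>)) \<partial>M)"
  have int_ln': "integrable M (\<lambda>\<omega>. ln (norm (C k \<omega>)))" "(\<integral>\<omega>. ln (norm (C k \<omega>)) \<partial>M) = \<Lambda>" for k
    using identically_distributed_integral[OF C C eq _ int_ln, of k] by (auto simp: \<Lambda>_def)
  have \<mu>: "\<mu> > 0"
  proof -
    have "\<mu> \<noteq> 0"
    proof
      assume "\<mu> = 0"
      then have "AE \<omega> in M. norm (C 0 \<omega>) powr t = 0"
        using integral_nonneg_eq_0_iff_AE[OF int_t] by (simp add: \<mu>_def)
      with nz[of 0] have "AE \<omega> in M. False" by eventually_elim simp
      then show False by simp
    qed
    moreover have "\<mu> \<ge> 0" unfolding \<mu>_def by (intro integral_nonneg_AE) auto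
    ultimately show ?thesis by simp
  qed
  define a where "a = ln 2 / 2 + (if t \<le> 2 then 1 / t else 1 / 2) * ln (real n + 1) + ln \<mu> / t - 1 / t"
  define H where "H = (\<lambda>\<omega>. a + (\<Sum>k\<le>n. norm (C k \<omega>) powr t) / (t * \<mu> * (real n + 1))
    - ln (norm (C 0 \<omega>)) / 2 - ln (norm (C n \<omega>)) / 2)"
  have int_H: "integrable M H" unfolding H_def
    by (intro Bochner_Integration.integrable_diff Bochner_Integration.integrable_add Bochner_Integration.integrable_sum
        integrable_divide int_t' int_ln' integrable_const)
  have E_H: "(\<integral>\<omega>. H \<omega> \<partial>M) \<le> T"
  proof -
    have "(\<integral>\<omega>. H \<omega> \<partial>M) = a + (\<Sum>k\<le>n. \<mu>) / (t * \<mu> * (real n + 1)) - \<Lambda> / 2 - \<Lambda> / 2"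
      unfolding H_def using int_t' int_ln' by (simp add: prob_space)
    also have "(\<Sum>k\<le>n. \<mu>) / (t * \<mu> * (real n + 1)) = 1 / t"
    proof -
      have "(\<Sum>k\<le>n. \<mu>) = \<mu> * (real n + 1)" "\<mu> * (real n + 1) \<noteq> 0" using \<mu> by simp_all
      then show ?thesis by (simp only: mult.assoc) simp
    qed
    finally show ?thesis using T by (simp add: a_def \<mu>_def \<Lambda>_def)
  qed
  have pt: "AE \<omega> in M. \<bar>zero_counting n (random_poly C n \<omega>) (annular_sector r \<alpha> \<beta>) - (\<beta> - \<alpha>) / (2 * pi)\<bar>
     \<le> K * sqrt (H \<omega> / real n) \<and> 0 < H \<omega>"
    using nz[of 0] nz[of n]
  proof eventually_elim
    case (elim \<omega>)
    let ?p = "random_poly C n \<omega>"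
    define h where "h = ln (2 * (\<Sum>k\<le>n. (norm (coeff ?p k))\<^sup>2) / (norm (coeff ?p 0) * norm (coeff ?p n))) / 2"
    have deg: "degree ?p = n"
      using elim by (intro antisym degree_le le_degree) (auto simp: coeff_random_poly)
    have p0: "coeff ?p 0 \<noteq> 0" using elim by (simp add: coeff_random_poly)
    note disc = zero_counting_discrepancy[OF deg n p0 r ab, folded h_def K_def]
    have S: "(\<Sum>k\<le>n. (norm (C k \<omega>))\<^sup>2) > 0"
      using elim by (intro sum_pos2[of _ 0]) auto
    have "h = (ln 2 + ln (\<Sum>k\<le>n. (norm (C k \<omega>))\<^sup>2) - (ln (norm (C 0 \<omega>)) + ln (norm (C n \<omega>)))) / 2"
      using S elim by (simp add: h_def coeff_random_poly ln_div ln_mult)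
    also have "\<dots> \<le> H \<omega>"
      using half_ln_sum_squares_le[OF t \<mu> _ S] by (simp add: H_def a_def)
    finally have "h \<le> H \<omega>" .
    then have "K * sqrt (h / real n) \<le> K * sqrt (H \<omega> / real n)"
      using K by (intro mult_left_mono real_sqrt_le_mono divide_right_mono) auto
    with disc \<open>h \<le> H \<omega>\<close> show ?case by linarith
  qed
  define b where "b = T / real n"
  have "(\<integral>\<omega>. 0 \<partial>M) < (\<integral>\<omega>. H \<omega> \<partial>M)"
  proof (rule integral_less_AE_space[OF _ int_H])
    show "AE \<omega> in M. 0 < H \<omega>" using pt by eventually_elim simp
  qed (auto simp: emeasure_space_1)
  then show T_pos: "T > 0" using E_H by simp
  then have b: "b > 0" using n by (simp add: b_def)
  have "(\<integral>\<omega>. \<bar>zero_counting n (random_poly C n \<omega>) (annular_sector r \<alpha> \<beta>) - (\<beta> - \<alpha>) / (2 * pi)\<bar> \<partial>M)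
     \<le> (\<integral>\<omega>. K * ((H \<omega> / real n + b) / (2 * sqrt b)) \<partial>M)"
  proof (rule integral_mono_AE[OF int_Z])
    show "integrable M (\<lambda>\<omega>. K * ((H \<omega> / real n + b) / (2 * sqrt b)))"
      using int_H by (intro integrable_mult_right integrable_divide Bochner_Integration.integrable_add integrable_const)
    show "AE \<omega> in M. \<bar>zero_counting n (random_poly C n \<omega>) (annular_sector r \<alpha> \<beta>) - (\<beta> - \<alpha>) / (2 * pi)\<bar>
      \<le> K * ((H \<omega> / real n + b) / (2 * sqrt b))"
      using pt
    proof eventually_elim
      case (elim \<omega>)
      have "sqrt (H \<omega> / real n) \<le> (H \<omega> / real n + b) / (2 * sqrt b)"
        using elim b n by (intro sqrt_le_tangent) auto
      then have "K * sqrt (H \<omega> / real n) \<le> K * ((H \<omega> / real n + b) / (2 * sqrt b))"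
        using K by (intro mult_left_mono)
      with elim show ?case by linarith
    qed
  qed
  also have "\<dots> = K * (((\<integral>\<omega>. H \<omega> \<partial>M) / real n + b) / (2 * sqrt b))"
    using int_H by (simp add: prob_space)
  also have "\<dots> \<le> K * ((b + b) / (2 * sqrt b))"
    using K b E_H n by (intro mult_left_mono divide_right_mono add_right_mono) (auto simp: b_def divide_right_mono)
  also have "(b + b) / (2 * sqrt b) = sqrt b"
    using b by (simp add: field_simps)
  finally show "(\<integral>\<omega>. \<bar>zero_counting n (random_poly C n \<omega>) (annular_sector r \<alpha> \<beta>) - (\<beta> - \<alpha>) / (2 * pi)\<bar> \<partial>M)
    \<le> (4 / sqrt pi + 2 / (1 - r)) * sqrt (T / real n)" by (simp add: K_def b_def)
qed

section \<open>Equidistribution of the zeros of random polynomials\<close>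

text \<open>
  The positive part of \<open>ln X\<close> is at most \<open>X\<^sup>t / t\<close>, so only the negative part can have infinite
  expectation.
\<close>

lemma ext_expectation_ln_cases:
  fixes X :: "'a \<Rightarrow> real"
  assumes M: "prob_space M" and X: "X \<in> borel_measurable M" "\<And>\<omega>. X \<omega> \<ge> 0"
    and t: "t > 0" and int: "integrable M (\<lambda>\<omega>. X \<omega> powr t)"
  obtains "ext_expectation M (\<lambda>\<omega>. ln (X \<omega>)) = -\<infinity>"
  | "integrable M (\<lambda>\<omega>. ln (X \<omega>))" "ext_expectation M (\<lambda>\<omega>. ln (X \<omega>)) = ereal (\<integral>\<omega>. ln (X \<omega>) \<partial>M)"
proof -
  let ?pos = "\<integral>\<^sup>+\<omega>. ennreal (ln (X \<omega>)) \<partial>M" and ?neg = "\<integral>\<^sup>+\<omega>. ennreal (- ln (X \<omega>)) \<partial>M"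
  have ln_le: "ln (X \<omega>) \<le> X \<omega> powr t / t" for \<omega>
  proof (cases "X \<omega> = 0")
    case False
    then have "X \<omega> > 0" using X(2)[of \<omega>] by simp
    then have "t * ln (X \<omega>) \<le> X \<omega> powr t"
      using ln_le_minus_one[of "X \<omega> powr t"] by (simp add: ln_powr)
    then show ?thesis using t by (simp add: field_simps)
  qed simp
  have pos_fin: "?pos < \<infinity>"
  proof -
    have "?pos \<le> (\<integral>\<^sup>+\<omega>. ennreal (X \<omega> powr t / t) \<partial>M)"
      using ln_le by (intro nn_integral_mono ennreal_leI)
    also have "\<dots> = ennreal (\<integral>\<omega>. X \<omega> powr t / t \<partial>M)"
      using int t by (intro nn_integral_eq_integral integrable_divide) auto
    finally show ?thesis by (simp add: le_less_trans)
  qed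
  show thesis
  proof (cases "?neg = \<infinity>")
    case True
    have "enn2ereal ?pos \<noteq> \<infinity>" using pos_fin by (metis enn2ereal_eq_top_iff infinity_ennreal_def less_irrefl)
    then have "enn2ereal ?pos - enn2ereal ?neg = -\<infinity>"
      using True by (cases "enn2ereal ?pos") auto
    then show ?thesis by (intro that(1)) (simp add: ext_expectation_def)
  next
    case False
    have neg_fin: "?neg < \<infinity>" using False by (simp add: less_top)
    have int_ln: "integrable M (\<lambda>\<omega>. ln (X \<omega>))"
      using X(1) pos_fin neg_fin by (auto simp: real_integrable_def)
    have "ext_expectation M (\<lambda>\<omega>. ln (X \<omega>)) = ereal (enn2real ?pos) - ereal (enn2real ?neg)"
    proof -
      have "enn2ereal u = ereal (enn2real u)" if "u < \<infinity>" for u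
        using that by (cases u) simp_all
      from this[OF pos_fin] this[OF neg_fin] show ?thesis
        unfolding ext_expectation_def by (rule arg_cong2[of _ _ _ _ "(-)"])
    qed
    then show ?thesis using that(2) int_ln real_lebesgue_integral_def[OF int_ln] by simp
  qed
qed

theorem theorem3p3:
  fixes M :: "'a measure" and C :: "nat \<Rightarrow> 'a \<Rightarrow> complex" and t r \<alpha> \<beta> :: real
  assumes "prob_space M"
    and "prob_space.indep_vars M (\<lambda>_. borel) C UNIV"
    and "\<And>k. distr M borel (C k) = distr M borel (C 0)"
    and "\<exists>f. distributed M lborel (C 0) f"
    and "t > 0"
    and "integrable M (\<lambda>\<omega>. norm (C 0 \<omega>) powr t)"
    and "0 < r" and "r < 1"
    and "0 \<le> \<alpha>" and "\<alpha> < \<beta>" and "\<beta> < 2 * pi"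
  shows "\<forall>\<^sub>F n in sequentially.
    integrable M (\<lambda>\<omega>. \<bar>zero_counting n (random_poly C n \<omega>) (annular_sector r \<alpha> \<beta>)
                        - (\<beta> - \<alpha>) / (2 * pi)\<bar>) \<and>
    ereal (\<integral>\<omega>. \<bar>zero_counting n (random_poly C n \<omega>) (annular_sector r \<alpha> \<beta>)
                 - (\<beta> - \<alpha>) / (2 * pi)\<bar> \<partial>M)
    \<le> ereal (sqrt (2 * pi / catalan_constant) + 2 / (1 - r)) *
       ereal_sqrt
         ((ereal ((t + 2) / (2 * t) * ln (real n + 1)
                  + (1 / t) * ln (\<integral>\<omega>. norm (C 0 \<omega>) powr t \<partial>M)
                  + 1 / (2 * exp 1))
           - ext_expectation M (\<lambda>\<omega>. ln (norm (C 0 \<omega>)))) / ereal (real n))"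
proof -
  interpret prob_space M by (rule assms(1))
  have C: "C k \<in> borel_measurable M" for k
    using assms(2) unfolding indep_vars_def by simp
  obtain f where f: "distributed M lborel (C 0) f" using assms(4) by blast
  have nz: "AE \<omega> in M. C k \<omega> \<noteq> 0" for k
    by (rule AE_nonzero_if_distributed_lborel[OF f C assms(3)])
  let ?Z = "\<lambda>n \<omega>. \<bar>zero_counting n (random_poly C n \<omega>) (annular_sector r \<alpha> \<beta>) - (\<beta> - \<alpha>) / (2 * pi)\<bar>"
  let ?K = "sqrt (2 * pi / catalan_constant) + 2 / (1 - r)"
  have K: "?K > 0" using catalan_constant_bounds assms(8) by (intro add_nonneg_pos) auto
  obtain A :: "nat \<Rightarrow> complex set" where A: "\<And>i. compact (A i)" "\<And>i. A i \<subseteq> A (Suc i)"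
    "annular_sector r \<alpha> \<beta> = (\<Union>i. A i)"
    using annular_sector_sigma_compact[OF assms(7,9,11)] by blast
  have int_Z: "integrable M (?Z n)" for n
  proof (rule integrable_const_bound)
    show "?Z n \<in> borel_measurable M"
      unfolding A(3)
      by (intro borel_measurable_abs borel_measurable_diff borel_measurable_const
          zero_counting_measurable[where C = C and n = n and A = A, OF C A(1,2)])
    have "zero_counting n (random_poly C n \<omega>) (annular_sector r \<alpha> \<beta>) \<le> 1" for \<omega>
    proof -
      have "size (filter_mset (\<lambda>z. z \<in> annular_sector r \<alpha> \<beta>) (proots (random_poly C n \<omega>))) \<le> size (proots (random_poly C n \<omega>))"
        by (rule size_filter_mset_lesseq)
      also have "\<dots> \<le> n"
        using size_proots_le[of "random_poly C n \<omega>"] degree_le[of n "random_poly C n \<omega>"] by (simp add: coeff_random_poly)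
      finally show ?thesis unfolding zero_counting_eq_size by (cases "n = 0") (auto simp: divide_le_eq_1)
    qed
    moreover have "0 \<le> zero_counting n (random_poly C n \<omega>) (annular_sector r \<alpha> \<beta>)" for \<omega>
      unfolding zero_counting_eq_size by simp
    moreover have "0 \<le> (\<beta> - \<alpha>) / (2 * pi)" "(\<beta> - \<alpha>) / (2 * pi) \<le> 1" using assms(9-11) by (auto simp: field_simps)
    ultimately show "AE \<omega> in M. norm (?Z n \<omega>) \<le> 1"
      by (intro AE_I2) (smt (verit) real_norm_def)
  qed
  \<comment> \<open>the part of the coefficient of \<open>ln (n + 1)\<close> that the estimate of the height does not use\<close>
  define gap where "gap = (t + 2) / (2 * t) - (if t \<le> 2 then 1 / t else 1 / 2)"
  have gap: "gap > 0" using assms(5) by (auto simp: gap_def field_simps)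
  have "filterlim (\<lambda>n. gap * ln (real n + 1)) at_top sequentially"
    using gap by real_asymp
  then have ev: "\<forall>\<^sub>F n in sequentially. ln 2 / 2 \<le> gap * ln (real n + 1)"
    unfolding filterlim_at_top by (rule spec)
  show ?thesis
    using ev eventually_gt_at_top[of 0]
  proof eventually_elim
    case (elim n)
    consider "ext_expectation M (\<lambda>\<omega>. ln (norm (C 0 \<omega>))) = -\<infinity>"
      | "integrable M (\<lambda>\<omega>. ln (norm (C 0 \<omega>)))"
        "ext_expectation M (\<lambda>\<omega>. ln (norm (C 0 \<omega>))) = ereal (\<integral>\<omega>. ln (norm (C 0 \<omega>)) \<partial>M)"
      using ext_expectation_ln_cases[OF assms(1) _ _ assms(5,6)] C[of 0] by auto
    then show ?case
    proof cases
      case 1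
      have "ereal ?K * \<infinity> = \<infinity>" using K by simp
      then show ?thesis using int_Z elim by (simp add: 1 ereal_sqrt_def)
    next
      case 2
      define T where "T = (t + 2) / (2 * t) * ln (real n + 1) + (1 / t) * ln (\<integral>\<omega>. norm (C 0 \<omega>) powr t \<partial>M)
        + 1 / (2 * exp 1) - (\<integral>\<omega>. ln (norm (C 0 \<omega>)) \<partial>M)"
      have T: "ln 2 / 2 + (if t \<le> 2 then 1 / t else 1 / 2) * ln (real n + 1)
          + ln (\<integral>\<omega>. norm (C 0 \<omega>) powr t \<partial>M) / t - (\<integral>\<omega>. ln (norm (C 0 \<omega>)) \<partial>M) \<le> T"
      proof -
        have "(t + 2) / (2 * t) * ln (real n + 1) = gap * ln (real n + 1) + (if t \<le> 2 then 1 / t else 1 / 2) * ln (real n + 1)"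
          unfolding gap_def by (simp only: left_diff_distrib)
        moreover have "0 \<le> 1 / (2 * exp (1::real))" by simp
        moreover have "1 / t * ln (\<integral>\<omega>. norm (C 0 \<omega>) powr t \<partial>M) = ln (\<integral>\<omega>. norm (C 0 \<omega>) powr t \<partial>M) / t" by simp
        ultimately show ?thesis
          using elim(1) unfolding T_def by linarith
      qed
      note bound = expected_discrepancy_le[OF assms(1) C assms(3) nz assms(5,6) 2(1) assms(7-11) elim(2) int_Z T]
      have "(4 / sqrt pi + 2 / (1 - r)) * sqrt (T / real n) \<le> ?K * sqrt (T / real n)"
        by (rule mult_right_mono[OF add_right_mono[OF four_div_sqrt_pi_le]]) (use bound(1) in simp)
      with bound(2) have "(\<integral>\<omega>. ?Z n \<omega> \<partial>M) \<le> ?K * sqrt (T / real n)" by linarith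
      then show ?thesis
        using int_Z elim by (simp add: 2(2) T_def ereal_sqrt_def)
    qed
  qed
qed

end
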